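(* Let $\mathscr{R}$ be a finite von Neumann algebra with a faithful normal tracial state $\tau$, let $\mathscr{S}$ be a von Neumann subalgebra of $\mathscr{R}$, and let $\Phi:\mathscr{R}\to\mathscr{S}$ be a $\tau$-preserving conditional expectation from $\mathscr{R}$ onto $\mathscr{S}$. Let $\Delta$ denote the Fuglede-Kadison determinant on $\mathscr{R}$ associated with $\tau$. For any regular positive operator $A$ in $\mathscr{R}$, $$\Delta(\Phi(A^{-1})^{-1}) \le \Delta(A) \le \Delta(\Phi(A)),$$ with equality on either side if and only if $\Phi(A)=A$, i.e. $A\in\mathscr{S}$. If $A$ is positive (but not necessarily regular), one still has the inequality on the right, i.e. $\Delta(A)\le\Delta(\Phi(A))$.
   Context: Von Neumann algebras act on a separable complex Hilbert space and contain the identity operator $I$; $\mathscr{S}$ contains the identity $I$ of $\mathscr{R}$. "Regular" means invertible (with bounded inverse). Conditional expectation: a map $\Phi:\mathscr{R}\to\mathscr{S}$ that is linear, positive, with $\Phi(I)=I$, and $\Phi(S_1RS_2)=S_1\Phi(R)S_2$ for all $R\in\mathscr{R}$, $S_1,S_2\in\mathscr{S}$. It is $\tau$-preserving if $\tau(\Phi(R))=\tau(R)$ for all $R\in\mathscr{R}$. Fuglede-Kadison determinant (analytic extension): for regular $A\in\mathscr{R}$, $\Delta(A)=\exp(\tau(\log (A^*A)^{1/2}))$; for general $A\in\mathscr{R}$ with spectral decomposition $(A^*A)^{1/2}=\int\lambda\,dE_\lambda$, $\Delta(A)=\exp\left(\int\log\lambda\,d\tau(E_\lambda)\right)$, with $\Delta(A)=0$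 if $\int\log\lambda\,d\tau(E_\lambda)=-\infty$. *)

theory Defs
  imports "HOL-Analysis.Analysis"
begin

section \<open>Complex Hilbert spaces\<close>

class complex_vector = real_vector +
  fixes scaleC :: "complex \<Rightarrow> 'a \<Rightarrow> 'a"  (infixr \<open>*\<^sub>C\<close> 75)
  assumes scaleC_add_right: "c *\<^sub>C (x + y) = c *\<^sub>C x + c *\<^sub>C y"
    and scaleC_add_left: "(c + d) *\<^sub>C x = c *\<^sub>C x + d *\<^sub>C x"
    and scaleC_scaleC: "c *\<^sub>C (d *\<^sub>C x) = (c * d) *\<^sub>C x"
    and scaleR_scaleC: "r *\<^sub>R x = complex_of_real r *\<^sub>C x"

text \<open>
  The complex inner product is linear in its first argument.  Its real part is the real inner
  product of the library, which supplies the norm, the topology and positive definiteness.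
\<close>

class complex_inner = complex_vector + real_inner +
  fixes cinner :: "'a \<Rightarrow> 'a \<Rightarrow> complex"
  assumes cinner_commute: "cinner x y = cnj (cinner y x)"
    and cinner_add_left: "cinner (x + y) z = cinner x z + cinner y z"
    and cinner_scaleC_left: "cinner (c *\<^sub>C x) y = c * cinner x y"
    and inner_eq_Re_cinner: "inner x y = Re (cinner x y)"

class complex_hilbert = complex_inner + complete_space

lemma cinner_same: "cinner x x = complex_of_real ((norm x)\<^sup>2)"
proof (rule complex_eqI)
  show "Re (cinner x x) = Re (complex_of_real ((norm x)\<^sup>2))"
    using inner_eq_Re_cinner[of x x] by (simp add: power2_norm_eq_inner)
  show "Im (cinner x x) = Im (complex_of_real ((norm x)\<^sup>2))"
    using cinner_commute[of x x] by (simp add: complex_eq_iff)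
qed

lemma norm_scaleC: "norm (c *\<^sub>C x) = cmod c * norm (x :: 'a::complex_inner)"
proof -
  have "cinner (c *\<^sub>C x) (c *\<^sub>C x) = c * cnj c * cinner x x"
    using cinner_commute[of x "c *\<^sub>C x"] cinner_commute[of x x]
    by (simp add: cinner_scaleC_left)
  then have "complex_of_real ((norm (c *\<^sub>C x))\<^sup>2) = complex_of_real ((cmod c * norm x)\<^sup>2)"
    by (simp add: cinner_same power_mult_distrib flip: complex_norm_square of_real_power of_real_mult)
  then have "(norm (c *\<^sub>C x))\<^sup>2 = (cmod c * norm x)\<^sup>2"
    using of_real_eq_iff by blast
  then show ?thesis
    by (simp add: power2_eq_iff_nonneg)
qed

lemma bounded_linear_scaleC: "bounded_linear (\<lambda>x :: 'a::complex_inner. c *\<^sub>C x)"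
proof (rule bounded_linear_intro[where K = "cmod c"])
  show "c *\<^sub>C (r *\<^sub>R x) = r *\<^sub>R (c *\<^sub>C x)" for r and x :: 'a
    by (simp add: scaleR_scaleC scaleC_scaleC mult.commute)
qed (simp_all add: scaleC_add_right norm_scaleC mult.commute)

instantiation complex :: complex_vector
begin
definition scaleC_complex :: "complex \<Rightarrow> complex \<Rightarrow> complex" where
  "scaleC_complex c z = c * z"
instance
  by standard (simp_all add: scaleC_complex_def algebra_simps scaleR_conv_of_real)
end

instantiation blinfun :: (real_normed_vector, complex_inner) complex_vector
begin
lift_definition scaleC_blinfun :: "complex \<Rightarrow> 'a \<Rightarrow>\<^sub>L 'b \<Rightarrow> 'a \<Rightarrow>\<^sub>L 'b"
  is "\<lambda>c A x. c *\<^sub>C A x"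
  by (rule bounded_linear_compose[OF bounded_linear_scaleC])
instance
  by standard (transfer, simp add: fun_eq_iff scaleC_add_right scaleC_add_left scaleC_scaleC
      scaleR_scaleC)+
end

definition clinear_on :: "'a::complex_vector set \<Rightarrow> ('a \<Rightarrow> 'b::complex_vector) \<Rightarrow> bool" where
  "clinear_on V f \<longleftrightarrow>
     (\<forall>x\<in>V. \<forall>y\<in>V. f (x + y) = f x + f y) \<and> (\<forall>c. \<forall>x\<in>V. f (c *\<^sub>C x) = c *\<^sub>C f x)"


section \<open>Bounded operators\<close>

text \<open>
  The type \<open>'h \<Rightarrow>\<^sub>L 'h\<close> consists of the bounded real-linear maps, so complex linearity is
  imposed separately.
\<close>

type_synonym 'h operator = "'h \<Rightarrow>\<^sub>L 'h"

definition bounded_operators :: "'h::complex_hilbert operator set" where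
  "bounded_operators = {A. clinear_on UNIV (blinfun_apply A)}"

definition adj :: "'h::complex_hilbert operator \<Rightarrow> 'h operator" where
  "adj A = (THE B :: 'h operator. \<forall>x y. cinner (A x) y = cinner x (B y))"

definition self_adjoint :: "'h::complex_hilbert operator \<Rightarrow> bool" where
  "self_adjoint A \<longleftrightarrow> A \<in> bounded_operators \<and> adj A = A"

definition positive_op :: "'h::complex_hilbert operator \<Rightarrow> bool" where
  "positive_op A \<longleftrightarrow> A \<in> bounded_operators \<and> (\<forall>x. cinner (A x) x \<in> \<real>\<^sub>\<ge>\<^sub>0)"

definition le_op :: "'h::complex_hilbert operator \<Rightarrow> 'h operator \<Rightarrow> bool" where
  "le_op A B \<longleftrightarrow> positive_op (B - A)"

definition projection :: "'h::complex_hilbert operator \<Rightarrow> bool" where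
  "projection P \<longleftrightarrow> self_adjoint P \<and> P o\<^sub>L P = P"

definition regular :: "'h::complex_hilbert operator \<Rightarrow> bool" where
  "regular A \<longleftrightarrow> (\<exists>B. A o\<^sub>L B = id_blinfun \<and> B o\<^sub>L A = id_blinfun)"

definition inv_op :: "'h::complex_hilbert operator \<Rightarrow> 'h operator" where
  "inv_op A = (THE B. A o\<^sub>L B = id_blinfun \<and> B o\<^sub>L A = id_blinfun)"

definition sqrt_op :: "'h::complex_hilbert operator \<Rightarrow> 'h operator" where
  "sqrt_op A = (THE B. positive_op B \<and> B o\<^sub>L B = A)"

definition abs_op :: "'h::complex_hilbert operator \<Rightarrow> 'h operator" where
  "abs_op A = sqrt_op (adj A o\<^sub>L A)"


section \<open>Spectral decomposition\<close>

text \<open>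
  \<open>\<integral> f(\<lambda>) d\<langle>E\<^sub>\<lambda> x, x\<rangle>\<close> is the Lebesgue--Stieltjes integral against \<open>spectral_measure E x\<close>.
\<close>

definition spectral_measure :: "(real \<Rightarrow> 'h::complex_hilbert operator) \<Rightarrow> 'h \<Rightarrow> real measure" where
  "spectral_measure E x = interval_measure (\<lambda>t. Re (cinner (E t x) x))"

text \<open>
  \<open>spectral_resolution E H\<close>: the family \<open>E\<close> is a resolution of the identity, increasing, strongly
  continuous from the right, supported in \<open>[-\<parallel>H\<parallel>, \<parallel>H\<parallel>]\<close>, with \<open>H = \<integral> \<lambda> dE\<^sub>\<lambda>\<close>.
\<close>

definition spectral_resolution ::
    "(real \<Rightarrow> 'h::complex_hilbert operator) \<Rightarrow> 'h operator \<Rightarrow> bool" where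
  "spectral_resolution E H \<longleftrightarrow>
     (\<forall>t. projection (E t)) \<and>
     (\<forall>s t. s \<le> t \<longrightarrow> le_op (E s) (E t)) \<and>
     (\<forall>t x. ((\<lambda>s. E s x) \<longlongrightarrow> E t x) (at_right t)) \<and>
     (\<forall>t < - norm H. E t = 0) \<and>
     (\<forall>t \<ge> norm H. E t = id_blinfun) \<and>
     (\<forall>x. cinner (H x) x = complex_of_real (\<integral>t. t \<partial>spectral_measure E x))"

text \<open>
  A self-adjoint \<open>H\<close> has exactly one spectral resolution, so the choice below is no choice.
\<close>

definition spectral_family :: "'h::complex_hilbert operator \<Rightarrow> real \<Rightarrow> 'h operator" where
  "spectral_family H = (SOME E. spectral_resolution E H)"

text \<open>Functional calculus \<open>f(H) = \<integral> f(\<lambda>) dE\<^sub>\<lambda>\<close>, for \<open>f\<close> bounded on the spectrum of \<open>H\<close>.\<close>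

definition op_fun :: "(real \<Rightarrow> real) \<Rightarrow> 'h::complex_hilbert operator \<Rightarrow> 'h operator" where
  "op_fun f H = (THE T. T \<in> bounded_operators \<and>
     (\<forall>x. cinner (T x) x = complex_of_real (\<integral>t. f t \<partial>spectral_measure (spectral_family H) x)))"


section \<open>Von Neumann algebras, traces and conditional expectations\<close>

definition von_neumann_algebra :: "'h::complex_hilbert operator set \<Rightarrow> bool" where
  "von_neumann_algebra R \<longleftrightarrow>
     R \<subseteq> bounded_operators \<and> id_blinfun \<in> R \<and>
     (\<forall>A\<in>R. \<forall>B\<in>R. A + B \<in> R) \<and> (\<forall>c. \<forall>A\<in>R. c *\<^sub>C A \<in> R) \<and>
     (\<forall>A\<in>R. \<forall>B\<in>R. A o\<^sub>L B \<in> R) \<and> (\<forall>A\<in>R. adj A \<in> R) \<and>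
     closedin strong_operator_topology R"

text \<open>Finiteness: the identity is not equivalent to a proper subprojection.\<close>

definition finite_von_neumann_algebra :: "'h::complex_hilbert operator set \<Rightarrow> bool" where
  "finite_von_neumann_algebra R \<longleftrightarrow> von_neumann_algebra R \<and>
     (\<forall>V\<in>R. adj V o\<^sub>L V = id_blinfun \<longrightarrow> V o\<^sub>L adj V = id_blinfun)"

definition state_on ::
    "'h::complex_hilbert operator set \<Rightarrow> ('h operator \<Rightarrow> complex) \<Rightarrow> bool" where
  "state_on R \<tau> \<longleftrightarrow> clinear_on R \<tau> \<and> (\<forall>A\<in>R. positive_op A \<longrightarrow> \<tau> A \<in> \<real>\<^sub>\<ge>\<^sub>0) \<and> \<tau> id_blinfun = 1"

text \<open>
  Normality: if a directed family \<open>D\<close> of self-adjoint elements has least upper bound \<open>H\<close>, then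
  \<open>\<tau>(H)\<close> is the supremum of \<open>\<tau>\<close> on \<open>D\<close>.  (States are real on self-adjoint elements.)
\<close>

definition normal_on ::
    "'h::complex_hilbert operator set \<Rightarrow> ('h operator \<Rightarrow> complex) \<Rightarrow> bool" where
  "normal_on R \<tau> \<longleftrightarrow>
     (\<forall>D H. D \<subseteq> {A \<in> R. self_adjoint A} \<and> D \<noteq> {} \<and>
        (\<forall>A\<in>D. \<forall>B\<in>D. \<exists>C\<in>D. le_op A C \<and> le_op B C) \<and>
        H \<in> R \<and> self_adjoint H \<and> (\<forall>A\<in>D. le_op A H) \<and>
        (\<forall>K\<in>R. self_adjoint K \<and> (\<forall>A\<in>D. le_op A K) \<longrightarrow> le_op H K)
        \<longrightarrow> Re (\<tau> H) = (SUP A\<in>D. Re (\<tau> A)))"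

definition faithful_normal_tracial_state ::
    "'h::complex_hilbert operator set \<Rightarrow> ('h operator \<Rightarrow> complex) \<Rightarrow> bool" where
  "faithful_normal_tracial_state R \<tau> \<longleftrightarrow>
     state_on R \<tau> \<and> normal_on R \<tau> \<and>
     (\<forall>A\<in>R. \<tau> (adj A o\<^sub>L A) = 0 \<longrightarrow> A = 0) \<and>
     (\<forall>A\<in>R. \<forall>B\<in>R. \<tau> (A o\<^sub>L B) = \<tau> (B o\<^sub>L A))"

definition conditional_expectation ::
    "'h::complex_hilbert operator set \<Rightarrow> 'h operator set \<Rightarrow> ('h operator \<Rightarrow> 'h operator) \<Rightarrow> bool"
  where
  "conditional_expectation R S \<Phi> \<longleftrightarrow>
     \<Phi> \<in> R \<rightarrow> S \<and> clinear_on R \<Phi> \<and> (\<forall>A\<in>R. positive_op A \<longrightarrow> positive_op (\<Phi> A)) \<and>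
     \<Phi> id_blinfun = id_blinfun \<and>
     (\<forall>A\<in>R. \<forall>S1\<in>S. \<forall>S2\<in>S. \<Phi> (S1 o\<^sub>L A o\<^sub>L S2) = S1 o\<^sub>L \<Phi> A o\<^sub>L S2)"

definition preserves_on ::
    "'h::complex_hilbert operator set \<Rightarrow> ('h operator \<Rightarrow> complex) \<Rightarrow> ('h operator \<Rightarrow> 'h operator) \<Rightarrow> bool"
  where
  "preserves_on R \<tau> \<Phi> \<longleftrightarrow> (\<forall>A\<in>R. \<tau> (\<Phi> A) = \<tau> A)"


section \<open>The Fuglede--Kadison determinant\<close>

text \<open>The measure \<open>d\<tau>(E\<^sub>\<lambda>)\<close>, where \<open>E\<close> is the spectral family of \<open>H\<close>.\<close>

definition trace_measure ::
    "('h::complex_hilbert operator \<Rightarrow> complex) \<Rightarrow> 'h operator \<Rightarrow> real measure" where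
  "trace_measure \<tau> H = interval_measure (\<lambda>t. Re (\<tau> (spectral_family H t)))"

text \<open>
  In the singular case \<open>trace_measure \<tau> (abs_op A)\<close> is a probability measure on
  \<open>[0, \<parallel>A\<parallel>]\<close>.  As \<open>log\<close> is bounded above there, \<open>\<integral> log \<lambda> d\<tau>(E\<^sub>\<lambda>)\<close> always exists in
  \<open>[-\<infinity>, \<infinity>)\<close>; it is \<open>-\<infinity>\<close> iff \<open>{0}\<close> has positive mass (where \<open>log 0 = -\<infinity>\<close>, whereas
  \<open>ln 0 = 0\<close> in HOL) or \<open>ln\<close> is not integrable.
\<close>

definition FK_det :: "('h::complex_hilbert operator \<Rightarrow> complex) \<Rightarrow> 'h operator \<Rightarrow> real" where
  "FK_det \<tau> A =
     (if regular A then exp (Re (\<tau> (op_fun ln (abs_op A))))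
      else if (AE t in trace_measure \<tau> (abs_op A). 0 < t) \<and> integrable (trace_measure \<tau> (abs_op A)) ln
      then exp (\<integral>t. ln t \<partial>trace_measure \<tau> (abs_op A))
      else 0)"

end

theory Submission
  imports Defs "HOL-Probability.Distribution_Functions"
begin

text \<open>
  Write \<open>B = \<Phi>(A)\<close>.  For \<open>t\<close> with \<open>A + t\<close> bounded below, the second-order expansion of the inverse gives
  \<open>\<tau>((A + t)\<^sup>-\<^sup>1) \<ge> \<tau>((B + t)\<^sup>-\<^sup>1)\<close>: the first-order term has trace \<open>0\<close> because \<open>\<Phi>\<close> is a
  \<open>\<tau>\<close>-preserving bimodule map, and the remainder is positive and vanishes only if \<open>A = B\<close>.  Hence
  \<open>g(t) = \<tau>(log (B + t)) - \<tau>(log (A + t))\<close> has derivative \<open>\<le> 0\<close>.  As \<open>g(t) \<rightarrow> 0\<close> for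
  \<open>t \<rightarrow> \<infinity>\<close>, it is nonnegative, and if it vanishes somewhere then \<open>A = B\<close>.  The left inequality is the right
  one for \<open>A\<^sup>-\<^sup>1\<close>, and singular operators are reached by letting \<open>t\<close> decrease to \<open>0\<close>.

  The spectral theorem behind this needs no adjoints: everything takes place among symmetric operators for
  the real inner product, and complex linearity is preserved by strong limits.
\<close>

section \<open>Symmetric operators on a real Hilbert space\<close>

text \<open>The determinants of \<open>A\<close> and \<open>\<Phi> A\<close> are never joined by a
  path of operators. Each logarithm is differentiated only in the scalar shift \<open>t\<close>,
  inside the commutative algebra generated by one operator, so no derivative of a noncommutative
  function occurs; noncommutativity is confined to one resolvent identity. The bulk of the work has
  another cause: the determinant is defined through descriptions (\<open>SOME\<close>,
  \<open>THE\<close>), which say nothing until spectral resolutions are known to exist and to be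
  unique. Both rest on one fact: \<open>p(A)\<close> is positive when the polynomial
  \<open>p\<close> is nonnegative on an interval bounding the form of \<open>A\<close>. Bernstein
  polynomials give it without a notion of spectrum. Riemann sum estimates are kept uniform over all
  quadratic forms, which makes them norm estimates, and a state passes through these directly.
  Normality enters to make the distribution function of the trace right-continuous.\<close>

definition sym_op :: "'h::real_inner operator \<Rightarrow> bool" where
  "sym_op T \<longleftrightarrow> (\<forall>x y. T x \<bullet> y = x \<bullet> T y)"

text \<open>Stands in for a bound on the spectrum: only the quadratic form is controlled. On the
  zero space the form bounds hold for all \<open>a\<close> and \<open>b\<close>, so
  \<open>a \<le> b\<close> is demanded separately; it keeps \<open>{a..b}\<close> nonempty.\<close>

definition between :: "real \<Rightarrow> real \<Rightarrow> 'h::real_inner operator \<Rightarrow> bool" where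
  "between a b A \<longleftrightarrow> a \<le> b \<and> sym_op A \<and> (\<forall>x. a * (x \<bullet> x) \<le> A x \<bullet> x \<and> A x \<bullet> x \<le> b * (x \<bullet> x))"

lemma sym_opD: "sym_op T \<Longrightarrow> T x \<bullet> y = x \<bullet> T y"
  by (simp add: sym_op_def)

lemma sym_op_id [simp]: "sym_op id_blinfun"
  by (simp add: sym_op_def)

lemma sym_op_0 [simp]: "sym_op 0"
  by (simp add: sym_op_def)

lemma sym_op_add: "sym_op S \<Longrightarrow> sym_op T \<Longrightarrow> sym_op (S + T)"
  by (simp add: sym_op_def blinfun.add_left inner_add)

lemma sym_op_diff: "sym_op S \<Longrightarrow> sym_op T \<Longrightarrow> sym_op (S - T)"
  by (simp add: sym_op_def blinfun.diff_left inner_diff)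

lemma sym_op_scaleR: "sym_op S \<Longrightarrow> sym_op (c *\<^sub>R S)"
  by (simp add: sym_op_def blinfun.scaleR_left)

lemma sym_op_compose: "sym_op S \<Longrightarrow> sym_op T \<Longrightarrow> S o\<^sub>L T = T o\<^sub>L S \<Longrightarrow> sym_op (S o\<^sub>L T)"
  unfolding sym_op_def by (metis blinfun_apply_blinfun_compose)

lemma sym_op_sum: "(\<And>i. i \<in> I \<Longrightarrow> sym_op (f i)) \<Longrightarrow> sym_op (sum f I)"
  by (induction I rule: infinite_finite_induct) (auto simp: sym_op_add)

lemma sym_op_limit:
  fixes L :: "'h::real_inner operator"
  assumes "\<And>n::nat. sym_op (X n)" "\<And>x. (\<lambda>n. X n x) \<longlonglongrightarrow> L x"
  shows "sym_op L"
  unfolding sym_op_def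
proof (intro allI)
  fix x y
  have "(\<lambda>n. X n x \<bullet> y) \<longlonglongrightarrow> L x \<bullet> y" "(\<lambda>n. x \<bullet> X n y) \<longlonglongrightarrow> x \<bullet> L y"
    by (intro tendsto_intros assms)+
  moreover have "(\<lambda>n. X n x \<bullet> y) = (\<lambda>n. x \<bullet> X n y)"
    using assms(1) by (auto simp: sym_op_def)
  ultimately show "L x \<bullet> y = x \<bullet> L y"
    using LIMSEQ_unique by metis
qed

text \<open>Polarisation: symmetry makes \<open>4 * (T x \<bullet> y)\<close> the difference of the
  form at \<open>x + y\<close> and at \<open>x - y\<close>, and the parallelogram law adds up the
  two bounds.\<close>

lemma sym_op_norm_le:
  assumes T: "sym_op T" and bd: "\<And>x. \<bar>T x \<bullet> x\<bar> \<le> c * (x \<bullet> x)" and c: "0 \<le> c"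
  shows "norm T \<le> c"
proof (rule norm_blinfun_bound[OF c])
  fix x
  show "norm (T x) \<le> c * norm x"
  proof (cases "T x = 0 \<or> x = 0")
    case True
    then show ?thesis using c by (auto simp: blinfun.zero_right)
  next
    case False
    \<comment> \<open>The factor stretches \<open>T x\<close> to the length of \<open>x\<close>: the
      bound becomes \<open>4 * c * (norm x)\<^sup>2\<close>, while \<open>T x \<bullet> y\<close> is
      \<open>norm x * norm (T x)\<close>.\<close>
    define r where "r = norm x / norm (T x)"
    define y where "y = r *\<^sub>R T x"
    have ny: "norm y = norm x" using False by (simp add: y_def r_def)
    have "4 * (T x \<bullet> y) = T (x + y) \<bullet> (x + y) - T (x - y) \<bullet> (x - y)"
      using sym_opD[OF T, of y x]
      by (simp add: blinfun.add_right blinfun.diff_right inner_add inner_diff inner_commute algebra_simps)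
    also have "\<dots> \<le> c * ((x + y) \<bullet> (x + y)) + c * ((x - y) \<bullet> (x - y))"
      using bd[of "x + y"] bd[of "x - y"] by linarith
    also have "\<dots> = 2 * c * (x \<bullet> x + y \<bullet> y)"
      by (simp add: inner_add inner_diff inner_commute algebra_simps)
    also have "\<dots> = 4 * c * (norm x)\<^sup>2"
      by (simp add: ny flip: power2_norm_eq_inner)
    finally have "T x \<bullet> y \<le> c * (norm x)\<^sup>2" by simp
    moreover have "T x \<bullet> y = norm x * norm (T x)"
      using False by (simp add: y_def r_def power2_eq_square flip: power2_norm_eq_inner)
    ultimately show ?thesis
      using False by (simp add: power2_eq_square)
  qed
qed

text \<open>A skew operator on a real space has zero form, so the form determines an operator only
  among the symmetric ones; this is why symmetry is recorded throughout.\<close>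

lemma sym_op_eqI:
  assumes "sym_op S" "sym_op T" "\<And>x. S x \<bullet> x = T x \<bullet> x"
  shows "S = T"
proof -
  have "norm (S - T) \<le> 0"
    by (rule sym_op_norm_le) (auto simp: assms sym_op_diff blinfun.diff_left inner_diff_left)
  then show ?thesis by simp
qed

lemma form_bound: "\<bar>T x \<bullet> x\<bar> \<le> norm T * (x \<bullet> x)" for T :: "'h::real_inner operator"
proof -
  have "\<bar>T x \<bullet> x\<bar> \<le> norm (T x) * norm x" by (rule Cauchy_Schwarz_ineq2)
  also have "\<dots> \<le> norm T * norm x * norm x" by (intro mult_right_mono norm_blinfun) auto
  finally show ?thesis by (simp add: power2_eq_square flip: power2_norm_eq_inner)
qed

lemma between_norm:
  assumes "sym_op A"
  shows "between (- norm A) (norm A) A"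
  using assms form_bound[of A] norm_ge_zero[of A]
  by (auto simp: between_def abs_le_iff minus_le_iff simp del: norm_ge_zero)

lemma between_mono: "between a b A \<Longrightarrow> a' \<le> a \<Longrightarrow> b \<le> b' \<Longrightarrow> between a' b' A"
  unfolding between_def by (meson inner_ge_zero mult_right_mono order_trans)

lemma between_sym: "between a b A \<Longrightarrow> sym_op A"
  by (simp add: between_def)

lemma inner_sandwich: "sym_op Q \<Longrightarrow> (Q o\<^sub>L T o\<^sub>L Q) x \<bullet> x = T (Q x) \<bullet> Q x"
  by (simp add: sym_opD)

section \<open>Polynomials of an operator\<close>

definition poly_op :: "real poly \<Rightarrow> 'h::real_normed_vector operator \<Rightarrow> 'h operator" where
  "poly_op p A = fold_coeffs (\<lambda>c T. c *\<^sub>R id_blinfun + (A o\<^sub>L T)) p 0"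

lemma blinfun_compose_0 [simp]: "A o\<^sub>L 0 = 0" "0 o\<^sub>L A = 0"
  by (auto intro: blinfun_eqI simp: blinfun.zero_right)

lemma blinfun_compose_assoc: "(A o\<^sub>L B) o\<^sub>L C = A o\<^sub>L (B o\<^sub>L C)"
  by (auto intro: blinfun_eqI)

lemma blinfun_compose_id [simp]: "A o\<^sub>L id_blinfun = A" "id_blinfun o\<^sub>L A = A"
  by (auto intro: blinfun_eqI)

lemma blinfun_compose_add:
  "A o\<^sub>L (B + C) = (A o\<^sub>L B) + (A o\<^sub>L C)" "(B + C) o\<^sub>L A = (B o\<^sub>L A) + (C o\<^sub>L A)"
  by (auto intro: blinfun_eqI simp: blinfun.bilinear_simps)

lemma blinfun_compose_diff:
  "A o\<^sub>L (B - C) = (A o\<^sub>L B) - (A o\<^sub>L C)" "(B - C) o\<^sub>L A = (B o\<^sub>L A) - (C o\<^sub>L A)"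
  by (auto intro: blinfun_eqI simp: blinfun.bilinear_simps)

lemma blinfun_compose_scaleR:
  "A o\<^sub>L (c *\<^sub>R B) = c *\<^sub>R (A o\<^sub>L B)" "(c *\<^sub>R B) o\<^sub>L A = c *\<^sub>R (B o\<^sub>L A)"
  by (auto intro: blinfun_eqI simp: blinfun.bilinear_simps)

lemma blinfun_compose_sum:
  "A o\<^sub>L sum f I = (\<Sum>i\<in>I. A o\<^sub>L f i)" "sum f I o\<^sub>L A = (\<Sum>i\<in>I. f i o\<^sub>L A)"
  by (induction I rule: infinite_finite_induct) (auto simp: blinfun_compose_add)

lemma poly_op_0 [simp]: "poly_op 0 A = 0"
  by (simp add: poly_op_def)

lemma poly_op_pCons [simp]: "poly_op (pCons c p) A = c *\<^sub>R id_blinfun + (A o\<^sub>L poly_op p A)"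
  by (cases "p = 0 \<and> c = 0") (auto simp: poly_op_def)

lemma poly_op_1 [simp]: "poly_op 1 A = id_blinfun"
  by (simp add: one_pCons)

lemma poly_op_add: "poly_op (p + q) A = poly_op p A + poly_op q A"
  by (induction p q rule: poly_induct2) (auto simp: blinfun_compose_add algebra_simps)

lemma poly_op_smult: "poly_op (smult c p) A = c *\<^sub>R poly_op p A"
  by (induction p) (auto simp: blinfun_compose_scaleR algebra_simps)

lemma poly_op_uminus: "poly_op (- p) A = - poly_op p A"
  using poly_op_smult[of "-1" p A] by simp

lemma poly_op_diff: "poly_op (p - q) A = poly_op p A - poly_op q A"
  using poly_op_add[of p "- q" A] by (simp add: poly_op_uminus)

lemma poly_op_sum: "poly_op (sum f I) A = (\<Sum>i\<in>I. poly_op (f i) A)"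
  by (induction I rule: infinite_finite_induct) (auto simp: poly_op_add)

lemma poly_op_mult: "poly_op (p * q) A = poly_op p A o\<^sub>L poly_op q A"
  by (induction p)
    (auto simp: poly_op_add poly_op_smult blinfun_compose_add blinfun_compose_scaleR blinfun_compose_assoc)

lemma poly_op_pcompose: "poly_op (pcompose p q) A = poly_op p (poly_op q A)"
  by (induction p) (auto simp: pcompose_pCons poly_op_add poly_op_mult)

lemma poly_op_commute: "poly_op p A o\<^sub>L poly_op q A = poly_op q A o\<^sub>L poly_op p A"
  by (metis poly_op_mult mult.commute)

lemma poly_op_commute_self: "A o\<^sub>L poly_op p A = poly_op p A o\<^sub>L A"
  using poly_op_commute[of "[:0, 1:]" A p] by simp

lemma sym_op_poly_op: "sym_op A \<Longrightarrow> sym_op (poly_op p A)"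
  by (induction p) (auto intro!: sym_op_add sym_op_scaleR sym_op_compose simp: poly_op_commute_self)

lemma tendsto_poly_op:
  "(X \<longlongrightarrow> A) F \<Longrightarrow> ((\<lambda>n. poly_op p (X n)) \<longlongrightarrow> poly_op p A) F"
  by (induction p) (auto intro!: tendsto_intros bounded_bilinear.tendsto[OF bounded_bilinear_blinfun_compose])

text \<open>
  Bernstein's certificate: a polynomial that is nonnegative on \<open>[0, 1]\<close> becomes, after adding any
  \<open>e > 0\<close>, a combination with nonnegative coefficients of the polynomials \<open>x\<^sup>k (1 - x)\<^sup>l\<close>.
  These are positive at every operator between \<open>0\<close> and \<open>1\<close>.
\<close>

lemma poly_op_bernstein_nonneg:
  assumes "between 0 1 X"
  shows "0 \<le> poly_op ([:0, 1:] ^ k * [:1, -1:] ^ l) X x \<bullet> x"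
proof -
  have X: "sym_op X" using assms by (rule between_sym)
  \<comment> \<open>Halving the exponents leaves a sandwich \<open>q * r * q\<close> in which
    \<open>r\<close> has exponents at most 1, hence four cases.\<close>
  define q where "q = [:0, 1:] ^ (k div 2) * ([:1, -1:] ^ (l div 2) :: real poly)"
  define r where "r = [:0, 1:] ^ (k mod 2) * ([:1, -1:] ^ (l mod 2) :: real poly)"
  have *: "z ^ k = z ^ (k div 2) * z ^ (k div 2) * z ^ (k mod 2)" for z :: "real poly" and k
    by (metis div_mult_mod_eq mult_2_right power_add)
  have "[:0, 1:] ^ k * [:1, -1:] ^ l = q * r * q"
    unfolding q_def r_def by (subst (1 2) *) (simp only: mult_ac)
  then have eq: "poly_op ([:0, 1:] ^ k * [:1, -1:] ^ l) X x \<bullet> x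
      = poly_op r X (poly_op q X x) \<bullet> poly_op q X x"
    by (simp only: poly_op_mult inner_sandwich[OF sym_op_poly_op[OF X]])
  have lin: "0 \<le> X z \<bullet> z" "0 \<le> poly_op [:1, -1:] X z \<bullet> z" for z
    using assms by (auto simp: between_def blinfun.bilinear_simps inner_diff_left)
  have "0 \<le> poly_op r X z \<bullet> z" for z
  proof -
    consider "k mod 2 = 0" "l mod 2 = 0" | "k mod 2 = 1" "l mod 2 = 0"
      | "k mod 2 = 0" "l mod 2 = 1" | "k mod 2 = 1" "l mod 2 = 1"
      by linarith
    then show ?thesis
    proof cases
      case 4
      \<comment> \<open>Since \<open>x + (1 - x) = 1\<close>, the product \<open>x (1 - x)\<close>
        is a sum of two sandwiches of positive factors; this replaces the usual square root.\<close>
      have "r = [:0, 1:] * [:1, -1:] * [:0, 1:] + [:1, -1:] * [:0, 1:] * [:1, -1:]"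
        by (simp add: r_def 4)
      then have "poly_op r X z \<bullet> z = poly_op [:1, -1:] X (poly_op [:0, 1:] X z) \<bullet> poly_op [:0, 1:] X z
          + poly_op [:0, 1:] X (poly_op [:1, -1:] X z) \<bullet> poly_op [:1, -1:] X z"
        by (simp only: poly_op_add poly_op_mult blinfun.add_left inner_add_left
            inner_sandwich[OF sym_op_poly_op[OF X]])
      then show ?thesis using lin by simp
    qed (use lin in \<open>auto simp: r_def\<close>)
  qed
  then show ?thesis by (simp only: eq)
qed

text \<open>Multiply \<open>x^j\<close> by \<open>(x + (1 - x))^(n - j)\<close>, which is 1, and
  expand binomially.\<close>

lemma bernstein_monom:
  assumes "j \<le> n"
  shows "monom 1 j = (\<Sum>k\<in>{j..n}. smult (real ((n - j) choose (k - j))) ([:0, 1:] ^ k * [:1, -1:] ^ (n - k)))"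
proof -
  have "(\<Sum>k\<in>{j..n}. smult (real ((n - j) choose (k - j))) ([:0, 1:] ^ k * [:1, -1:] ^ (n - k)))
     = (\<Sum>i\<le>n - j. smult (real ((n - j) choose i)) ([:0, 1:] ^ (i + j) * [:1, -1:] ^ (n - j - i)))"
    by (rule sum.reindex_bij_witness[where i = "\<lambda>i. i + j" and j = "\<lambda>k. k - j"]) (use assms in auto)
  also have "\<dots> = [:0, 1:] ^ j * (\<Sum>i\<le>n - j. of_nat ((n - j) choose i) * [:0, 1:] ^ i * [:1, -1:] ^ (n - j - i))"
    by (simp add: sum_distrib_left power_add of_nat_poly mult_ac)
  also have "\<dots> = [:0, 1:] ^ j * ([:0, 1:] + [:1, -1:]) ^ (n - j)"
    by (simp only: binomial_ring)
  also have "[:0, 1:] + [:1, -1:] = (1 :: real poly)"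
    by (simp add: one_pCons)
  finally show ?thesis by (simp add: monom_altdef)
qed

text \<open>Splits off the weight \<open>n choose k\<close> of the Bernstein basis. The remaining
  ratio of falling factorials is close to \<open>(k / n)^j\<close>.\<close>

lemma binomial_shift:
  assumes "j \<le> k" "k \<le> n"
  shows "real ((n - j) choose (k - j)) = real (n choose k) * (\<Prod>i<j. (real k - real i) / (real n - real i))"
  using assms
proof (induction j)
  case (Suc j)
  have "Suc (k - Suc j) * (Suc (n - Suc j) choose Suc (k - Suc j)) = Suc (n - Suc j) * (n - Suc j choose (k - Suc j))"
    by (rule Suc_times_binomial)
  moreover have "Suc (k - Suc j) = k - j" "Suc (n - Suc j) = n - j"
    using Suc.prems by auto
  ultimately have "(k - j) * (n - j choose (k - j)) = (n - j) * (n - Suc j choose (k - Suc j))"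
    by simp
  then have "real (k - j) * real (n - j choose (k - j)) = real (n - j) * real (n - Suc j choose (k - Suc j))"
    by (metis of_nat_mult)
  moreover have "real (k - j) = real k - real j" "real (n - j) = real n - real j" "real n - real j > 0"
    using Suc.prems by (auto simp: of_nat_diff)
  ultimately have "real (n - Suc j choose (k - Suc j)) = (real k - real j) / (real n - real j) * real (n - j choose (k - j))"
    by (simp add: field_simps)
  then show ?case
    using Suc by (simp add: field_simps)
qed simp

text \<open>The bound does not depend on \<open>k\<close>. Replacing the factors one at a time costs
  the sum of the individual errors as long as all factors have modulus at most 1;
  \<open>2 * j < n\<close> secures this also for the negative factors with
  \<open>k < i\<close>.\<close>

lemma falling_ratio_approx:
  assumes "k \<le> n" "2 * j < n"
  shows "\<bar>(\<Prod>i<j. (real k - real i) / (real n - real i)) - (real k / real n) ^ j\<bar> \<le> real j * (real j / (real n - real j))"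
proof -
  have 1: "\<bar>(real k - real i) / (real n - real i)\<bar> \<le> 1" if "i < j" for i
    using that assms by (auto simp: abs_le_iff divide_simps)
  have 2: "\<bar>(real k - real i) / (real n - real i) - real k / real n\<bar> \<le> real j / (real n - real j)" if "i < j" for i
  proof -
    have pos: "0 < real n" "0 < real n - real i" "0 < real n - real j" using that assms by auto
    have "(real k - real i) / (real n - real i) - real k / real n = - (real i * (real n - real k) / (real n * (real n - real i)))"
      using pos by (simp add: field_simps)
    then have "\<bar>(real k - real i) / (real n - real i) - real k / real n\<bar> = real i * ((real n - real k) / real n) / (real n - real i)"
      using pos assms by (simp add: abs_mult)
    also have "\<dots> \<le> real i * 1 / (real n - real i)"
      using pos assms by (intro divide_right_mono mult_left_mono) auto
    also have "\<dots> \<le> real j / (real n - real j)"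
      using pos that by (intro frac_le) auto
    finally show ?thesis .
  qed
  have "\<bar>(\<Prod>i<j. (real k - real i) / (real n - real i)) - (\<Prod>i<j. real k / real n)\<bar>
      \<le> (\<Sum>i<j. \<bar>(real k - real i) / (real n - real i) - real k / real n\<bar>)"
    using norm_prod_diff[of "{..<j}" "\<lambda>i. (real k - real i) / (real n - real i)" "\<lambda>i. real k / real n"] 1 assms
    by (simp add: abs_mult)
  also have "\<dots> \<le> (\<Sum>i<j. real j / (real n - real j))"
    by (rule sum_mono) (use 2 in auto)
  finally show ?thesis by simp
qed

lemma smult_sum_right: "smult c (sum f I) = (\<Sum>i\<in>I. smult c (f i))"
  by (induction I rule: infinite_finite_induct) (auto simp: smult_add_right)

text \<open>By the two preceding facts the Bernstein coefficients \<open>c n k\<close> of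
  \<open>p\<close> differ from the values \<open>p (k / n) \<ge> 0\<close> by at most
  \<open>err n\<close>. As the weighted basis sums to 1, the form is at least
  \<open>- err n * (x \<bullet> x)\<close>, and \<open>err n\<close> tends to 0.\<close>

lemma poly_op_nonneg_unit:
  assumes X: "between 0 1 X" and p: "\<And>t. 0 \<le> t \<Longrightarrow> t \<le> 1 \<Longrightarrow> 0 \<le> poly p t"
  shows "0 \<le> poly_op p X x \<bullet> x"
proof -
  define d where "d = degree p"
  define B where "B n k = [:0, 1:] ^ k * ([:1, -1:] ^ (n - k) :: real poly)" for n k
  define c where "c n k = (\<Sum>j\<le>d. coeff p j * (\<Prod>i<j. (real k - real i) / (real n - real i)))" for n k
  define err where "err n = (\<Sum>j\<le>d. \<bar>coeff p j\<bar> * (real j * (real j / (real n - real j))))" for n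
  have "err \<longlonglongrightarrow> (\<Sum>j\<le>d. \<bar>coeff p j\<bar> * (real j * 0))"
    unfolding err_def
    by (intro tendsto_intros real_tendsto_divide_at_top[OF tendsto_const])
      (simp add: filterlim_at_top_add_at_top filterlim_real_sequentially filterlim_tendsto_add_at_top
        filterlim_tendsto_add_at_top[OF tendsto_const[of "- real _"], simplified])
  then have err0: "err \<longlonglongrightarrow> 0" by simp
  have expand: "p = (\<Sum>k\<le>n. smult (real (n choose k) * c n k) (B n k))" if "2 * d < n" for n
  proof -
    have "p = (\<Sum>j\<le>d. smult (coeff p j) (monom 1 j))"
      unfolding d_def by (simp add: smult_monom poly_as_sum_of_monoms)
    also have "\<dots> = (\<Sum>j\<le>d. \<Sum>k\<le>n. smult (coeff p j * (real (n choose k) * (\<Prod>i<j. (real k - real i) / (real n - real i)))) (B n k))"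
    proof (rule sum.cong[OF refl])
      fix j assume "j \<in> {..d}"
      then have j: "j \<le> n" using that by auto
      have "monom 1 j = (\<Sum>k\<in>{j..n}. smult (real ((n - j) choose (k - j))) (B n k))"
        unfolding B_def by (rule bernstein_monom[OF j])
      also have "\<dots> = (\<Sum>k\<in>{j..n}. smult (real (n choose k) * (\<Prod>i<j. (real k - real i) / (real n - real i))) (B n k))"
        by (rule sum.cong) (simp_all add: binomial_shift)
      \<comment> \<open>For \<open>k < j\<close> the factor with index \<open>i = k\<close> is zero,
        which lets the sum start at 0.\<close>
      also have "\<dots> = (\<Sum>k\<le>n. smult (real (n choose k) * (\<Prod>i<j. (real k - real i) / (real n - real i))) (B n k))"
        by (rule sum.mono_neutral_left) (auto simp: not_le intro!: prod_zero)
      finally show "smult (coeff p j) (monom 1 j) = (\<Sum>k\<le>n. smult (coeff p j * (real (n choose k) * (\<Prod>i<j. (real k - real i) / (real n - real i)))) (B n k))"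
        by (simp add: smult_sum_right)
    qed
    also have "\<dots> = (\<Sum>k\<le>n. smult (real (n choose k) * c n k) (B n k))"
      unfolding c_def
      by (subst sum.swap) (simp add: sum_distrib_left mult_ac flip: smult_sum)
    finally show ?thesis .
  qed
  have cpos: "- err n \<le> c n k" if "2 * d < n" "k \<le> n" for n k
  proof -
    have "0 \<le> poly p (real k / real n)"
      using that by (intro p) auto
    also have "poly p (real k / real n) = (\<Sum>j\<le>d. coeff p j * (real k / real n) ^ j)"
      unfolding d_def by (rule poly_altdef)
    finally have 1: "0 \<le> (\<Sum>j\<le>d. coeff p j * (real k / real n) ^ j)" .
    have "\<bar>c n k - (\<Sum>j\<le>d. coeff p j * (real k / real n) ^ j)\<bar>
       = \<bar>\<Sum>j\<le>d. coeff p j * ((\<Prod>i<j. (real k - real i) / (real n - real i)) - (real k / real n) ^ j)\<bar>"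
      by (simp add: c_def sum_subtractf right_diff_distrib)
    also have "\<dots> \<le> (\<Sum>j\<le>d. \<bar>coeff p j * ((\<Prod>i<j. (real k - real i) / (real n - real i)) - (real k / real n) ^ j)\<bar>)"
      by (rule sum_abs)
    also have "\<dots> \<le> err n"
      unfolding err_def abs_mult using that
      by (intro sum_mono mult_left_mono falling_ratio_approx) auto
    finally show ?thesis using 1 by linarith
  qed
  have main: "- err n * (x \<bullet> x) \<le> poly_op p X x \<bullet> x" if n: "2 * d < n" for n
  proof -
    have Bpos: "0 \<le> poly_op (B n k) X x \<bullet> x" for k
      unfolding B_def by (rule poly_op_bernstein_nonneg[OF X])
    have "(\<Sum>k\<le>n. smult (real (n choose k)) (B n k)) = 1"
      using bernstein_monom[of 0 n] by (simp add: B_def atMost_atLeast0 monom_0 one_pCons)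
    then have "poly_op (\<Sum>k\<le>n. smult (real (n choose k)) (B n k)) X x \<bullet> x = x \<bullet> x"
      by simp
    then have "(\<Sum>k\<le>n. real (n choose k) * (poly_op (B n k) X x \<bullet> x)) = x \<bullet> x"
      by (simp add: poly_op_sum poly_op_smult blinfun.sum_left blinfun.scaleR_left inner_sum_left)
    then have "- err n * (x \<bullet> x) = (\<Sum>k\<le>n. (- err n) * (real (n choose k) * (poly_op (B n k) X x \<bullet> x)))"
      by (simp only: sum_distrib_left[symmetric])
    also have "\<dots> \<le> (\<Sum>k\<le>n. c n k * (real (n choose k) * (poly_op (B n k) X x \<bullet> x)))"
      using cpos[OF n] Bpos by (intro sum_mono mult_right_mono) auto
    also have "\<dots> = poly_op (\<Sum>k\<le>n. smult (real (n choose k) * c n k) (B n k)) X x \<bullet> x"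
      by (simp add: poly_op_sum poly_op_smult blinfun.sum_left blinfun.scaleR_left inner_sum_left mult_ac)
    also have "\<dots> = poly_op p X x \<bullet> x"
      using expand[OF n] by simp
    finally show ?thesis .
  qed
  have "(\<lambda>n. - err n * (x \<bullet> x)) \<longlonglongrightarrow> - 0 * (x \<bullet> x)"
    by (intro tendsto_intros err0)
  then show ?thesis
    using main by (intro LIMSEQ_le_const2[of _ "0" "poly_op p X x \<bullet> x"]) (auto intro!: exI[of _ "Suc (2 * d)"])
qed

lemma poly_op_scaled_id: "poly_op p (a *\<^sub>R id_blinfun) = poly p a *\<^sub>R id_blinfun"
  by (induction p) (auto simp: blinfun_compose_scaleR scaleR_left.add)

text \<open>An affine substitution moves \<open>[a, b]\<close> to \<open>[0, 1]\<close>. It divides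
  by \<open>b - a\<close>, so \<open>a = b\<close> is separate; there the form pins \<open>A\<close>
  down to a scalar.\<close>

lemma poly_op_nonneg:
  assumes A: "between a b A" and p: "\<And>t. a \<le> t \<Longrightarrow> t \<le> b \<Longrightarrow> 0 \<le> poly p t"
  shows "0 \<le> poly_op p A x \<bullet> x"
proof (cases "a = b")
  case True
  then have "A = a *\<^sub>R id_blinfun"
    using A by (intro sym_op_eqI sym_op_scaleR) (auto simp: between_def blinfun.scaleR_left intro: antisym)
  then show ?thesis
    using p[of a] True by (simp add: poly_op_scaled_id blinfun.scaleR_left)
next
  case False
  then have ab: "a < b" using A by (auto simp: between_def)
  define u where "u = [:- a / (b - a), 1 / (b - a):]"
  define v where "v = [:a, b - a:]"
  have vu: "pcompose v u = [:0, 1:]"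
    using ab by (simp add: u_def v_def pcompose_pCons)
  have sym: "sym_op (poly_op u A)" by (intro sym_op_poly_op between_sym[OF A])
  have uA: "poly_op u A z \<bullet> z = (A z \<bullet> z - a * (z \<bullet> z)) / (b - a)" for z
    using ab by (simp add: u_def blinfun.bilinear_simps blinfun_compose_scaleR inner_add_left inner_diff_left diff_divide_distrib)
  have "between 0 1 (poly_op u A)"
    using A ab sym unfolding between_def uA by (auto simp: divide_simps algebra_simps)
  then have "0 \<le> poly_op (pcompose p v) (poly_op u A) x \<bullet> x"
  proof (rule poly_op_nonneg_unit)
    fix t :: real assume "0 \<le> t" "t \<le> 1"
    then have "0 \<le> t * (b - a)" "t * (b - a) \<le> b - a" using ab by (auto simp: mult_left_le_one_le)
    then show "0 \<le> poly (pcompose p v) t" by (simp add: v_def poly_pcompose p)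
  qed
  then show ?thesis
    by (simp add: vu flip: poly_op_pcompose pcompose_assoc)
qed

text \<open>Positivity of \<open>e - p\<close> and \<open>e + p\<close>. Contractivity for the
  supremum norm is what extends the calculus from polynomials to continuous functions.\<close>

lemma poly_op_norm_le:
  assumes A: "between a b A" and p: "\<And>t. a \<le> t \<Longrightarrow> t \<le> b \<Longrightarrow> \<bar>poly p t\<bar> \<le> e"
  shows "norm (poly_op p A) \<le> e"
proof (rule sym_op_norm_le)
  show "sym_op (poly_op p A)" by (intro sym_op_poly_op between_sym[OF A])
  show "0 \<le> e" using p[of a] A by (auto simp: between_def)
  fix x
  have "0 \<le> poly_op ([:e:] - p) A x \<bullet> x" "0 \<le> poly_op ([:e:] + p) A x \<bullet> x"
    by (rule poly_op_nonneg[OF A]; use p in \<open>force simp: abs_le_iff\<close>)+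
  then show "\<bar>poly_op p A x \<bullet> x\<bar> \<le> e * (x \<bullet> x)"
    by (simp add: poly_op_diff poly_op_add blinfun.bilinear_simps inner_add_left inner_diff_left)
qed

section \<open>Continuous functional calculus\<close>

text \<open>The continuous functional calculus \<open>f(A)\<close>, with an interval in place of the
  spectrum. Demanding the estimate for all \<open>e\<close> and \<open>p\<close> at once, instead of
  fixing a sequence of polynomials, makes the result independent of choices and dependent on
  \<open>f\<close> only inside \<open>{a..b}\<close>.\<close>

definition cfc :: "real \<Rightarrow> real \<Rightarrow> (real \<Rightarrow> real) \<Rightarrow> 'h::real_normed_vector operator \<Rightarrow> 'h operator" where
  "cfc a b f A = (THE T. \<forall>e p. (\<forall>t\<in>{a..b}. \<bar>f t - poly p t\<bar> \<le> e) \<longrightarrow> norm (T - poly_op p A) \<le> e)"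

lemma weierstrass_poly:
  fixes f :: "real \<Rightarrow> real"
  assumes "continuous_on {a..b} f" "0 < e"
  obtains p where "\<And>t. a \<le> t \<Longrightarrow> t \<le> b \<Longrightarrow> \<bar>f t - poly p t\<bar> \<le> e"
proof -
  obtain g where g: "real_polynomial_function g" "\<And>x. x \<in> {a..b} \<Longrightarrow> \<bar>f x - g x\<bar> < e"
    using Stone_Weierstrass_real_polynomial_function[of "{a..b}" f e] assms by auto
  obtain c n where "g = (\<lambda>x. \<Sum>i\<le>n. c i * x ^ i)"
    using g(1) real_polynomial_function_iff_sum by auto
  then have "g x = poly (\<Sum>i\<le>n. monom (c i) i) x" for x
    by (simp add: poly_sum poly_monom)
  then show thesis
    using that[of "\<Sum>i\<le>n. monom (c i) i"] g(2) by force
qed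

text \<open>Here the description in \<open>cfc\<close> is shown to have exactly one solution:
  Weierstrass polynomials with error \<open>1 / (n + 1)\<close> give a Cauchy sequence, and its
  limit is within \<open>e\<close> of every admissible \<open>poly_op p A\<close>.\<close>

lemma cfc_approx:
  fixes A :: "'h::{real_inner, banach} operator"
  assumes A: "between a b A" and f: "continuous_on {a..b} f"
    and p: "\<And>t. a \<le> t \<Longrightarrow> t \<le> b \<Longrightarrow> \<bar>f t - poly p t\<bar> \<le> e"
  shows "norm (cfc a b f A - poly_op p A) \<le> e"
proof -
  have ab: "a \<le> b" using A by (simp add: between_def)
  have "\<exists>q. \<forall>t\<in>{a..b}. \<bar>f t - poly q t\<bar> \<le> 1 / real (Suc n)" for n
    using weierstrass_poly[OF f, of "1 / real (Suc n)"] by (metis atLeastAtMost_iff divide_pos_pos of_nat_0_less_iff zero_less_Suc zero_less_one)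
  then obtain q where q: "\<And>n t. t \<in> {a..b} \<Longrightarrow> \<bar>f t - poly (q n) t\<bar> \<le> 1 / real (Suc n)"
    by metis
  have diff: "norm (poly_op (q n) A - poly_op r A) \<le> 1 / real (Suc n) + e"
    if "\<And>t. t \<in> {a..b} \<Longrightarrow> \<bar>f t - poly r t\<bar> \<le> e" for r n e
  proof -
    have "norm (poly_op (q n - r) A) \<le> 1 / real (Suc n) + e"
    proof (rule poly_op_norm_le[OF A])
      fix t assume "a \<le> t" "t \<le> b"
      then show "\<bar>poly (q n - r) t\<bar> \<le> 1 / real (Suc n) + e"
        using q[of t n] that[of t] unfolding poly_diff atLeastAtMost_iff by linarith
    qed
    then show ?thesis by (simp add: poly_op_diff)
  qed
  have lim0: "(\<lambda>n. 1 / real (Suc n)) \<longlonglongrightarrow> 0"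
    using LIMSEQ_inverse_real_of_nat by (simp add: inverse_eq_divide)
  have "Cauchy (\<lambda>n. poly_op (q n) A)"
  proof (rule metric_CauchyI)
    fix e :: real assume "0 < e"
    then obtain N where N: "1 / real (Suc N) < e / 2"
      using nat_approx_posE half_gt_zero by metis
    have "dist (poly_op (q m) A) (poly_op (q n) A) < e" if "m \<ge> N" "n \<ge> N" for m n
    proof -
      have "1 / real (Suc m) \<le> 1 / real (Suc N)" "1 / real (Suc n) \<le> 1 / real (Suc N)"
        using that by (auto simp: divide_simps)
      then show ?thesis
        using diff[OF q, of m n] N by (simp add: dist_norm)
    qed
    then show "\<exists>M. \<forall>m\<ge>M. \<forall>n\<ge>M. dist (poly_op (q m) A) (poly_op (q n) A) < e" by blast
  qed
  then obtain T where T: "(\<lambda>n. poly_op (q n) A) \<longlonglongrightarrow> T"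
    using Cauchy_convergent_iff convergent_def by blast
  let ?P = "\<lambda>T. \<forall>e p. (\<forall>t\<in>{a..b}. \<bar>f t - poly p t\<bar> \<le> e) \<longrightarrow> norm (T - poly_op p A) \<le> e"
  have PT: "?P T"
  proof (intro allI impI)
    fix e r assume r: "\<forall>t\<in>{a..b}. \<bar>f t - poly r t\<bar> \<le> e"
    have 1: "(\<lambda>n. norm (poly_op (q n) A - poly_op r A)) \<longlonglongrightarrow> norm (T - poly_op r A)"
      by (intro tendsto_intros T)
    have 2: "(\<lambda>n. 1 / real (Suc n) + e) \<longlonglongrightarrow> 0 + e"
      by (intro tendsto_intros lim0)
    have "norm (T - poly_op r A) \<le> 0 + e"
      by (rule LIMSEQ_le[OF 1 2]) (use diff r in blast)
    then show "norm (T - poly_op r A) \<le> e" by simp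
  qed
  have uniq: "S = T" if S: "?P S" for S
  proof -
    have "(\<lambda>n. poly_op (q n) A) \<longlonglongrightarrow> S"
    proof (rule LIM_zero_cancel, rule tendsto_0_le[OF lim0, of _ 1], rule always_eventually, rule allI)
      fix n
      have "norm (S - poly_op (q n) A) \<le> 1 / real (Suc n)"
        using S q by blast
      then show "norm (poly_op (q n) A - S) \<le> norm (1 / real (Suc n)) * 1"
        by (simp add: norm_minus_commute)
    qed
    then show ?thesis using T LIMSEQ_unique by blast
  qed
  have "cfc a b f A = T"
    unfolding cfc_def by (rule the_equality) (use PT uniq in blast)+
  then show ?thesis using PT p by auto
qed

context
  fixes A :: "'h::{real_inner, banach} operator" and a b :: real
  assumes A: "between a b A"
begin

text \<open>For each \<open>e\<close>, one polynomial that is near \<open>f\<close> and whose value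
  at \<open>A\<close> is near \<open>T\<close> is enough; the algebraic rules of the calculus reduce
  to this criterion.\<close>

lemma cfcI:
  assumes f: "continuous_on {a..b} f"
    and T: "\<And>e. 0 < e \<Longrightarrow> \<exists>p. (\<forall>t\<in>{a..b}. \<bar>f t - poly p t\<bar> \<le> e) \<and> norm (T - poly_op p A) \<le> e"
  shows "cfc a b f A = T"
proof (rule ccontr)
  assume ne: "cfc a b f A \<noteq> T"
  define e where "e = norm (cfc a b f A - T) / 3"
  have e: "0 < e" using ne by (simp add: e_def)
  obtain p where p: "\<forall>t\<in>{a..b}. \<bar>f t - poly p t\<bar> \<le> e" "norm (T - poly_op p A) \<le> e"
    using T[OF e] by blast
  have "norm (cfc a b f A - poly_op p A) \<le> e"
    using p(1) by (intro cfc_approx[OF A f]) auto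
  then have "norm (cfc a b f A - T) \<le> e + e"
    using p(2) norm_triangle_ineq4[of "cfc a b f A - poly_op p A" "T - poly_op p A"] by simp
  then show False using e by (simp add: e_def)
qed

lemma cfc_poly: "cfc a b (poly p) A = poly_op p A"
proof (rule cfcI)
  show "continuous_on {a..b} (poly p)" by (intro continuous_intros)
  show "\<exists>q. (\<forall>t\<in>{a..b}. \<bar>poly p t - poly q t\<bar> \<le> e) \<and> norm (poly_op p A - poly_op q A) \<le> e" if "0 < e" for e
    by (rule exI[of _ p]) (use that in simp)
qed

lemma cfc_cong: "(\<And>t. a \<le> t \<Longrightarrow> t \<le> b \<Longrightarrow> f t = g t) \<Longrightarrow> cfc a b f A = cfc a b g A"
  unfolding cfc_def by (intro arg_cong[of _ _ The] ext all_cong1 imp_cong ball_cong) auto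

lemma cfc_norm_le:
  assumes "continuous_on {a..b} f" "\<And>t. a \<le> t \<Longrightarrow> t \<le> b \<Longrightarrow> \<bar>f t\<bar> \<le> e"
  shows "norm (cfc a b f A) \<le> e"
  using cfc_approx[OF A assms(1), of 0 e] assms(2) by simp

lemma cfc_add:
  assumes f: "continuous_on {a..b} f" and g: "continuous_on {a..b} g"
  shows "cfc a b (\<lambda>t. f t + g t) A = cfc a b f A + cfc a b g A"
proof (rule cfcI)
  fix e :: real assume "0 < e"
  then have e: "0 < e / 2" by simp
  obtain p where p: "\<And>t. a \<le> t \<Longrightarrow> t \<le> b \<Longrightarrow> \<bar>f t - poly p t\<bar> \<le> e / 2"
    using weierstrass_poly[OF f e] by blast
  obtain q where q: "\<And>t. a \<le> t \<Longrightarrow> t \<le> b \<Longrightarrow> \<bar>g t - poly q t\<bar> \<le> e / 2"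
    using weierstrass_poly[OF g e] by blast
  have "norm (cfc a b f A + cfc a b g A - poly_op (p + q) A) \<le> e"
    using norm_triangle_le[of "cfc a b f A - poly_op p A" "cfc a b g A - poly_op q A" e]
      cfc_approx[OF A f p] cfc_approx[OF A g q] by (simp add: poly_op_add algebra_simps)
  moreover have "\<bar>f t + g t - poly (p + q) t\<bar> \<le> e" if "t \<in> {a..b}" for t
    using p[of t] q[of t] that unfolding poly_add atLeastAtMost_iff by linarith
  ultimately show "\<exists>r. (\<forall>t\<in>{a..b}. \<bar>f t + g t - poly r t\<bar> \<le> e)
      \<and> norm (cfc a b f A + cfc a b g A - poly_op r A) \<le> e" by blast
qed (intro continuous_intros f g)

lemma cfc_mult:
  assumes f: "continuous_on {a..b} f" and g: "continuous_on {a..b} g"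
  shows "cfc a b (\<lambda>t. f t * g t) A = cfc a b f A o\<^sub>L cfc a b g A"
proof (rule cfcI)
  obtain K1 where K1: "\<And>t. a \<le> t \<Longrightarrow> t \<le> b \<Longrightarrow> \<bar>f t\<bar> \<le> K1"
    using compact_imp_bounded[OF compact_continuous_image[OF f compact_Icc]] unfolding bounded_iff by fastforce
  obtain K2 where K2: "\<And>t. a \<le> t \<Longrightarrow> t \<le> b \<Longrightarrow> \<bar>g t\<bar> \<le> K2"
    using compact_imp_bounded[OF compact_continuous_image[OF g compact_Icc]] unfolding bounded_iff by fastforce
  define K where "K = max 0 (max K1 K2)"
  have Kf: "\<bar>f t\<bar> \<le> K" and Kg: "\<bar>g t\<bar> \<le> K" if "a \<le> t" "t \<le> b" for t
    using K1[OF that] K2[OF that] by (auto simp: K_def)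
  fix e :: real assume e0: "0 < e"
  \<comment> \<open>\<open>d \<le> 1\<close> bounds the approximant of \<open>g\<close> by
    \<open>K + 1\<close>, so the error of the product is at most
    \<open>K * d + d * (K + 1) = (2 * K + 1) * d \<le> e\<close>.\<close>
  define d where "d = min 1 (e / (2 * K + 1))"
  have K0: "0 \<le> K" by (simp add: K_def)
  have d: "0 < d" "d \<le> 1" "d \<le> e / (2 * K + 1)"
    using e0 K0 by (auto simp: d_def)
  then have d': "(2 * K + 1) * d \<le> e"
    using K0 by (simp add: pos_le_divide_eq mult.commute)
  obtain p where p: "\<And>t. a \<le> t \<Longrightarrow> t \<le> b \<Longrightarrow> \<bar>f t - poly p t\<bar> \<le> d"
    using weierstrass_poly[OF f d(1)] by blast
  obtain q where q: "\<And>t. a \<le> t \<Longrightarrow> t \<le> b \<Longrightarrow> \<bar>g t - poly q t\<bar> \<le> d"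
    using weierstrass_poly[OF g d(1)] by blast
  have Kq: "\<bar>poly q t\<bar> \<le> K + 1" if "a \<le> t" "t \<le> b" for t
    using q[OF that] Kg[OF that] d(2) by linarith
  have *: "K * d + d * (K + 1) \<le> e" using d' by (simp add: algebra_simps)
  have "\<bar>f t * g t - poly (p * q) t\<bar> \<le> e" if t: "a \<le> t" "t \<le> b" for t
  proof -
    have "f t * g t - poly (p * q) t = f t * (g t - poly q t) + (f t - poly p t) * poly q t"
      by (simp add: algebra_simps)
    also have "\<bar>\<dots>\<bar> \<le> \<bar>f t\<bar> * \<bar>g t - poly q t\<bar> + \<bar>f t - poly p t\<bar> * \<bar>poly q t\<bar>"
      by (metis abs_mult abs_triangle_ineq)
    also have "\<dots> \<le> K * d + d * (K + 1)"
      by (intro add_mono mult_mono p q Kf Kq t) (use K0 d in auto)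
    finally show ?thesis using * by linarith
  qed
  moreover have "norm ((cfc a b f A o\<^sub>L cfc a b g A) - poly_op (p * q) A) \<le> e"
  proof -
    have "(cfc a b f A o\<^sub>L cfc a b g A) - poly_op (p * q) A
       = (cfc a b f A o\<^sub>L (cfc a b g A - poly_op q A)) + ((cfc a b f A - poly_op p A) o\<^sub>L poly_op q A)"
      by (simp add: poly_op_mult blinfun_compose_diff)
    also have "norm \<dots> \<le> norm (cfc a b f A) * norm (cfc a b g A - poly_op q A)
        + norm (cfc a b f A - poly_op p A) * norm (poly_op q A)"
      by (intro norm_triangle_le add_mono norm_blinfun_compose)
    also have "\<dots> \<le> K * d + d * (K + 1)"
      by (intro add_mono mult_mono cfc_approx[OF A] f g p q cfc_norm_le Kf poly_op_norm_le[OF A] Kq)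
        (use K0 d in auto)
    finally show ?thesis using * by linarith
  qed
  ultimately show "\<exists>r. (\<forall>t\<in>{a..b}. \<bar>f t * g t - poly r t\<bar> \<le> e)
      \<and> norm ((cfc a b f A o\<^sub>L cfc a b g A) - poly_op r A) \<le> e"
    by (intro exI[of _ "p * q"]) auto
qed (intro continuous_intros f g)

lemma cfc_const: "cfc a b (\<lambda>t. c) A = c *\<^sub>R id_blinfun"
  using cfc_poly[of "[:c:]"] cfc_cong[of "poly [:c:]" "\<lambda>t. c"] by simp

lemma cfc_scale:
  assumes f: "continuous_on {a..b} f"
  shows "cfc a b (\<lambda>t. c * f t) A = c *\<^sub>R cfc a b f A"
  using cfc_mult[OF continuous_on_const f, of c] by (simp add: cfc_const blinfun_compose_scaleR)

lemma cfc_diff: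
  assumes f: "continuous_on {a..b} f" and g: "continuous_on {a..b} g"
  shows "cfc a b (\<lambda>t. f t - g t) A = cfc a b f A - cfc a b g A"
proof -
  have "continuous_on {a..b} (\<lambda>t. - 1 * g t)" by (intro continuous_intros g)
  from cfc_add[OF f this] show ?thesis unfolding cfc_scale[OF g] by simp
qed

text \<open>The rate is part of the result for the sake of positivity: adding it to
  \<open>q n\<close> gives a polynomial that is nonnegative on \<open>{a..b}\<close> whenever
  \<open>f\<close> is.\<close>

lemma cfc_limit_poly:
  assumes f: "continuous_on {a..b} f"
  obtains q where "(\<lambda>n::nat. poly_op (q n) A) \<longlonglongrightarrow> cfc a b f A"
    "\<And>n t. a \<le> t \<Longrightarrow> t \<le> b \<Longrightarrow> \<bar>f t - poly (q n) t\<bar> \<le> 1 / real (Suc n)"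
proof -
  have "\<exists>q. \<forall>t\<in>{a..b}. \<bar>f t - poly q t\<bar> \<le> 1 / real (Suc n)" for n
    using weierstrass_poly[OF f, of "1 / real (Suc n)"]
    by (metis atLeastAtMost_iff divide_pos_pos of_nat_0_less_iff zero_less_Suc zero_less_one)
  then obtain q where q: "\<And>n t. t \<in> {a..b} \<Longrightarrow> \<bar>f t - poly (q n) t\<bar> \<le> 1 / real (Suc n)"
    by metis
  have lim0: "(\<lambda>n. 1 / real (Suc n)) \<longlonglongrightarrow> 0"
    using LIMSEQ_inverse_real_of_nat by (simp add: inverse_eq_divide)
  have "(\<lambda>n. poly_op (q n) A) \<longlonglongrightarrow> cfc a b f A"
  proof (rule LIM_zero_cancel, rule tendsto_0_le[OF lim0, of _ 1], rule always_eventually, rule allI)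
    fix n
    have "norm (cfc a b f A - poly_op (q n) A) \<le> 1 / real (Suc n)"
      using q by (intro cfc_approx[OF A f]) auto
    then show "norm (poly_op (q n) A - cfc a b f A) \<le> norm (1 / real (Suc n)) * 1"
      by (simp add: norm_minus_commute)
  qed
  then show thesis using that q by auto
qed

lemma sym_op_cfc:
  assumes f: "continuous_on {a..b} f"
  shows "sym_op (cfc a b f A)"
proof -
  obtain q where q: "(\<lambda>n::nat. poly_op (q n) A) \<longlonglongrightarrow> cfc a b f A"
    by (rule cfc_limit_poly[OF f])
  show ?thesis
  proof (rule sym_op_limit)
    show "sym_op (poly_op (q n) A)" for n by (intro sym_op_poly_op between_sym[OF A])
    show "(\<lambda>n. poly_op (q n) A x) \<longlonglongrightarrow> cfc a b f A x" for x
      by (rule blinfun.tendsto[OF q tendsto_const])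
  qed
qed

lemma cfc_nonneg:
  assumes f: "continuous_on {a..b} f" and pos: "\<And>t. a \<le> t \<Longrightarrow> t \<le> b \<Longrightarrow> 0 \<le> f t"
  shows "0 \<le> cfc a b f A x \<bullet> x"
proof -
  obtain q where q: "(\<lambda>n::nat. poly_op (q n) A) \<longlonglongrightarrow> cfc a b f A"
    "\<And>n t. a \<le> t \<Longrightarrow> t \<le> b \<Longrightarrow> \<bar>f t - poly (q n) t\<bar> \<le> 1 / real (Suc n)"
    using cfc_limit_poly[OF f] by blast
  have lim0: "(\<lambda>n. 1 / real (Suc n)) \<longlonglongrightarrow> 0"
    using LIMSEQ_inverse_real_of_nat by (simp add: inverse_eq_divide)
  have "0 \<le> poly_op (q n + [:1 / real (Suc n):]) A x \<bullet> x" for n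
  proof (rule poly_op_nonneg[OF A])
    fix t assume "a \<le> t" "t \<le> b"
    then show "0 \<le> poly (q n + [:1 / real (Suc n):]) t"
      using q(2)[of t n] pos[of t] by simp
  qed
  then have 1: "0 \<le> poly_op (q n) A x \<bullet> x + 1 / real (Suc n) * (x \<bullet> x)" for n
    by (simp add: poly_op_add blinfun.bilinear_simps inner_add_left)
  have "(\<lambda>n. poly_op (q n) A x \<bullet> x + 1 / real (Suc n) * (x \<bullet> x)) \<longlonglongrightarrow> cfc a b f A x \<bullet> x + 0 * (x \<bullet> x)"
    by (intro tendsto_intros q lim0)
  then have "0 \<le> cfc a b f A x \<bullet> x + 0 * (x \<bullet> x)"
    by (rule LIMSEQ_le_const) (use 1 in blast)
  then show ?thesis by simp
qed

lemma cfc_mono: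
  assumes f: "continuous_on {a..b} f" and g: "continuous_on {a..b} g"
    and le: "\<And>t. a \<le> t \<Longrightarrow> t \<le> b \<Longrightarrow> f t \<le> g t"
  shows "cfc a b f A x \<bullet> x \<le> cfc a b g A x \<bullet> x"
proof -
  have "0 \<le> cfc a b (\<lambda>t. g t - f t) A x \<bullet> x"
    by (rule cfc_nonneg) (use le in \<open>auto intro!: continuous_on_diff f g\<close>)
  then show ?thesis
    by (simp add: cfc_diff[OF g f] blinfun.diff_left inner_diff_left)
qed

text \<open>Brings operators with different bounds, or different bounds of one operator, to a common
  interval.\<close>

lemma cfc_interval:
  assumes "a' \<le> a" "b \<le> b'" and f: "continuous_on {a'..b'} f"
  shows "cfc a b f A = cfc a' b' f A"
proof (rule cfcI)
  show "continuous_on {a..b} f" using assms by (auto intro: continuous_on_subset)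
  have A': "between a' b' A" by (rule between_mono[OF A assms(1,2)])
  fix e :: real assume "0 < e"
  then obtain p where p: "\<And>t. a' \<le> t \<Longrightarrow> t \<le> b' \<Longrightarrow> \<bar>f t - poly p t\<bar> \<le> e"
    using weierstrass_poly[OF f] by blast
  show "\<exists>p. (\<forall>t\<in>{a..b}. \<bar>f t - poly p t\<bar> \<le> e) \<and> norm (cfc a' b' f A - poly_op p A) \<le> e"
  proof (intro exI conjI ballI)
    show "\<bar>f t - poly p t\<bar> \<le> e" if "t \<in> {a..b}" for t using that assms by (intro p) auto
    show "norm (cfc a' b' f A - poly_op p A) \<le> e" by (rule cfc_approx[OF A' f p])
  qed
qed

end

text \<open>Weak enough to hold of \<open>bounded_operators\<close> and of von Neumann algebras
  alike. One closure argument then yields complex linearity as well as membership in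
  \<open>R\<close> or in \<open>S\<close>. Limits are strong and sequential, the kind that produces
  spectral projections.\<close>

definition op_algebra :: "'h::real_normed_vector operator set \<Rightarrow> bool" where
  "op_algebra R \<longleftrightarrow> id_blinfun \<in> R \<and> (\<forall>A\<in>R. \<forall>B\<in>R. A + B \<in> R) \<and> (\<forall>c. \<forall>A\<in>R. c *\<^sub>R A \<in> R) \<and>
     (\<forall>A\<in>R. \<forall>B\<in>R. A o\<^sub>L B \<in> R) \<and>
     (\<forall>X L. (\<forall>n::nat. X n \<in> R) \<and> (\<forall>x. (\<lambda>n. blinfun_apply (X n) x) \<longlonglongrightarrow> blinfun_apply L x) \<longrightarrow> L \<in> R)"

lemma op_algebraD:
  assumes "op_algebra R"
  shows "id_blinfun \<in> R" "A \<in> R \<Longrightarrow> B \<in> R \<Longrightarrow> A + B \<in> R" "A \<in> R \<Longrightarrow> c *\<^sub>R A \<in> R"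
    "A \<in> R \<Longrightarrow> B \<in> R \<Longrightarrow> A o\<^sub>L B \<in> R"
  using assms unfolding op_algebra_def by blast+

lemma op_algebra_limit:
  fixes L :: "'h::real_normed_vector operator"
  assumes "op_algebra R" "\<And>n::nat. X n \<in> R" "\<And>x. (\<lambda>n. X n x) \<longlonglongrightarrow> L x"
  shows "L \<in> R"
  using assms unfolding op_algebra_def by blast

lemma op_algebra_0: "op_algebra R \<Longrightarrow> 0 \<in> R"
  using op_algebraD(1) op_algebraD(3)[of R id_blinfun 0] by auto

lemma op_algebra_diff: "op_algebra R \<Longrightarrow> A \<in> R \<Longrightarrow> B \<in> R \<Longrightarrow> A - B \<in> R"
  using op_algebraD(2)[of R A "-1 *\<^sub>R B"] op_algebraD(3)[of R B "-1"] by simp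

lemma op_algebra_sum: "op_algebra R \<Longrightarrow> (\<And>i. i \<in> I \<Longrightarrow> f i \<in> R) \<Longrightarrow> sum f I \<in> R"
  by (induction I rule: infinite_finite_induct) (auto simp: op_algebra_0 op_algebraD)

lemma op_algebra_poly_op: "op_algebra R \<Longrightarrow> A \<in> R \<Longrightarrow> poly_op p A \<in> R"
  by (induction p) (auto simp: op_algebra_0 op_algebraD)

lemma op_algebra_cfc:
  fixes A :: "'h::{real_inner, banach} operator"
  assumes "op_algebra R" "A \<in> R" "between a b A" "continuous_on {a..b} f"
  shows "cfc a b f A \<in> R"
proof -
  obtain q where q: "(\<lambda>n::nat. poly_op (q n) A) \<longlonglongrightarrow> cfc a b f A"
    by (rule cfc_limit_poly[OF assms(3,4)])
  show ?thesis
  proof (rule op_algebra_limit[OF assms(1)])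
    show "poly_op (q n) A \<in> R" for n using assms(1,2) by (rule op_algebra_poly_op)
    show "(\<lambda>n. poly_op (q n) A x) \<longlonglongrightarrow> cfc a b f A x" for x
      by (rule blinfun.tendsto[OF q tendsto_const])
  qed
qed

lemma blinfun_pointwise_limit:
  fixes T :: "nat \<Rightarrow> 'a::real_normed_vector \<Rightarrow>\<^sub>L 'b::real_normed_vector"
  assumes bd: "\<And>n. norm (T n) \<le> K" and conv: "\<And>x. convergent (\<lambda>n. T n x)"
  shows "\<exists>L :: 'a \<Rightarrow>\<^sub>L 'b. \<forall>x. (\<lambda>n. T n x) \<longlonglongrightarrow> L x"
proof -
  define f where "f x = lim (\<lambda>n. T n x)" for x
  have f: "(\<lambda>n. T n x) \<longlonglongrightarrow> f x" for x
    using conv unfolding f_def by (simp add: convergent_LIMSEQ_iff)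
  have "bounded_linear f"
  proof (rule bounded_linear_intro[where K = K])
    fix x y
    have "(\<lambda>n. T n (x + y)) \<longlonglongrightarrow> f x + f y"
      unfolding blinfun.add_right by (intro tendsto_add f)
    then show "f (x + y) = f x + f y" using f LIMSEQ_unique by blast
  next
    fix r x
    have "(\<lambda>n. T n (r *\<^sub>R x)) \<longlonglongrightarrow> r *\<^sub>R f x"
      unfolding blinfun.scaleR_right by (intro tendsto_scaleR tendsto_const f)
    then show "f (r *\<^sub>R x) = r *\<^sub>R f x" using f LIMSEQ_unique by blast
  next
    fix x
    have "norm (T n x) \<le> norm x * K" for n
    proof -
      have "norm (T n x) \<le> norm (T n) * norm x" by (rule norm_blinfun)
      also have "\<dots> \<le> K * norm x" using bd by (intro mult_right_mono) auto
      finally show ?thesis by (simp add: mult.commute)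
    qed
    then show "norm (f x) \<le> norm x * K"
      by (intro LIMSEQ_le_const2[OF tendsto_norm[OF f]]) auto
  qed
  then have "\<forall>x. (\<lambda>n. T n x) \<longlonglongrightarrow> Blinfun f x"
    using f by (simp add: bounded_linear_Blinfun_apply)
  then show ?thesis by blast
qed

section \<open>Spectral projections\<close>

text \<open>
  As \<open>n\<close> grows, \<open>ramp n l\<close> decreases to the indicator of \<open>(-\<infinity>, l]\<close>.  It equals \<open>1\<close> up to
  \<open>l + 1 / n\<close>, beyond \<open>l\<close> itself; this makes the limit projections continuous from the right.
\<close>

definition ramp :: "nat \<Rightarrow> real \<Rightarrow> real \<Rightarrow> real" where
  "ramp n l t = max 0 (min 1 (2 - real n * (t - l)))"

lemma continuous_on_ramp [continuous_intros]: "continuous_on S (ramp n l)"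
  unfolding ramp_def by (intro continuous_intros)

lemma ramp_bounds: "0 \<le> ramp n l t" "ramp n l t \<le> 1"
  by (auto simp: ramp_def)

lemma ramp_eq_1: "t \<le> l \<Longrightarrow> ramp n l t = 1"
  using mult_nonneg_nonpos[of "real n" "t - l"] by (auto simp: ramp_def)

lemma ramp_antimono: "m \<le> n \<Longrightarrow> ramp n l t \<le> ramp m l t"
proof (cases "t \<le> l")
  case True
  then show ?thesis by (simp add: ramp_eq_1)
next
  case False
  moreover assume "m \<le> n"
  ultimately have "real m * (t - l) \<le> real n * (t - l)" by (intro mult_right_mono) auto
  then show ?thesis by (auto simp: ramp_def)
qed

lemma ramp_mono: "l \<le> l' \<Longrightarrow> ramp n l t \<le> ramp n l' t"
  using mult_left_mono[of "t - l'" "t - l" "real n"] by (auto simp: ramp_def)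

lemma ramp_eq_0: "l < t \<Longrightarrow> 2 / (t - l) \<le> real n \<Longrightarrow> ramp n l t = 0"
  by (auto simp: ramp_def field_simps)

text \<open>\<open>ramp (2 * n) l\<close> has reached 0 at \<open>l + 1 / n\<close>, just where
  \<open>ramp n l\<close> begins to fall. This is what makes the limit idempotent.\<close>

lemma ramp_double: "ramp (2 * n) l t \<le> ramp n l t * ramp n l t"
proof (cases "real n * (t - l) \<le> 1")
  case True
  then show ?thesis by (auto simp: ramp_def)
next
  case False
  then have "ramp (2 * n) l t = 0" by (auto simp: ramp_def)
  then show ?thesis by simp
qed

definition spec_proj :: "real \<Rightarrow> real \<Rightarrow> 'h::real_normed_vector operator \<Rightarrow> real \<Rightarrow> 'h operator" where
  "spec_proj a b A l = (THE E :: 'h operator. \<forall>x. (\<lambda>n. cfc a b (ramp n l) A x) \<longlonglongrightarrow> E x)"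

lemma sym_op_inner_self: "sym_op S \<Longrightarrow> (norm (S x))\<^sup>2 = (S o\<^sub>L S) x \<bullet> x"
  by (simp add: power2_norm_eq_inner sym_opD)

text \<open>A vector \<open>y\<close> in the range of \<open>P\<close> satisfies
  \<open>y \<bullet> y = P y \<bullet> y \<le> Q y \<bullet> y\<close>, hence \<open>y - Q y\<close>
  has length 0. The second identity is the first one transposed.\<close>

lemma sym_idem_absorb:
  fixes P Q :: "'h::real_inner operator"
  assumes P: "sym_op P" "P o\<^sub>L P = P" and Q: "sym_op Q" "Q o\<^sub>L Q = Q"
    and le: "\<And>x. P x \<bullet> x \<le> Q x \<bullet> x"
  shows "Q o\<^sub>L P = P" "P o\<^sub>L Q = P"
proof -
  have idem: "P (P z) = P z" "Q (Q z) = Q z" for z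
    using P(2) Q(2) by (metis blinfun_apply_blinfun_compose)+
  have QP: "Q (P x) = P x" for x
  proof -
    let ?y = "P x"
    have "?y \<bullet> ?y = P ?y \<bullet> ?y" by (simp add: idem)
    also have "\<dots> \<le> Q ?y \<bullet> ?y" by (rule le)
    finally have "(?y - Q ?y) \<bullet> (?y - Q ?y) \<le> 0"
      using sym_opD[OF Q(1), of "Q ?y" ?y] by (simp add: idem inner_diff inner_commute)
    then have "?y - Q ?y = 0" by (metis inner_ge_zero antisym inner_eq_zero_iff)
    then show ?thesis by simp
  qed
  then show "Q o\<^sub>L P = P" by (auto intro: blinfun_eqI)
  have "(P o\<^sub>L Q) x \<bullet> y = P x \<bullet> y" for x y
    by (simp add: sym_opD[OF P(1)] sym_opD[OF Q(1)] QP)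
  then have "(P o\<^sub>L Q) x = P x" for x
    by (metis inner_commute vector_eq_rdot)
  then show "P o\<^sub>L Q = P" by (auto intro: blinfun_eqI)
qed

context
  fixes A :: "'h::{real_inner, banach} operator" and a b :: real
  assumes A: "between a b A"
begin

text \<open>The difference of two ramps takes values in \<open>[0, 1]\<close>, so its square lies
  below it. Convergence of the decreasing forms thus forces convergence of the vectors
  themselves.\<close>

lemma ramp_difference_norm:
  assumes "m \<le> n"
  shows "(norm ((cfc a b (ramp m l) A - cfc a b (ramp n l) A) x))\<^sup>2
     \<le> cfc a b (ramp m l) A x \<bullet> x - cfc a b (ramp n l) A x \<bullet> x"
proof -
  let ?g = "\<lambda>t. ramp m l t - ramp n l t"
  have g: "continuous_on {a..b} ?g" by (intro continuous_intros)
  have eq: "cfc a b ?g A = cfc a b (ramp m l) A - cfc a b (ramp n l) A"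
    by (rule cfc_diff[OF A]) (intro continuous_intros)+
  have "(norm (cfc a b ?g A x))\<^sup>2 = cfc a b (\<lambda>t. ?g t * ?g t) A x \<bullet> x"
    by (subst cfc_mult[OF A g g]) (rule sym_op_inner_self[OF sym_op_cfc[OF A g]])
  also have "\<dots> \<le> cfc a b ?g A x \<bullet> x"
  proof (rule cfc_mono[OF A])
    fix t
    have "0 \<le> ?g t" "?g t \<le> 1"
      using ramp_antimono[OF assms, of l t] ramp_bounds[of m l t] ramp_bounds[of n l t] by linarith+
    then show "?g t * ?g t \<le> ?g t" using mult_left_le_one_le[of "?g t" "?g t"] by simp
  qed (intro continuous_intros)+
  finally show ?thesis by (simp add: eq blinfun.diff_left inner_diff_left)
qed

lemma tendsto_spec_proj: "(\<lambda>n. cfc a b (ramp n l) A x) \<longlonglongrightarrow> spec_proj a b A l x"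
proof -
  let ?T = "\<lambda>n. cfc a b (ramp n l) A"
  have conv: "convergent (\<lambda>n. ?T n x)" for x
  proof -
    have dec: "decseq (\<lambda>n. ?T n x \<bullet> x)"
      by (intro decseq_SucI cfc_mono[OF A] continuous_on_ramp ramp_antimono) simp
    moreover have "0 \<le> ?T n x \<bullet> x" for n
      by (intro cfc_nonneg[OF A] continuous_on_ramp ramp_bounds)
    ultimately obtain L where "(\<lambda>n. ?T n x \<bullet> x) \<longlonglongrightarrow> L"
      using decseq_convergent[of "\<lambda>n. ?T n x \<bullet> x" 0] by blast
    then have "Cauchy (\<lambda>n. ?T n x \<bullet> x)"
      by (rule LIMSEQ_imp_Cauchy)
    have "Cauchy (\<lambda>n. ?T n x)"
    proof (rule metric_CauchyI)
      fix e :: real assume e: "0 < e"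
      then have "0 < e\<^sup>2" by simp
      then obtain M where M: "\<And>m n. m \<ge> M \<Longrightarrow> n \<ge> M \<Longrightarrow> dist (?T m x \<bullet> x) (?T n x \<bullet> x) < e\<^sup>2"
        using metric_CauchyD[OF \<open>Cauchy (\<lambda>n. ?T n x \<bullet> x)\<close>] by meson
      have le: "dist (?T m x) (?T n x) < e" if "m \<ge> M" "m \<le> n" for m n
      proof -
        have "(norm (?T m x - ?T n x))\<^sup>2 \<le> ?T m x \<bullet> x - ?T n x \<bullet> x"
          using ramp_difference_norm[OF that(2)] by (simp add: blinfun.diff_left)
        also have "\<dots> < e\<^sup>2"
          using M[of m n] that by (simp add: dist_real_def)
        finally show ?thesis
          using e by (simp add: dist_norm power2_less_imp_less)
      qed
      have "dist (?T m x) (?T n x) < e" if "m \<ge> M" "n \<ge> M" for m n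
        using le[of m n] le[of n m] that by (cases "m \<le> n") (auto simp: dist_commute)
      then show "\<exists>M. \<forall>m\<ge>M. \<forall>n\<ge>M. dist (?T m x) (?T n x) < e" by blast
    qed
    then show ?thesis by (simp add: Cauchy_convergent_iff)
  qed
  have "\<exists>L :: 'h operator. \<forall>x. (\<lambda>n. ?T n x) \<longlonglongrightarrow> L x"
    by (rule blinfun_pointwise_limit[where K = 1])
      (use ramp_bounds in \<open>auto intro!: cfc_norm_le[OF A] continuous_intros conv\<close>)
  then have "\<exists>!L :: 'h operator. \<forall>x. (\<lambda>n. ?T n x) \<longlonglongrightarrow> L x"
    by (blast intro: blinfun_eqI LIMSEQ_unique)
  then show ?thesis
    unfolding spec_proj_def by (rule theI'[THEN spec])
qed

lemma tendsto_spec_proj_form: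
  "(\<lambda>n. cfc a b (ramp n l) A x \<bullet> x) \<longlonglongrightarrow> spec_proj a b A l x \<bullet> x"
  by (intro tendsto_inner tendsto_spec_proj tendsto_const)

lemma sym_op_spec_proj: "sym_op (spec_proj a b A l)"
  by (rule sym_op_limit[OF sym_op_cfc[OF A continuous_on_ramp] tendsto_spec_proj])

lemma spec_proj_in: "op_algebra R \<Longrightarrow> A \<in> R \<Longrightarrow> spec_proj a b A l \<in> R"
  by (rule op_algebra_limit[OF _ op_algebra_cfc[OF _ _ A continuous_on_ramp] tendsto_spec_proj])

text \<open>A single \<open>n\<close> is enough because the ramps decrease with \<open>n\<close>;
  for the bound from below all \<open>n\<close> have to be controlled.\<close>

lemma spec_proj_le_cfc:
  assumes "continuous_on {a..b} g" "\<And>t. a \<le> t \<Longrightarrow> t \<le> b \<Longrightarrow> ramp n l t \<le> g t"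
  shows "spec_proj a b A l x \<bullet> x \<le> cfc a b g A x \<bullet> x"
proof (rule LIMSEQ_le_const2[OF tendsto_spec_proj_form], intro exI[of _ n] allI impI)
  fix k assume "n \<le> k"
  then show "cfc a b (ramp k l) A x \<bullet> x \<le> cfc a b g A x \<bullet> x"
    by (intro cfc_mono[OF A] continuous_on_ramp assms(1) order_trans[OF ramp_antimono assms(2)])
qed

lemma cfc_le_spec_proj:
  assumes "continuous_on {a..b} g" "\<And>n t. a \<le> t \<Longrightarrow> t \<le> b \<Longrightarrow> g t \<le> ramp n l t"
  shows "cfc a b g A x \<bullet> x \<le> spec_proj a b A l x \<bullet> x"
  by (rule LIMSEQ_le_const[OF tendsto_spec_proj_form])
    (intro exI[of _ 0] allI impI cfc_mono[OF A] continuous_on_ramp assms)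

lemma spec_proj_mono:
  assumes "l \<le> l'"
  shows "spec_proj a b A l x \<bullet> x \<le> spec_proj a b A l' x \<bullet> x"
  by (rule LIMSEQ_le[OF tendsto_spec_proj_form tendsto_spec_proj_form])
    (intro exI[of _ 0] allI impI cfc_mono[OF A] continuous_on_ramp ramp_mono assms)

text \<open>Compare forms: ramps with values in \<open>[0, 1]\<close> dominate their squares, and
  \<open>ramp_double\<close> gives the opposite bound in the limit.\<close>

lemma spec_proj_idem: "spec_proj a b A l o\<^sub>L spec_proj a b A l = spec_proj a b A l"
proof (rule sym_op_eqI)
  let ?P = "spec_proj a b A l" and ?T = "\<lambda>n. cfc a b (ramp n l) A"
  show "sym_op ?P" "sym_op (?P o\<^sub>L ?P)"
    by (auto intro!: sym_op_spec_proj sym_op_compose)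
  fix x
  have sq: "(norm (?T n x))\<^sup>2 = cfc a b (\<lambda>t. ramp n l t * ramp n l t) A x \<bullet> x" for n
    unfolding cfc_mult[OF A continuous_on_ramp continuous_on_ramp]
    by (rule sym_op_inner_self[OF sym_op_cfc[OF A continuous_on_ramp]])
  have lim: "(\<lambda>n. (norm (?T n x))\<^sup>2) \<longlonglongrightarrow> (norm (?P x))\<^sup>2"
    by (intro tendsto_power tendsto_norm tendsto_spec_proj)
  have "(norm (?P x))\<^sup>2 \<le> ?P x \<bullet> x"
  proof (rule LIMSEQ_le[OF lim tendsto_spec_proj_form], intro exI[of _ 0] allI impI)
    fix n
    have "ramp n l t * ramp n l t \<le> ramp n l t" for t
      using mult_left_mono[OF ramp_bounds(2)[of n l t] ramp_bounds(1)[of n l t]] by simp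
    then show "(norm (?T n x))\<^sup>2 \<le> ?T n x \<bullet> x"
      unfolding sq by (intro cfc_mono[OF A] continuous_on_mult continuous_on_ramp)
  qed
  moreover have "?P x \<bullet> x \<le> (norm (?P x))\<^sup>2"
  proof (rule LIMSEQ_le_const[OF lim], intro exI[of _ 0] allI impI)
    fix n
    show "?P x \<bullet> x \<le> (norm (?T n x))\<^sup>2"
      unfolding sq
      by (rule spec_proj_le_cfc[of _ "2 * n"]) (auto intro!: continuous_on_mult continuous_on_ramp ramp_double)
  qed
  ultimately show "(?P o\<^sub>L ?P) x \<bullet> x = ?P x \<bullet> x"
    using sym_op_inner_self[OF sym_op_spec_proj] by (metis antisym)
qed

lemma spec_proj_eq_0: "l < a \<Longrightarrow> spec_proj a b A l = 0"
proof (rule sym_op_eqI[OF sym_op_spec_proj sym_op_0])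
  fix x assume l: "l < a"
  obtain n :: nat where n: "2 / (a - l) \<le> real n" using real_arch_simple by blast
  have "spec_proj a b A l x \<bullet> x \<le> cfc a b (\<lambda>t. 0) A x \<bullet> x"
  proof (rule spec_proj_le_cfc[of _ n])
    fix t assume t: "a \<le> t"
    have "2 / (t - l) \<le> 2 / (a - l)" using l t by (intro divide_left_mono) auto
    then show "ramp n l t \<le> 0" using n l t by (subst ramp_eq_0) auto
  qed auto
  moreover have "cfc a b (\<lambda>t. 0) A x \<bullet> x \<le> spec_proj a b A l x \<bullet> x"
    by (rule cfc_le_spec_proj) (auto simp: ramp_bounds)
  ultimately show "spec_proj a b A l x \<bullet> x = blinfun_apply 0 x \<bullet> x"
    by (simp add: cfc_const[OF A])
qed

lemma spec_proj_eq_id: "b \<le> l \<Longrightarrow> spec_proj a b A l = id_blinfun"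
proof (rule sym_op_eqI[OF sym_op_spec_proj sym_op_id])
  fix x assume l: "b \<le> l"
  have "spec_proj a b A l x \<bullet> x \<le> cfc a b (\<lambda>t. 1) A x \<bullet> x"
    by (rule spec_proj_le_cfc) (auto simp: ramp_bounds)
  moreover have "cfc a b (\<lambda>t. 1) A x \<bullet> x \<le> spec_proj a b A l x \<bullet> x"
    by (rule cfc_le_spec_proj) (use l in \<open>auto simp: ramp_eq_1\<close>)
  ultimately show "spec_proj a b A l x \<bullet> x = id_blinfun x \<bullet> x"
    by (simp add: cfc_const[OF A])
qed

lemma spec_proj_absorb:
  assumes "l \<le> l'"
  shows "spec_proj a b A l' (spec_proj a b A l x) = spec_proj a b A l x"
  using sym_idem_absorb(1)[OF sym_op_spec_proj spec_proj_idem sym_op_spec_proj spec_proj_idem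
      spec_proj_mono[OF assms]]
  by (metis blinfun_apply_blinfun_compose)

text \<open>Nested projections differ by a projection; strong convergence of the family therefore
  reduces to convergence of its forms.\<close>

lemma norm_spec_proj_diff:
  assumes "l \<le> l'"
  shows "(norm (spec_proj a b A l' x - spec_proj a b A l x))\<^sup>2
     = spec_proj a b A l' x \<bullet> x - spec_proj a b A l x \<bullet> x"
proof -
  let ?P = "spec_proj a b A"
  have "?P l' (?P l' z) = ?P l' z" "?P l (?P l z) = ?P l z" for z
    using spec_proj_idem by (metis blinfun_apply_blinfun_compose)+
  then have "?P l' x \<bullet> ?P l' x = ?P l' x \<bullet> x" "?P l x \<bullet> ?P l x = ?P l x \<bullet> x" "?P l' x \<bullet> ?P l x = ?P l x \<bullet> x"
    using sym_opD[OF sym_op_spec_proj, of l' "?P l' x" x] sym_opD[OF sym_op_spec_proj, of l "?P l x" x]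
      sym_opD[OF sym_op_spec_proj, of l' x "?P l x"]
    by (simp_all add: spec_proj_absorb[OF assms] inner_commute)
  then show ?thesis
    by (simp add: power2_norm_eq_inner inner_diff inner_commute)
qed

lemma spec_proj_right_continuous:
  "((\<lambda>s. spec_proj a b A s x) \<longlongrightarrow> spec_proj a b A l x) (at_right l)"
proof (rule tendstoI)
  fix e :: real assume e: "0 < e"
  let ?P = "spec_proj a b A"
  have "\<forall>\<^sub>F n in sequentially. cfc a b (ramp n l) A x \<bullet> x < ?P l x \<bullet> x + e\<^sup>2"
    by (rule order_tendstoD(2)[OF tendsto_spec_proj_form]) (use e in simp)
  then obtain N where N: "\<And>n. N \<le> n \<Longrightarrow> cfc a b (ramp n l) A x \<bullet> x < ?P l x \<bullet> x + e\<^sup>2"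
    unfolding eventually_sequentially by blast
  define n where "n = Suc N"
  have n: "0 < n" "cfc a b (ramp n l) A x \<bullet> x < ?P l x \<bullet> x + e\<^sup>2"
    using N[of n] by (auto simp: n_def)
  \<comment> \<open>Up to \<open>l + 1 / n\<close> the function \<open>ramp n l\<close> is still 1,
    so it dominates steep ramps at any \<open>s\<close> before that point.\<close>
  have "dist (?P s x) (?P l x) < e" if s: "l < s" "s < l + 1 / real n" for s
  proof -
    \<comment> \<open>Steep enough for \<open>ramp m s\<close> to vanish beyond
      \<open>l + 1 / n\<close>.\<close>
    obtain m :: nat where m: "2 / (l + 1 / real n - s) \<le> real m" using real_arch_simple by blast
    have "?P s x \<bullet> x \<le> cfc a b (ramp n l) A x \<bullet> x"
    proof (rule spec_proj_le_cfc[OF continuous_on_ramp, of m])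
      fix t
      show "ramp m s t \<le> ramp n l t"
      proof (cases "t \<le> l + 1 / real n")
        case True
        then have "ramp n l t = 1" using n(1) by (auto simp: ramp_def field_simps)
        then show ?thesis by (simp add: ramp_bounds)
      next
        case False
        then have "2 / (t - s) \<le> 2 / (l + 1 / real n - s)" using s by (intro divide_left_mono) auto
        then have "ramp m s t = 0" using m s False by (intro ramp_eq_0) auto
        then show ?thesis by (simp add: ramp_bounds)
      qed
    qed
    then have "(norm (?P s x - ?P l x))\<^sup>2 < e\<^sup>2"
      using n(2) norm_spec_proj_diff[of l s x] s by simp
    then show ?thesis using e by (simp add: dist_norm power2_less_imp_less)
  qed
  then show "\<forall>\<^sub>F s in at_right l. dist (?P s x) (?P l x) < e"
    unfolding eventually_at_right_field using n(1) by (intro exI[of _ "l + 1 / real n"]) auto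
qed

text \<open>The difference \<open>ramp n t - ramp n s\<close> is nonnegative and vanishes up to
  \<open>s\<close> and beyond \<open>t + 2 / n\<close>. Multiplication by the variable is therefore
  pinched between \<open>s\<close> and \<open>t + 2 / n\<close>, and the excess disappears in the
  limit.\<close>

lemma spec_proj_sandwich:
  assumes "s \<le> t"
  shows "s * ((spec_proj a b A t - spec_proj a b A s) x \<bullet> x) \<le> A ((spec_proj a b A t - spec_proj a b A s) x) \<bullet> x"
    and "A ((spec_proj a b A t - spec_proj a b A s) x) \<bullet> x \<le> t * ((spec_proj a b A t - spec_proj a b A s) x \<bullet> x)"
proof -
  let ?P = "spec_proj a b A" and ?T = "\<lambda>n l. cfc a b (ramp n l) A"
  let ?g = "\<lambda>n u. ramp n t u - ramp n s u"
  have g: "continuous_on {a..b} (?g n)" for n by (intro continuous_intros)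
  have gpos: "0 \<le> ?g n u" for n u using ramp_mono[OF assms] by simp
  have idc: "continuous_on {a..b} (\<lambda>u. u)" by (intro continuous_intros)
  have cg: "cfc a b (?g n) A = ?T n t - ?T n s" for n
    by (rule cfc_diff[OF A]) (intro continuous_intros)+
  have "cfc a b (\<lambda>u. u) A = A"
    using cfc_poly[OF A, of "[:0, 1:]"] cfc_cong[OF A, of "poly [:0, 1:]" "\<lambda>u. u"] by simp
  then have ug: "cfc a b (\<lambda>u. u * ?g n u) A = A o\<^sub>L (?T n t - ?T n s)" for n
    using cfc_mult[OF A idc g, of n] by (simp add: cg)
  have dlim: "(\<lambda>n. (?T n t - ?T n s) x) \<longlonglongrightarrow> (?P t - ?P s) x"
    unfolding blinfun.diff_left by (intro tendsto_diff tendsto_spec_proj)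
  have lim1: "(\<lambda>n. A ((?T n t - ?T n s) x) \<bullet> x) \<longlonglongrightarrow> A ((?P t - ?P s) x) \<bullet> x"
    by (intro tendsto_inner blinfun.tendsto tendsto_const dlim)
  have lim2: "(\<lambda>n. (?T n t - ?T n s) x \<bullet> x) \<longlonglongrightarrow> (?P t - ?P s) x \<bullet> x"
    by (intro tendsto_inner tendsto_const dlim)
  have "(\<lambda>n. 2 * (1 / real n)) \<longlonglongrightarrow> 2 * 0"
    by (intro tendsto_mult tendsto_const lim_1_over_n)
  then have lim3: "(\<lambda>n. (t + 2 / real n) * ((?T n t - ?T n s) x \<bullet> x)) \<longlonglongrightarrow> (t + 0) * ((?P t - ?P s) x \<bullet> x)"
    by (intro tendsto_mult tendsto_add tendsto_const lim2) simp
  show "s * ((?P t - ?P s) x \<bullet> x) \<le> A ((?P t - ?P s) x) \<bullet> x"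
  proof (rule LIMSEQ_le[OF tendsto_mult[OF tendsto_const lim2] lim1], intro exI[of _ 0] allI impI)
    fix n
    have "s * ?g n u \<le> u * ?g n u" for u
      by (cases "u \<le> s") (use assms gpos[of n u] in \<open>auto simp: ramp_eq_1 mult_right_mono\<close>)
    then have "cfc a b (\<lambda>u. s * ?g n u) A x \<bullet> x \<le> cfc a b (\<lambda>u. u * ?g n u) A x \<bullet> x"
      by (intro cfc_mono[OF A] continuous_intros)
    then show "s * ((?T n t - ?T n s) x \<bullet> x) \<le> A ((?T n t - ?T n s) x) \<bullet> x"
      by (simp add: cfc_scale[OF A g] cg ug blinfun.scaleR_left)
  qed
  have "A ((?P t - ?P s) x) \<bullet> x \<le> (t + 0) * ((?P t - ?P s) x \<bullet> x)"
  proof (rule LIMSEQ_le[OF lim1 lim3], intro exI[of _ 1] allI impI)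
    fix n :: nat assume n: "1 \<le> n"
    have "u * ?g n u \<le> (t + 2 / real n) * ?g n u" for u
    proof (cases "u \<le> t + 2 / real n")
      case True
      then show ?thesis using gpos by (rule mult_right_mono)
    next
      case False
      then have "2 \<le> real n * (u - t)" using n by (auto simp: field_simps)
      moreover have "real n * (u - t) \<le> real n * (u - s)" using assms by (intro mult_left_mono) auto
      ultimately have "?g n u = 0" by (auto simp: ramp_def)
      then show ?thesis by simp
    qed
    then have "cfc a b (\<lambda>u. u * ?g n u) A x \<bullet> x \<le> cfc a b (\<lambda>u. (t + 2 / real n) * ?g n u) A x \<bullet> x"
      by (intro cfc_mono[OF A] continuous_intros)
    then show "A ((?T n t - ?T n s) x) \<bullet> x \<le> (t + 2 / real n) * ((?T n t - ?T n s) x \<bullet> x)"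
      by (simp add: cfc_scale[OF A g] cg ug blinfun.scaleR_left)
  qed
  then show "A ((?P t - ?P s) x) \<bullet> x \<le> t * ((?P t - ?P s) x \<bullet> x)" by simp
qed

end

section \<open>Stieltjes integrals and spectral resolutions\<close>

text \<open>Distribution functions of measures of mass \<open>c\<close> on \<open>[a, b]\<close>.
  The mass is a parameter since it is \<open>x \<bullet> x\<close> for the forms of a resolution and
  1 for the trace.\<close>

definition stieltjes :: "real \<Rightarrow> real \<Rightarrow> real \<Rightarrow> (real \<Rightarrow> real) \<Rightarrow> bool" where
  "stieltjes a b c F \<longleftrightarrow> a \<le> b \<and> (\<forall>x y. x \<le> y \<longrightarrow> F x \<le> F y) \<and> (\<forall>t. (F \<longlongrightarrow> F t) (at_right t)) \<and>
     (\<forall>t<a. F t = 0) \<and> (\<forall>t\<ge>b. F t = c)"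

context
  fixes a b c :: real and F :: "real \<Rightarrow> real"
  assumes F: "stieltjes a b c F"
begin

lemma stieltjes_mono: "x \<le> y \<Longrightarrow> F x \<le> F y"
  using F by (simp add: stieltjes_def)

lemma stieltjes_cont: "continuous (at_right t) F"
  using F by (simp add: stieltjes_def continuous_within)

lemma stieltjes_at_bot: "(F \<longlongrightarrow> 0) at_bot"
  by (rule tendsto_eventually) (use F in \<open>auto simp: stieltjes_def eventually_at_bot_dense\<close>)

lemma stieltjes_at_top: "(F \<longlongrightarrow> c) at_top"
  by (rule tendsto_eventually) (use F in \<open>auto simp: stieltjes_def eventually_at_top_linorder\<close>)

lemma stieltjes_nonneg: "0 \<le> c"
proof -
  have "F (a - 1) \<le> F b" using F by (intro stieltjes_mono) (auto simp: stieltjes_def)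
  then show ?thesis using F by (auto simp: stieltjes_def)
qed

lemma stieltjes_finite: "finite_measure (interval_measure F)"
  using finite_borel_measure_interval_measure[OF stieltjes_mono stieltjes_cont stieltjes_at_bot stieltjes_at_top stieltjes_nonneg]
  by (simp add: finite_borel_measure_def)

lemma stieltjes_total: "measure (interval_measure F) UNIV = c"
  using interval_measure_UNIV[OF stieltjes_mono stieltjes_cont stieltjes_at_bot stieltjes_at_top stieltjes_nonneg]
    stieltjes_nonneg by (simp add: measure_def)

lemma stieltjes_Iic: "measure (interval_measure F) {..x} = F x"
  by (rule measure_interval_measure_Iic[OF stieltjes_mono stieltjes_cont stieltjes_at_bot])

lemma stieltjes_Ioc: "x \<le> y \<Longrightarrow> measure (interval_measure F) {x<..y} = F y - F x"
  by (rule measure_interval_measure_Ioc[OF _ stieltjes_mono stieltjes_cont])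

lemma stieltjes_AE: "AE t in interval_measure F. a \<le> t \<and> t \<le> b"
proof -
  interpret finite_measure "interval_measure F" by (rule stieltjes_finite)
  \<comment> \<open>\<open>F\<close> may jump at \<open>a\<close>, so the null half-lines end
    strictly to the left of \<open>a\<close>; countably many of them exhaust
    \<open>{..<a}\<close>.\<close>
  have low: "AE t in interval_measure F. a - 1 / real (Suc n) < t" for n
  proof (rule AE_I')
    show "{..a - 1 / real (Suc n)} \<in> null_sets (interval_measure F)"
      using F stieltjes_Iic[of "a - 1 / real (Suc n)"] by (auto simp: null_sets_def emeasure_eq_measure stieltjes_def)
  qed auto
  have up: "AE t in interval_measure F. t \<le> b"
  proof (rule AE_I')
    have "measure (interval_measure F) (UNIV - {..b}) = c - F b"
      by (subst finite_measure_Diff) (auto simp: stieltjes_total stieltjes_Iic)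
    then show "UNIV - {..b} \<in> null_sets (interval_measure F)"
      using F by (auto simp: null_sets_def emeasure_eq_measure stieltjes_def)
  qed auto
  have "AE t in interval_measure F. \<forall>n. a - 1 / real (Suc n) < t"
    using low by (simp add: AE_all_countable)
  with up show ?thesis
  proof eventually_elim
    case (elim t)
    have "a \<le> t"
    proof (rule ccontr)
      assume "\<not> a \<le> t"
      then obtain n where "1 / real (Suc n) < a - t" using nat_approx_posE[of "a - t"] by auto
      then show False using elim(2)[rule_format, of n] by linarith
    qed
    then show ?case using elim(1) by simp
  qed
qed

lemma stieltjes_integrable:
  fixes f :: "real \<Rightarrow> real"
  assumes "f \<in> borel_measurable borel" "\<And>t. a \<le> t \<Longrightarrow> t \<le> b \<Longrightarrow> \<bar>f t\<bar> \<le> K"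
  shows "integrable (interval_measure F) f"
proof -
  interpret finite_measure "interval_measure F" by (rule stieltjes_finite)
  show ?thesis
  proof (rule integrable_const_bound[of _ K])
    show "AE t in interval_measure F. norm (f t) \<le> K"
      using stieltjes_AE by eventually_elim (use assms(2) in auto)
  qed (use assms(1) in simp)
qed

lemma stieltjes_integrable_continuous:
  fixes f :: "real \<Rightarrow> real"
  assumes f: "f \<in> borel_measurable borel" "continuous_on {a..b} f"
  shows "integrable (interval_measure F) f"
proof -
  obtain K where K: "\<And>t. t \<in> {a..b} \<Longrightarrow> \<bar>f t\<bar> \<le> K"
    using compact_imp_bounded[OF compact_continuous_image[OF f(2) compact_Icc]] unfolding bounded_iff by fastforce
  show ?thesis by (rule stieltjes_integrable[OF f(1), of K]) (use K in auto)
qed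

lemma stieltjes_integral_close:
  fixes f g :: "real \<Rightarrow> real"
  assumes f: "f \<in> borel_measurable borel" "continuous_on {a..b} f"
    and g: "g \<in> borel_measurable borel" "continuous_on {a..b} g"
    and e: "\<And>t. a \<le> t \<Longrightarrow> t \<le> b \<Longrightarrow> \<bar>f t - g t\<bar> \<le> e"
  shows "\<bar>(\<integral>t. f t \<partial>interval_measure F) - (\<integral>t. g t \<partial>interval_measure F)\<bar> \<le> e * c"
proof -
  interpret finite_measure "interval_measure F" by (rule stieltjes_finite)
  have i: "integrable (interval_measure F) f" "integrable (interval_measure F) g"
    by (intro stieltjes_integrable_continuous f g)+
  have "\<bar>(\<integral>t. f t - g t \<partial>interval_measure F)\<bar> \<le> (\<integral>t. e \<partial>interval_measure F)"
  proof (rule order_trans[OF integral_abs_bound], rule integral_mono_AE)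
    show "AE t in interval_measure F. \<bar>f t - g t\<bar> \<le> e"
      using stieltjes_AE by eventually_elim (use e in auto)
  qed (use i in auto)
  then show ?thesis
    using i by (simp add: stieltjes_total mult.commute)
qed

text \<open>Right endpoints as tags match cells that are open on the left. The induction carries the
  mass covered so far, so the total error is \<open>e\<close> times the mass.\<close>

lemma stieltjes_tagged:
  fixes f :: "real \<Rightarrow> real"
  assumes f: "continuous_on UNIV f" and t: "incseq t" and t0: "t 0 < a" and tn: "t n = b"
    and osc: "\<And>i u. i < n \<Longrightarrow> t i < u \<Longrightarrow> u \<le> t (Suc i) \<Longrightarrow> \<bar>f u - f (t (Suc i))\<bar> \<le> e"
  shows "\<bar>(\<integral>u. f u \<partial>interval_measure F) - (\<Sum>i<n. f (t (Suc i)) * (F (t (Suc i)) - F (t i)))\<bar> \<le> e * c"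
proof -
  interpret finite_measure "interval_measure F" by (rule stieltjes_finite)
  let ?N = "interval_measure F"
  have fm: "f \<in> borel_measurable borel" by (rule borel_measurable_continuous_onI[OF f])
  have fi: "integrable ?N f"
    by (rule stieltjes_integrable_continuous[OF fm continuous_on_subset[OF f]]) auto
  have ii: "integrable ?N (\<lambda>u. indicator {x<..y} u * f u)" for x y
    using integrable_mult_indicator[OF _ fi, of "{x<..y}"] by simp
  have ic: "integrable ?N (\<lambda>u. indicator {x<..y} u * k)" for x y k :: real
    using integrable_mult_indicator[of "{x<..y}" ?N "\<lambda>_. k"] by simp
  have le: "t i \<le> t j" if "i \<le> j" for i j using t that by (simp add: incseq_def)
  have part: "\<bar>(\<integral>u. indicator {t 0<..t m} u * f u \<partial>?N) - (\<Sum>i<m. f (t (Suc i)) * (F (t (Suc i)) - F (t i)))\<bar>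
      \<le> e * (F (t m) - F (t 0))" if "m \<le> n" for m
    using that
  proof (induction m)
    case (Suc m)
    let ?J = "{t m<..t (Suc m)}"
    have J: "(\<integral>u. indicator ?J u * k \<partial>?N) = k * (F (t (Suc m)) - F (t m))" for k :: real
      using stieltjes_Ioc[OF le[of m "Suc m"]] by simp
    have "indicator {t 0<..t (Suc m)} u * f u = indicator {t 0<..t m} u * f u + indicator ?J u * f u" for u
      using le[of 0 m] le[of m "Suc m"] by (auto simp: indicator_def)
    then have split: "(\<integral>u. indicator {t 0<..t (Suc m)} u * f u \<partial>?N)
        = (\<integral>u. indicator {t 0<..t m} u * f u \<partial>?N) + (\<integral>u. indicator ?J u * f u \<partial>?N)"
      using ii by simp
    have "\<bar>(\<integral>u. indicator ?J u * f u - indicator ?J u * f (t (Suc m)) \<partial>?N)\<bar> \<le> (\<integral>u. indicator ?J u * e \<partial>?N)"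
      by (rule order_trans[OF integral_abs_bound], rule integral_mono)
        (use ii ic osc[of m] Suc.prems in \<open>auto simp: indicator_def\<close>)
    then have "\<bar>(\<integral>u. indicator ?J u * f u \<partial>?N) - f (t (Suc m)) * (F (t (Suc m)) - F (t m))\<bar>
        \<le> e * (F (t (Suc m)) - F (t m))"
      using ii ic by (simp only: J Bochner_Integration.integral_diff)
    moreover have "e * (F (t (Suc m)) - F (t 0)) = e * (F (t m) - F (t 0)) + e * (F (t (Suc m)) - F (t m))"
      by (simp add: algebra_simps)
    ultimately show ?case
      using Suc.IH Suc.prems unfolding split sum.lessThan_Suc by linarith
  qed simp
  have "(\<integral>u. indicator {t 0<..t n} u * f u \<partial>?N) = (\<integral>u. f u \<partial>?N)"
  proof (rule integral_cong_AE)
    show "AE u in ?N. indicator {t 0<..t n} u * f u = f u"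
      using stieltjes_AE by eventually_elim (use t0 tn in auto)
  qed (use fm in auto)
  moreover have "F (t n) - F (t 0) = c"
    using F t0 tn by (auto simp: stieltjes_def)
  ultimately show ?thesis using part[of n] by simp
qed

end

text \<open>
  The mesh starts at \<open>a - 1\<close> because a Stieltjes measure on \<open>[a, b]\<close> may have an atom at \<open>a\<close>, which the
  half-open cells would otherwise miss.
\<close>

definition mesh_point :: "real \<Rightarrow> real \<Rightarrow> nat \<Rightarrow> nat \<Rightarrow> real" where
  "mesh_point a b n i = a - 1 + real i * ((b - a + 1) / real n)"

context
  fixes a b :: real
  assumes ab: "a \<le> b"
begin

lemma mesh_point_incseq: "incseq (mesh_point a b n)"
  unfolding incseq_def mesh_point_def using ab by (intro allI impI add_left_mono mult_right_mono) auto

lemma mesh_point_0: "mesh_point a b n 0 < a"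
  by (simp add: mesh_point_def)

lemma mesh_point_n: "0 < n \<Longrightarrow> mesh_point a b n n = b"
  by (simp add: mesh_point_def)

lemma mesh_point_step: "mesh_point a b n (Suc i) = mesh_point a b n i + (b - a + 1) / real n"
  by (simp add: mesh_point_def algebra_simps add_divide_distrib diff_divide_distrib)

lemma mesh_size_small:
  assumes "0 < e"
  shows "\<exists>N>0. \<forall>n\<ge>N. (b - a + 1) / real n < e"
proof -
  obtain N :: nat where N: "(b - a + 1) / e < real N" using reals_Archimedean2 by blast
  have "0 < (b - a + 1) / e" using ab assms by simp
  then have N0: "0 < N" using N by (metis of_nat_0_less_iff order.strict_trans)
  have "(b - a + 1) / real n < e" if "n \<ge> N" for n
  proof -
    have "(b - a + 1) / e < real n" using N that by simp
    moreover have "0 < real n" using N0 that by simp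
    ultimately show ?thesis using assms by (simp add: field_simps)
  qed
  then show ?thesis using N0 by blast
qed

text \<open>\<open>N\<close> precedes \<open>F\<close> and \<open>c\<close>: the estimate is uniform
  in the distribution function. Applied to all forms of a resolution with the same \<open>N\<close>,
  it becomes a norm estimate.\<close>

lemma stieltjes_riemann:
  assumes f: "continuous_on UNIV f" and e: "0 < e"
  obtains N where "0 < N" "\<And>n c F. N \<le> n \<Longrightarrow> stieltjes a b c F \<Longrightarrow>
    \<bar>(\<integral>u. f u \<partial>interval_measure F)
      - (\<Sum>i<n. f (mesh_point a b n (Suc i)) * (F (mesh_point a b n (Suc i)) - F (mesh_point a b n i)))\<bar> \<le> e * c"
proof -
  have "uniformly_continuous_on {a - 1..b} f"
    by (rule compact_uniformly_continuous[OF continuous_on_subset[OF f]]) auto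
  then obtain d where d: "0 < d" "\<And>u v. u \<in> {a - 1..b} \<Longrightarrow> v \<in> {a - 1..b} \<Longrightarrow> dist u v < d \<Longrightarrow> dist (f u) (f v) < e"
    using e unfolding uniformly_continuous_on_def by metis
  obtain N where N: "0 < N" "\<And>n. n \<ge> N \<Longrightarrow> (b - a + 1) / real n < d"
    using mesh_size_small[OF d(1)] by blast
  show thesis
  proof (rule that[OF N(1)])
    fix n c F assume n: "N \<le> n" and F: "stieltjes a b c F"
    let ?t = "mesh_point a b n"
    show "\<bar>(\<integral>u. f u \<partial>interval_measure F) - (\<Sum>i<n. f (?t (Suc i)) * (F (?t (Suc i)) - F (?t i)))\<bar> \<le> e * c"
    proof (rule stieltjes_tagged[OF F f mesh_point_incseq mesh_point_0])
      show "?t n = b" using N(1) n by (intro mesh_point_n) auto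
      fix i u assume i: "i < n" "?t i < u" "u \<le> ?t (Suc i)"
      have "a - 1 \<le> ?t i" using incseqD[OF mesh_point_incseq, of 0 i n] by (simp add: mesh_point_def)
      moreover have "?t (Suc i) \<le> ?t n" using incseqD[OF mesh_point_incseq, of "Suc i" n n] i by simp
      ultimately have "dist (f u) (f (?t (Suc i))) < e"
        using i N(2)[OF n] mesh_point_n[of n] mesh_point_step[of n i]
        by (intro d(2)) (auto simp: dist_real_def)
      then show "\<bar>f u - f (?t (Suc i))\<bar> \<le> e" by (simp add: dist_real_def)
    qed
  qed
qed

end

text \<open>Orthogonality kills the mixed products, and \<open>one\<close> provides the constant
  coefficient.\<close>

lemma poly_op_orthogonal_sum:
  assumes I: "finite I" and Q: "\<And>i j. i \<in> I \<Longrightarrow> j \<in> I \<Longrightarrow> Q i o\<^sub>L Q j = (if i = j then Q i else 0)"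
    and one: "(\<Sum>i\<in>I. Q i) = id_blinfun"
  shows "poly_op p (\<Sum>i\<in>I. c i *\<^sub>R Q i) = (\<Sum>i\<in>I. poly p (c i) *\<^sub>R Q i)"
proof (induction p)
  case (pCons k p)
  have "(\<Sum>i\<in>I. c i *\<^sub>R Q i) o\<^sub>L (\<Sum>j\<in>I. poly p (c j) *\<^sub>R Q j)
      = (\<Sum>i\<in>I. \<Sum>j\<in>I. (c i * poly p (c j)) *\<^sub>R (Q i o\<^sub>L Q j))"
    by (simp add: blinfun_compose_sum blinfun_compose_scaleR scaleR_sum_right mult.commute)
      (rule sum.swap)
  also have "\<dots> = (\<Sum>i\<in>I. \<Sum>j\<in>I. if i = j then (c i * poly p (c j)) *\<^sub>R Q i else 0)"
    by (intro sum.cong refl) (simp add: Q)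
  also have "\<dots> = (\<Sum>i\<in>I. (c i * poly p (c i)) *\<^sub>R Q i)"
    using I by (simp add: sum.delta')
  finally show ?case
    using pCons by (simp add: scaleR_left.add sum.distrib flip: one scaleR_sum_right)
qed simp

text \<open>The real counterpart of \<open>spectral_resolution\<close>, on any interval
  \<open>[a, b]\<close>, so that the interval can avoid 0, where \<open>ln\<close> is
  discontinuous.\<close>

definition resolution_on :: "real \<Rightarrow> real \<Rightarrow> (real \<Rightarrow> 'h::real_inner operator) \<Rightarrow> 'h operator \<Rightarrow> bool" where
  "resolution_on a b E H \<longleftrightarrow> a \<le> b \<and>
     (\<forall>t. sym_op (E t) \<and> E t o\<^sub>L E t = E t) \<and>
     (\<forall>s t x. s \<le> t \<longrightarrow> E s x \<bullet> x \<le> E t x \<bullet> x) \<and>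
     (\<forall>t x. ((\<lambda>s. E s x) \<longlongrightarrow> E t x) (at_right t)) \<and>
     (\<forall>t<a. E t = 0) \<and> (\<forall>t\<ge>b. E t = id_blinfun) \<and>
     (\<forall>x. H x \<bullet> x = (\<integral>t. t \<partial>interval_measure (\<lambda>t. E t x \<bullet> x)))"

lemma resolution_stieltjes:
  "resolution_on a b E H \<Longrightarrow> stieltjes a b (x \<bullet> x) (\<lambda>t. E t x \<bullet> x)"
  unfolding resolution_on_def stieltjes_def
  by (auto intro: tendsto_inner tendsto_const)

context
  fixes H :: "'h::{real_inner, banach} operator" and E :: "real \<Rightarrow> 'h operator" and a b :: real
  assumes H: "sym_op H" and E: "resolution_on a b E H"
begin

lemma resolution_le: "a \<le> b"
  using E unfolding resolution_on_def by (rule conjunct1)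

lemma resolution_sym: "sym_op (E t)"
  using E by (simp add: resolution_on_def)

lemma resolution_idem: "E t o\<^sub>L E t = E t"
  using E by (simp add: resolution_on_def)

lemma resolution_mono: "s \<le> t \<Longrightarrow> E s x \<bullet> x \<le> E t x \<bullet> x"
  using E by (simp add: resolution_on_def)

lemmas resolution_absorb =
  sym_idem_absorb[OF resolution_sym resolution_idem resolution_sym resolution_idem resolution_mono]

lemma resolution_step_sum:
  assumes n: "0 < n"
  defines "t \<equiv> mesh_point a b n"
  shows "poly_op p (\<Sum>i<n. t (Suc i) *\<^sub>R (E (t (Suc i)) - E (t i))) = (\<Sum>i<n. poly p (t (Suc i)) *\<^sub>R (E (t (Suc i)) - E (t i)))"
    and "(\<Sum>i<n. E (t (Suc i)) - E (t i)) = id_blinfun"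
proof -
  note ab = resolution_le
  have t: "t i \<le> t j" if "i \<le> j" for i j
    using incseqD[OF mesh_point_incseq[OF ab] that] by (simp add: t_def)
  have orth: "(E (t (Suc i)) - E (t i)) o\<^sub>L (E (t (Suc j)) - E (t j)) = 0" if "i < j" for i j
    using that by (simp add: blinfun_compose_diff resolution_absorb t)
  have orth': "(E (t (Suc j)) - E (t j)) o\<^sub>L (E (t (Suc i)) - E (t i)) = 0" if "i < j" for i j
    using that by (simp add: blinfun_compose_diff resolution_absorb t)
  have idem: "(E (t (Suc i)) - E (t i)) o\<^sub>L (E (t (Suc i)) - E (t i)) = E (t (Suc i)) - E (t i)" for i
    by (simp add: blinfun_compose_diff resolution_absorb t)
  show one: "(\<Sum>i<n. E (t (Suc i)) - E (t i)) = id_blinfun"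
    using E mesh_point_0[OF ab, of n] mesh_point_n[OF ab n]
    by (subst sum_lessThan_telescope) (simp add: t_def resolution_on_def)
  have "(E (t (Suc i)) - E (t i)) o\<^sub>L (E (t (Suc j)) - E (t j)) = (if i = j then E (t (Suc i)) - E (t i) else 0)" for i j
    using orth[of i j] orth'[of j i] idem[of i] by (cases i j rule: linorder_cases) auto
  then show "poly_op p (\<Sum>i<n. t (Suc i) *\<^sub>R (E (t (Suc i)) - E (t i))) = (\<Sum>i<n. poly p (t (Suc i)) *\<^sub>R (E (t (Suc i)) - E (t i)))"
    using poly_op_orthogonal_sum[of "{..<n}" "\<lambda>i. E (t (Suc i)) - E (t i)" p "\<lambda>i. t (Suc i)", OF finite_lessThan _ one]
    by blast
qed

lemma resolution_step_form:
  fixes f :: "real \<Rightarrow> real" and t :: "nat \<Rightarrow> real"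
  shows
  "(\<Sum>i<n. f (t (Suc i)) *\<^sub>R (E (t (Suc i)) - E (t i))) x \<bullet> x
     = (\<Sum>i<n. f (t (Suc i)) * (E (t (Suc i)) x \<bullet> x - E (t i) x \<bullet> x))"
  by (simp only: blinfun.sum_left blinfun.scaleR_left blinfun.diff_left inner_sum_left inner_diff_left inner_scaleR_left)

lemma sym_op_resolution_step:
  fixes f :: "real \<Rightarrow> real" and t :: "nat \<Rightarrow> real"
  shows "sym_op (\<Sum>i<n. f (t (Suc i)) *\<^sub>R (E (t (Suc i)) - E (t i)))"
  by (intro sym_op_sum sym_op_scaleR sym_op_diff resolution_sym)

end

context
  fixes H :: "'h::{real_inner, banach} operator" and E :: "real \<Rightarrow> 'h operator" and a b :: real
  assumes H: "sym_op H" and E: "resolution_on a b E H"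
begin

text \<open>A resolution only prescribes the integral of the identity function. Its step operators
  \<open>T n\<close> converge to \<open>H\<close> in norm, and \<open>p\<close> of a step operator
  is the step operator of \<open>p\<close>; the two limits of \<open>poly_op p (T n)\<close> give
  the integral of \<open>p\<close>.\<close>

lemma resolution_poly:
  "(\<integral>t. poly p t \<partial>interval_measure (\<lambda>t. E t x \<bullet> x)) = poly_op p H x \<bullet> x"
proof -
  note ab = resolution_le[OF H E]
  define T where "T n = (\<Sum>i<n. mesh_point a b n (Suc i) *\<^sub>R (E (mesh_point a b n (Suc i)) - E (mesh_point a b n i)))" for n
  define U where "U n = (\<Sum>i<n. poly p (mesh_point a b n (Suc i)) *\<^sub>R (E (mesh_point a b n (Suc i)) - E (mesh_point a b n i)))" for n
  have symT: "sym_op (T n)" for n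
    using sym_op_resolution_step[OF H E, where f = "\<lambda>t. t" and t = "mesh_point a b n" and n = n] by (simp add: T_def)
  have "T \<longlonglongrightarrow> H"
  proof (rule metric_LIMSEQ_I)
    fix e :: real assume e: "0 < e"
    have "continuous_on UNIV (\<lambda>u::real. u)" by (rule continuous_on_id)
    then obtain N where N: "\<And>n c F. N \<le> n \<Longrightarrow> stieltjes a b c F \<Longrightarrow>
        \<bar>(\<integral>u. u \<partial>interval_measure F) - (\<Sum>i<n. mesh_point a b n (Suc i) * (F (mesh_point a b n (Suc i)) - F (mesh_point a b n i)))\<bar> \<le> e / 2 * c"
      by (rule stieltjes_riemann[OF ab _ half_gt_zero[OF e]]) (rule that)
    have "norm (H - T n) \<le> e / 2" if "n \<ge> N" for n
    proof (rule sym_op_norm_le)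
      show "sym_op (H - T n)" by (intro sym_op_diff H symT)
      fix x
      have "H x \<bullet> x = (\<integral>u. u \<partial>interval_measure (\<lambda>t. E t x \<bullet> x))"
        using E by (simp add: resolution_on_def)
      then show "\<bar>(H - T n) x \<bullet> x\<bar> \<le> e / 2 * (x \<bullet> x)"
        using N[OF that resolution_stieltjes[OF E, of x]] resolution_step_form[OF H E, where f = "\<lambda>t. t" and t = "mesh_point a b n" and n = n and x = x]
        by (simp add: T_def blinfun.diff_left inner_diff_left)
    qed (use e in simp)
    then have "dist (T n) H < e" if "n \<ge> N" for n
      using e that by (force simp: dist_norm norm_minus_commute)
    then show "\<exists>N. \<forall>n\<ge>N. dist (T n) H < e" by blast
  qed
  then have 1: "(\<lambda>n. poly_op p (T n) x \<bullet> x) \<longlonglongrightarrow> poly_op p H x \<bullet> x"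
    by (intro tendsto_inner blinfun.tendsto tendsto_poly_op tendsto_const)
  have "(\<lambda>n. U n x \<bullet> x) \<longlonglongrightarrow> (\<integral>t. poly p t \<partial>interval_measure (\<lambda>t. E t x \<bullet> x))"
  proof (rule metric_LIMSEQ_I)
    fix e :: real assume e: "0 < e"
    define d where "d = e / (x \<bullet> x + 1)"
    have xx: "0 \<le> x \<bullet> x" by simp
    have d: "0 < d" "d * (x \<bullet> x) < e"
      using e xx by (simp_all add: d_def add_nonneg_pos pos_divide_less_eq distrib_left)
    have "continuous_on UNIV (poly p)" by (intro continuous_intros)
    then obtain N where N: "\<And>n c F. N \<le> n \<Longrightarrow> stieltjes a b c F \<Longrightarrow>
        \<bar>(\<integral>u. poly p u \<partial>interval_measure F) - (\<Sum>i<n. poly p (mesh_point a b n (Suc i)) * (F (mesh_point a b n (Suc i)) - F (mesh_point a b n i)))\<bar> \<le> d * c"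
      by (rule stieltjes_riemann[OF ab _ d(1)]) (rule that)
    have "dist (U n x \<bullet> x) (\<integral>t. poly p t \<partial>interval_measure (\<lambda>t. E t x \<bullet> x)) < e" if "n \<ge> N" for n
      using N[OF that resolution_stieltjes[OF E, of x]] resolution_step_form[OF H E, where f = "poly p" and t = "mesh_point a b n" and n = n and x = x] d(2)
      by (simp add: U_def dist_real_def abs_minus_commute)
    then show "\<exists>N. \<forall>n\<ge>N. dist (U n x \<bullet> x) (\<integral>t. poly p t \<partial>interval_measure (\<lambda>t. E t x \<bullet> x)) < e" by blast
  qed
  moreover have "\<forall>\<^sub>F n in sequentially. U n x \<bullet> x = poly_op p (T n) x \<bullet> x"
    using eventually_gt_at_top[of 0] unfolding T_def U_def
    by eventually_elim (simp add: resolution_step_sum(1)[OF H E])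
  ultimately have "(\<lambda>n. poly_op p (T n) x \<bullet> x) \<longlonglongrightarrow> (\<integral>t. poly p t \<partial>interval_measure (\<lambda>t. E t x \<bullet> x))"
    by (rule Lim_transform_eventually)
  then show ?thesis using 1 LIMSEQ_unique by blast
qed

end

lemma nonpos_if_le_scaled:
  fixes d K :: real
  assumes "\<And>e. 0 < e \<Longrightarrow> d \<le> e * K"
  shows "d \<le> 0"
proof (rule field_le_epsilon)
  fix r :: real assume r: "0 < r"
  have "r / (\<bar>K\<bar> + 1) * K \<le> r"
  proof -
    have "r * K \<le> r * (\<bar>K\<bar> + 1)" using r by (intro mult_left_mono) auto
    then show ?thesis by (simp add: pos_divide_le_eq add_nonneg_pos)
  qed
  then show "d \<le> 0 + r"
    using assms[of "r / (\<bar>K\<bar> + 1)"] r by (simp add: add_nonneg_pos)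
qed

section \<open>Uniqueness and existence of the spectral resolution\<close>

context
  fixes H :: "'h::{real_inner, banach} operator" and a b :: real
  assumes H: "between a b H"
begin

lemma resolution_cfc_form:
  assumes E: "resolution_on a b E H" and f: "f \<in> borel_measurable borel" "continuous_on {a..b} f"
  shows "(\<integral>t. f t \<partial>interval_measure (\<lambda>t. E t x \<bullet> x)) = cfc a b f H x \<bullet> x"
proof -
  let ?N = "interval_measure (\<lambda>t. E t x \<bullet> x)"
  have "\<bar>(\<integral>t. f t \<partial>?N) - cfc a b f H x \<bullet> x\<bar> \<le> e * (2 * (x \<bullet> x))" if e: "0 < e" for e
  proof -
    obtain p where p: "\<And>t. a \<le> t \<Longrightarrow> t \<le> b \<Longrightarrow> \<bar>f t - poly p t\<bar> \<le> e"
      using weierstrass_poly[OF f(2) e] by blast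
    have "continuous_on UNIV (poly p)" by (intro continuous_intros)
    then have pm: "poly p \<in> borel_measurable borel" "continuous_on {a..b} (poly p)"
      by (auto intro: borel_measurable_continuous_onI continuous_on_subset)
    have "\<bar>(\<integral>t. f t \<partial>?N) - (\<integral>t. poly p t \<partial>?N)\<bar> \<le> e * (x \<bullet> x)"
      by (rule stieltjes_integral_close[OF resolution_stieltjes[OF E] f pm p])
    moreover have "(\<integral>t. poly p t \<partial>?N) = poly_op p H x \<bullet> x"
      by (rule resolution_poly[OF between_sym[OF H] E])
    moreover have "\<bar>(cfc a b f H - poly_op p H) x \<bullet> x\<bar> \<le> e * (x \<bullet> x)"
      by (rule order_trans[OF form_bound mult_right_mono[OF cfc_approx[OF H f(2) p]]]) auto
    ultimately show ?thesis
      by (simp add: blinfun.diff_left inner_diff_left)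
  qed
  from nonpos_if_le_scaled[OF this] show ?thesis by simp
qed

text \<open>The indicator of \<open>{..t}\<close> is the dominated limit of the ramps, and the
  integral of a ramp is given by \<open>cfc\<close>, where \<open>E\<close> no longer
  occurs.\<close>

lemma resolution_unique:
  assumes E: "resolution_on a b E H"
  shows "E t = spec_proj a b H t"
proof (rule sym_op_eqI)
  show "sym_op (E t)" "sym_op (spec_proj a b H t)"
    by (rule resolution_sym[OF between_sym[OF H] E], rule sym_op_spec_proj[OF H])
  fix x
  let ?F = "\<lambda>t. E t x \<bullet> x"
  have F: "stieltjes a b (x \<bullet> x) ?F" by (rule resolution_stieltjes[OF E])
  interpret finite_measure "interval_measure ?F" by (rule stieltjes_finite[OF F])
  have rm: "ramp n t \<in> borel_measurable borel" for n
    by (intro borel_measurable_continuous_onI continuous_on_ramp)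
  have lim: "(\<lambda>n. ramp n t u) \<longlonglongrightarrow> indicator {..t} u" for u
  proof (cases "u \<le> t")
    case True
    then show ?thesis by (simp add: ramp_eq_1)
  next
    case False
    obtain m :: nat where "2 / (u - t) \<le> real m" using real_arch_simple by blast
    then have "ramp n t u = 0" if "n \<ge> m" for n
      using that False by (intro ramp_eq_0) (auto simp: not_le intro: order_trans)
    then have "\<forall>\<^sub>F n in sequentially. ramp n t u = indicator {..t} u"
      using False by (auto simp: eventually_sequentially)
    then show ?thesis by (rule tendsto_eventually)
  qed
  have "(\<lambda>n. \<integral>u. ramp n t u \<partial>interval_measure ?F) \<longlonglongrightarrow> (\<integral>u. indicator {..t} u \<partial>interval_measure ?F)"
  proof (rule integral_dominated_convergence[where w = "\<lambda>_. 1"])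
    show "AE u in interval_measure ?F. (\<lambda>n. ramp n t u) \<longlonglongrightarrow> indicator {..t} u" using lim by simp
    show "AE u in interval_measure ?F. norm (ramp n t u) \<le> 1" for n
      using ramp_bounds[of n t] by simp
  qed (use rm in auto)
  moreover have "(\<integral>u. indicator {..t} u \<partial>interval_measure ?F) = E t x \<bullet> x"
    by (simp add: stieltjes_Iic[OF F])
  moreover have "(\<integral>u. ramp n t u \<partial>interval_measure ?F) = cfc a b (ramp n t) H x \<bullet> x" for n
    by (rule resolution_cfc_form[OF E rm continuous_on_ramp])
  ultimately show "E t x \<bullet> x = spec_proj a b H t x \<bullet> x"
    using tendsto_spec_proj_form[OF H, of t x] LIMSEQ_unique by simp
qed

text \<open>For a mesh finer than \<open>e\<close>, \<open>spec_proj_sandwich\<close> places the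
  Riemann sum of the identity function between \<open>H x \<bullet> x\<close> and
  \<open>H x \<bullet> x + e * (x \<bullet> x)\<close>.\<close>

lemma resolution_spec_proj: "resolution_on a b (spec_proj a b H) H"
  unfolding resolution_on_def
proof (intro conjI allI impI)
  let ?P = "spec_proj a b H"
  show ab: "a \<le> b" using H by (simp add: between_def)
  show "sym_op (?P t)" for t by (rule sym_op_spec_proj[OF H])
  show "?P t o\<^sub>L ?P t = ?P t" for t by (rule spec_proj_idem[OF H])
  show "?P s x \<bullet> x \<le> ?P t x \<bullet> x" if "s \<le> t" for s t x by (rule spec_proj_mono[OF H that])
  show "((\<lambda>s. ?P s x) \<longlongrightarrow> ?P t x) (at_right t)" for t x by (rule spec_proj_right_continuous[OF H])
  show "?P t = 0" if "t < a" for t by (rule spec_proj_eq_0[OF H that])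
  show "?P t = id_blinfun" if "b \<le> t" for t by (rule spec_proj_eq_id[OF H that])
  fix x
  have F: "stieltjes a b (x \<bullet> x) (\<lambda>t. ?P t x \<bullet> x)"
    unfolding stieltjes_def
    using ab spec_proj_mono[OF H, of _ _ x] spec_proj_eq_0[OF H] spec_proj_eq_id[OF H]
    by (auto intro!: tendsto_inner tendsto_const spec_proj_right_continuous[OF H])
  let ?N = "interval_measure (\<lambda>t. ?P t x \<bullet> x)"
  have "\<bar>H x \<bullet> x - (\<integral>t. t \<partial>?N)\<bar> \<le> e * (2 * (x \<bullet> x))" if e: "0 < e" for e
  proof -
    have "continuous_on UNIV (\<lambda>u::real. u)" by (rule continuous_on_id)
    then obtain N where N: "0 < N" "\<And>n c F. N \<le> n \<Longrightarrow> stieltjes a b c F \<Longrightarrow>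
        \<bar>(\<integral>u. u \<partial>interval_measure F) - (\<Sum>i<n. mesh_point a b n (Suc i) * (F (mesh_point a b n (Suc i)) - F (mesh_point a b n i)))\<bar> \<le> e * c"
      by (rule stieltjes_riemann[OF ab _ e]) (rule that)
    obtain M where M: "0 < M" "\<And>n. n \<ge> M \<Longrightarrow> (b - a + 1) / real n < e"
      using mesh_size_small[OF ab e] by blast
    define n where "n = max N M"
    have n: "N \<le> n" "0 < n" "(b - a + 1) / real n < e" using N(1) M by (auto simp: n_def)
    define t where "t = mesh_point a b n"
    define D where "D i = ?P (t (Suc i)) - ?P (t i)" for i
    have tle: "t i \<le> t (Suc i)" for i
      using incseqD[OF mesh_point_incseq[OF ab], of i "Suc i" n] by (simp add: t_def)
    have step: "t (Suc i) \<le> t i + e" for i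
      using n(3) by (simp add: t_def mesh_point_step[OF ab])
    have Dpos: "0 \<le> D i x \<bullet> x" for i
      using spec_proj_mono[OF H tle, of i x] by (simp add: D_def blinfun.diff_left inner_diff_left)
    have one: "(\<Sum>i<n. D i) = id_blinfun"
      unfolding D_def
      using spec_proj_eq_0[OF H mesh_point_0[OF ab, of n]] spec_proj_eq_id[OF H, of b] mesh_point_n[OF ab n(2)]
      by (subst sum_lessThan_telescope) (simp add: t_def)
    have xs: "(\<Sum>i<n. D i x) = x"
      using arg_cong[OF one, of "\<lambda>T. T x"] by (simp add: blinfun.sum_left)
    have sx: "(\<Sum>i<n. D i x \<bullet> x) = x \<bullet> x"
      using arg_cong[OF xs, of "\<lambda>z. z \<bullet> x"] by (simp add: inner_sum_left)
    have Hx: "H x \<bullet> x = (\<Sum>i<n. H (D i x) \<bullet> x)"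
      by (subst (1) xs[symmetric]) (simp only: blinfun.sum_right inner_sum_left)
    have lo: "t i * (D i x \<bullet> x) \<le> H (D i x) \<bullet> x" and up: "H (D i x) \<bullet> x \<le> t (Suc i) * (D i x \<bullet> x)" for i
      using spec_proj_sandwich[OF H tle[of i], of x] unfolding D_def by auto
    have "(\<Sum>i<n. t (Suc i) * (D i x \<bullet> x)) \<le> (\<Sum>i<n. H (D i x) \<bullet> x + e * (D i x \<bullet> x))"
    proof (rule sum_mono)
      fix i
      have "t (Suc i) * (D i x \<bullet> x) \<le> (t i + e) * (D i x \<bullet> x)"
        by (rule mult_right_mono[OF step Dpos])
      then show "t (Suc i) * (D i x \<bullet> x) \<le> H (D i x) \<bullet> x + e * (D i x \<bullet> x)"
        using lo[of i] by (simp add: distrib_right)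
    qed
    then have 1: "(\<Sum>i<n. t (Suc i) * (D i x \<bullet> x)) \<le> H x \<bullet> x + e * (x \<bullet> x)"
      unfolding Hx sx[symmetric] by (simp only: sum.distrib sum_distrib_left)
    have 2: "H x \<bullet> x \<le> (\<Sum>i<n. t (Suc i) * (D i x \<bullet> x))"
      unfolding Hx by (rule sum_mono[OF up])
    have "\<bar>(\<integral>u. u \<partial>?N) - (\<Sum>i<n. t (Suc i) * (D i x \<bullet> x))\<bar> \<le> e * (x \<bullet> x)"
      using N(2)[OF n(1) F] by (simp only: t_def D_def blinfun.diff_left inner_diff_left)
    then show ?thesis using 1 2 by (simp add: abs_le_iff)
  qed
  from nonpos_if_le_scaled[OF this] show "H x \<bullet> x = (\<integral>t. t \<partial>?N)" by simp
qed

end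

section \<open>Operators on a complex Hilbert space\<close>

instance complex_hilbert \<subseteq> banach ..

lemma Re_cinner: "Re (cinner x y) = x \<bullet> y"
  by (simp add: inner_eq_Re_cinner)

lemma Im_cinner: "Im (cinner x y) = ((- \<i>) *\<^sub>C x) \<bullet> y"
  by (simp add: inner_eq_Re_cinner cinner_scaleC_left)

lemma inner_scaleC_unit: "cmod c = 1 \<Longrightarrow> (c *\<^sub>C x) \<bullet> (c *\<^sub>C y) = x \<bullet> (y :: 'h::complex_inner)"
proof -
  assume c: "cmod c = 1"
  have "cinner x (c *\<^sub>C y) = cnj (cinner (c *\<^sub>C y) x)" by (rule cinner_commute)
  also have "\<dots> = cnj c * cnj (cinner y x)" by (simp add: cinner_scaleC_left)
  also have "cnj (cinner y x) = cinner x y" by (rule cinner_commute[symmetric])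
  finally have "cinner (c *\<^sub>C x) (c *\<^sub>C y) = (c * cnj c) * cinner x y"
    by (simp add: cinner_scaleC_left)
  also have "c * cnj c = 1" using c complex_norm_square[of c] by simp
  finally show ?thesis by (simp add: inner_eq_Re_cinner)
qed

lemma bounded_operatorsD: "T \<in> bounded_operators \<Longrightarrow> T (c *\<^sub>C x) = c *\<^sub>C T x"
  by (simp add: bounded_operators_def clinear_on_def)

lemma scaleC_right_commute: "r *\<^sub>R c *\<^sub>C x = c *\<^sub>C r *\<^sub>R (x :: 'h::complex_vector)"
  by (simp add: scaleR_scaleC scaleC_scaleC mult.commute)

lemma op_algebra_bounded_operators: "op_algebra (bounded_operators :: 'h::complex_hilbert operator set)"
  unfolding op_algebra_def
proof (intro conjI allI ballI impI)
  fix X :: "nat \<Rightarrow> 'h operator" and L :: "'h operator"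
  assume "(\<forall>n. X n \<in> bounded_operators) \<and> (\<forall>x. (\<lambda>n. X n x) \<longlonglongrightarrow> L x)"
  then have X: "X n \<in> bounded_operators" "(\<lambda>n. X n x) \<longlonglongrightarrow> L x" for n x
    by simp_all
  have "L (c *\<^sub>C x) = c *\<^sub>C L x" for c x
  proof (rule LIMSEQ_unique[OF X(2)])
    show "(\<lambda>n. X n (c *\<^sub>C x)) \<longlonglongrightarrow> c *\<^sub>C L x"
      unfolding bounded_operatorsD[OF X(1)]
      by (rule bounded_linear.tendsto[OF bounded_linear_scaleC X(2)])
  qed
  then show "L \<in> bounded_operators"
    by (simp add: bounded_operators_def clinear_on_def blinfun.add_right)
qed (auto simp: bounded_operators_def clinear_on_def blinfun.bilinear_simps scaleC_add_right scaleC_right_commute)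

text \<open>\<open>strong_operator_topology\<close> is pulled back from a product topology, where
  convergence is componentwise. This extracts sequential closure from the closedness of a von
  Neumann algebra.\<close>

lemma limitin_strong_operator_topology:
  fixes X :: "'i \<Rightarrow> 'a::real_normed_vector \<Rightarrow>\<^sub>L 'b::real_normed_vector" and L :: "'a \<Rightarrow>\<^sub>L 'b"
  assumes "\<And>x. ((\<lambda>n. X n x) \<longlongrightarrow> L x) F"
  shows "limitin strong_operator_topology X L F"
proof -
  have "limitin (product_topology (\<lambda>_. euclidean) UNIV) (\<lambda>n. blinfun_apply (X n)) (blinfun_apply L) F"
    using assms by (simp add: limitin_componentwise)
  then have lim: "limitin euclidean (\<lambda>n. blinfun_apply (X n)) (blinfun_apply L) F"
    by (simp only: euclidean_product_topology)
  show ?thesis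
    unfolding limitin_def strong_operator_topology_topspace
  proof (intro conjI allI impI UNIV_I)
    fix U assume "openin strong_operator_topology U \<and> L \<in> U"
    then obtain V where V: "openin euclidean V" "U = blinfun_apply -` V" "L \<in> U"
      unfolding strong_operator_topology_def by (auto simp: openin_pullback_topology)
    then have "\<forall>\<^sub>F n in F. blinfun_apply (X n) \<in> V"
      by (intro limitinD[OF lim]) auto
    then show "\<forall>\<^sub>F n in F. X n \<in> U" by (simp add: V)
  qed
qed

lemma von_neumann_op_algebra:
  assumes "von_neumann_algebra R"
  shows "op_algebra R" "R \<subseteq> bounded_operators"
proof -
  have sc: "c *\<^sub>R A \<in> R" if "A \<in> R" for c A
    using assms that unfolding von_neumann_algebra_def scaleR_scaleC by blast
  have lim: "L \<in> R" if "\<And>n::nat. X n \<in> R" "\<And>x. (\<lambda>n. X n x) \<longlonglongrightarrow> L x" for X and L :: "'a operator"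
  proof (rule limitin_closedin)
    show "limitin strong_operator_topology X L sequentially"
      by (rule limitin_strong_operator_topology) (rule that)
    show "closedin strong_operator_topology R" using assms by (simp add: von_neumann_algebra_def)
  qed (use that in auto)
  show "op_algebra R"
    unfolding op_algebra_def
    using assms sc lim by (auto simp: von_neumann_algebra_def)
  show "R \<subseteq> bounded_operators" using assms by (simp add: von_neumann_algebra_def)
qed

section \<open>Adjoint, symmetry and positivity through the real inner product\<close>

lemma adj_eqI:
  fixes A B :: "'h::complex_hilbert operator"
  assumes "\<And>x y. cinner (A x) y = cinner x (B y)"
  shows "adj A = B"
  unfolding adj_def
proof (rule the_equality)
  show "\<forall>x y. cinner (A x) y = cinner x (B y)" using assms by blast
  fix C :: "'h operator" assume C: "\<forall>x y. cinner (A x) y = cinner x (C y)"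
  show "C = B"
  proof (rule blinfun_eqI)
    fix y
    have "cinner x (C y) = cinner x (B y)" for x using C assms by metis
    then have "x \<bullet> C y = x \<bullet> B y" for x by (simp add: inner_eq_Re_cinner)
    then show "C y = B y" by (metis vector_eq_ldot)
  qed
qed

text \<open>Complex linearity supplies the imaginary part: it is the real part at
  \<open>(- \<i>) *\<^sub>C x\<close>.\<close>

lemma cinner_eq_if_inner:
  assumes "A \<in> bounded_operators" "\<And>x y. A x \<bullet> y = x \<bullet> B y"
  shows "cinner (A x) y = cinner x (B y)"
proof (rule complex_eqI)
  show "Re (cinner (A x) y) = Re (cinner x (B y))" by (simp add: Re_cinner assms(2))
  have "((- \<i>) *\<^sub>C A x) \<bullet> y = A ((- \<i>) *\<^sub>C x) \<bullet> y" by (simp only: bounded_operatorsD[OF assms(1)])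
  then show "Im (cinner (A x) y) = Im (cinner x (B y))" by (simp only: Im_cinner assms(2))
qed

lemma adj_sym_op: "A \<in> bounded_operators \<Longrightarrow> sym_op A \<Longrightarrow> adj A = A"
  by (intro adj_eqI cinner_eq_if_inner) (simp_all add: sym_opD)

lemma adj_compose_sym_op:
  assumes "A \<in> bounded_operators" "B \<in> bounded_operators" "sym_op A" "sym_op B"
  shows "adj (A o\<^sub>L B) = B o\<^sub>L A"
  using op_algebraD(4)[OF op_algebra_bounded_operators assms(1,2)]
  by (intro adj_eqI cinner_eq_if_inner) (simp_all add: sym_opD[OF assms(3)] sym_opD[OF assms(4)])

lemma self_adjoint_sym_op: "A \<in> bounded_operators \<Longrightarrow> sym_op A \<Longrightarrow> self_adjoint A"
  by (simp add: self_adjoint_def adj_sym_op)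

lemma cinner_self_sym_op:
  assumes "A \<in> bounded_operators" "sym_op A"
  shows "cinner (A x) x = complex_of_real (A x \<bullet> x)"
proof -
  have "cinner (A x) x = cnj (cinner (A x) x)"
    by (rule trans[OF cinner_eq_if_inner[OF assms(1) sym_opD[OF assms(2)]] cinner_commute])
  then show ?thesis
    by (simp add: complex_eq_iff Re_cinner)
qed

text \<open>Write \<open>j\<close> for multiplication by \<open>- \<i>\<close>. A real form means
  \<open>A (j x) \<bullet> x = 0\<close>, so \<open>A (j x) \<bullet> y\<close> is antisymmetric in
  \<open>x\<close> and \<open>y\<close>. Putting \<open>j y\<close> for \<open>y\<close> and using
  that \<open>j\<close> is isometric with square \<open>-1\<close> gives the symmetry of
  \<open>A\<close>.\<close>

lemma sym_op_if_real_form: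
  assumes A: "A \<in> bounded_operators" and real: "\<And>x. cinner (A x) x \<in> \<real>"
  shows "sym_op A"
proof -
  let ?j = "\<lambda>x. (- \<i>) *\<^sub>C x"
  have zero: "A (?j x) \<bullet> x = 0" for x
    using real[of x] by (simp add: Im_cinner bounded_operatorsD[OF A] complex_is_Real_iff)
  have anti: "A (?j x) \<bullet> y = - (A (?j y) \<bullet> x)" for x y
    using zero[of "x + y"] zero[of x] zero[of y]
    by (simp add: scaleC_add_right blinfun.add_right inner_add)
  have "A x \<bullet> y = A y \<bullet> x" for x y
  proof -
    have "A x \<bullet> y = ?j (A x) \<bullet> ?j y" by (simp add: inner_scaleC_unit)
    also have "\<dots> = A (?j x) \<bullet> ?j y" by (simp add: bounded_operatorsD[OF A])
    also have "\<dots> = - (A (?j (?j y)) \<bullet> x)" by (rule anti)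
    also have "?j (?j y) = - y" using scaleR_scaleC[of "-1" y] by (simp add: scaleC_scaleC)
    finally show ?thesis by (simp add: blinfun.minus_right)
  qed
  then show ?thesis by (simp add: sym_op_def inner_commute)
qed

lemma positive_op_iff:
  "positive_op A \<longleftrightarrow> A \<in> bounded_operators \<and> sym_op A \<and> (\<forall>x. 0 \<le> A x \<bullet> x)"
proof safe
  assume "positive_op A"
  then have *: "A \<in> bounded_operators" "\<And>x. cinner (A x) x \<in> \<real>\<^sub>\<ge>\<^sub>0" by (auto simp: positive_op_def)
  show "A \<in> bounded_operators" by (rule *)
  show "sym_op A" using * by (intro sym_op_if_real_form) auto
  show "0 \<le> A x \<bullet> x" for x using *(2)[of x] by (simp add: complex_nonneg_Reals_iff Re_cinner)
next
  assume "A \<in> bounded_operators" "sym_op A" "\<forall>x. 0 \<le> A x \<bullet> x"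
  then show "positive_op A" by (simp add: positive_op_def cinner_self_sym_op)
qed

lemma positive_op_between: "positive_op A \<Longrightarrow> between 0 (norm A) A"
  using between_norm[of A] by (auto simp: positive_op_iff between_def)

lemma le_op_iff:
  assumes "A \<in> bounded_operators" "B \<in> bounded_operators" "sym_op A" "sym_op B"
  shows "le_op A B \<longleftrightarrow> (\<forall>x. A x \<bullet> x \<le> B x \<bullet> x)"
  using assms op_algebra_diff[OF op_algebra_bounded_operators assms(2,1)]
  by (simp add: le_op_def positive_op_iff sym_op_diff blinfun.diff_left inner_diff_left)

lemma spectral_resolution_imp_resolution_on:
  assumes E: "spectral_resolution E H" and H: "sym_op H"
  shows "resolution_on (- norm H) (norm H) E H"
proof -
  let ?m = "\<lambda>t. min t (- norm H - 1)"
  have E0: "E t = 0" if "t < - norm H" for t using E that by (simp add: spectral_resolution_def)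
  have le: "le_op (E s) (E t)" if "s \<le> t" for s t using E that by (simp add: spectral_resolution_def)
  \<comment> \<open>\<open>E\<close> vanishes far to the left, so \<open>E t = E t - E s\<close> is positive, hence symmetric.\<close>
  have sym: "sym_op (E t)" for t
    using le[of "?m t" t] E0[of "?m t"] by (simp add: le_op_def positive_op_iff)
  have mono: "E s x \<bullet> x \<le> E t x \<bullet> x" if "s \<le> t" for s t x
    using le[OF that] by (simp add: le_op_def positive_op_iff blinfun.diff_left inner_diff_left)
  have int: "H x \<bullet> x = (\<integral>t. t \<partial>interval_measure (\<lambda>t. E t x \<bullet> x))" for x
  proof -
    have "cinner (H x) x = complex_of_real (\<integral>t. t \<partial>interval_measure (\<lambda>t. E t x \<bullet> x))"
      using E by (simp add: spectral_resolution_def spectral_measure_def Re_cinner)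
    then have "Re (cinner (H x) x) = (\<integral>t. t \<partial>interval_measure (\<lambda>t. E t x \<bullet> x))" by simp
    then show ?thesis by (simp only: Re_cinner)
  qed
  show ?thesis
    unfolding resolution_on_def
  proof (intro conjI allI impI sym mono int E0)
    show "- norm H \<le> norm H" using norm_ge_zero[of H] by linarith
  qed (use E in \<open>auto simp: spectral_resolution_def projection_def\<close>)
qed

section \<open>The spectral family and \<open>op_fun\<close> of a symmetric operator\<close>

context
  fixes H :: "'h::complex_hilbert operator" and a b :: real
  assumes H: "between a b H" and Hc: "H \<in> bounded_operators"
    and ab: "- norm H \<le> a" "b \<le> norm H"
begin

lemma spectral_resolution_spec_proj: "spectral_resolution (spec_proj a b H) H"
proof -
  let ?P = "spec_proj a b H"
  note R = resolution_spec_proj[OF H]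
  have bnd: "?P t \<in> bounded_operators" for t
    by (rule spec_proj_in[OF H op_algebra_bounded_operators Hc])
  have sym: "sym_op (?P t)" for t by (rule sym_op_spec_proj[OF H])
  show ?thesis
    unfolding spectral_resolution_def
  proof (intro conjI allI impI)
    show "projection (?P t)" for t
      by (simp add: projection_def self_adjoint_sym_op[OF bnd sym] spec_proj_idem[OF H])
    show "le_op (?P s) (?P t)" if "s \<le> t" for s t
      using spec_proj_mono[OF H that] by (simp add: le_op_iff bnd sym)
    show "((\<lambda>s. ?P s x) \<longlongrightarrow> ?P t x) (at_right t)" for t x
      by (rule spec_proj_right_continuous[OF H])
    show "?P t = 0" if "t < - norm H" for t using that ab by (intro spec_proj_eq_0[OF H]) simp
    show "?P t = id_blinfun" if "norm H \<le> t" for t using that ab by (intro spec_proj_eq_id[OF H]) simp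
    show "cinner (H x) x = complex_of_real (\<integral>t. t \<partial>spectral_measure ?P x)" for x
      using R by (simp add: cinner_self_sym_op[OF Hc between_sym[OF H]] spectral_measure_def Re_cinner resolution_on_def)
  qed
qed

text \<open>Uniqueness on the widest interval \<open>[- norm H, norm H]\<close> identifies the
  chosen family and \<open>spec_proj a b H\<close> alike, so the latter does not depend on the
  interval.\<close>

lemma spectral_family_eq: "spectral_family H = spec_proj a b H"
proof -
  have sym: "sym_op H" by (rule between_sym[OF H])
  have u: "E = spec_proj (- norm H) (norm H) H" if "spectral_resolution E H" for E
    using resolution_unique[OF between_norm[OF sym] spectral_resolution_imp_resolution_on[OF that sym]] by blast
  have "spectral_resolution (spectral_family H) H"
    unfolding spectral_family_def by (rule someI[of _ "spec_proj a b H"]) (rule spectral_resolution_spec_proj)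
  then show ?thesis using u u[OF spectral_resolution_spec_proj] by simp
qed

text \<open>Continuity is required on \<open>{a..b}\<close> only, which admits \<open>ln\<close>
  when \<open>a\<close> is positive.\<close>

lemma op_fun_eq_cfc:
  assumes f: "f \<in> borel_measurable borel" "continuous_on {a..b} f"
  shows "op_fun f H = cfc a b f H"
proof -
  have int: "(\<integral>t. f t \<partial>spectral_measure (spectral_family H) x) = cfc a b f H x \<bullet> x" for x
    using resolution_cfc_form[OF H resolution_spec_proj[OF H] f]
    by (simp add: spectral_family_eq spectral_measure_def Re_cinner)
  have c: "cfc a b f H \<in> bounded_operators" "sym_op (cfc a b f H)"
    by (rule op_algebra_cfc[OF op_algebra_bounded_operators Hc H f(2)], rule sym_op_cfc[OF H f(2)])
  show ?thesis
    unfolding op_fun_def int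
  proof (rule the_equality)
    show "cfc a b f H \<in> bounded_operators \<and> (\<forall>x. cinner (cfc a b f H x) x = complex_of_real (cfc a b f H x \<bullet> x))"
      using c by (simp add: cinner_self_sym_op)
    fix T :: "'h operator"
    assume T: "T \<in> bounded_operators \<and> (\<forall>x. cinner (T x) x = complex_of_real (cfc a b f H x \<bullet> x))"
    then have "sym_op T" by (intro sym_op_if_real_form) auto
    moreover have "T x \<bullet> x = cfc a b f H x \<bullet> x" for x
      using T Re_cinner[of "T x" x] by simp
    ultimately show "T = cfc a b f H" using c by (intro sym_op_eqI)
  qed
qed

end

text \<open>Approximate \<open>t\<close> on \<open>[0, M]\<close> by \<open>q(t\<^sup>2)\<close>: both operators are then close to \<open>q(A\<^sup>2)\<close>.\<close>

lemma between_square_root_unique: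
  fixes A B :: "'h::{real_inner, banach} operator"
  assumes A: "between 0 M A" and B: "between 0 M B" and eq: "A o\<^sub>L A = B o\<^sub>L B"
  shows "A = B"
proof -
  have "norm (A - B) \<le> e * 2" if e: "0 < e" for e
  proof -
    have "continuous_on {0..M\<^sup>2} sqrt" by (intro continuous_intros)
    then obtain q where q: "\<And>s. 0 \<le> s \<Longrightarrow> s \<le> M\<^sup>2 \<Longrightarrow> \<bar>sqrt s - poly q s\<bar> \<le> e"
      using weierstrass_poly e by blast
    define p where "p = pcompose q [:0, 0, 1:]"
    have p: "\<bar>t - poly p t\<bar> \<le> e" if "0 \<le> t" "t \<le> M" for t
    proof -
      have "\<bar>sqrt (t\<^sup>2) - poly q (t\<^sup>2)\<bar> \<le> e" using that by (intro q power_mono) auto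
      then show ?thesis using that by (simp add: p_def poly_pcompose power2_eq_square)
    qed
    have close: "norm (T - poly_op q (T o\<^sub>L T)) \<le> e" if T: "between 0 M T" for T :: "'h operator"
    proof -
      have "cfc 0 M (\<lambda>t. t) T = T"
        using cfc_poly[OF T, of "[:0, 1:]"] cfc_cong[OF T, of "poly [:0, 1:]" "\<lambda>t. t"] by simp
      moreover have "norm (cfc 0 M (\<lambda>t. t) T - poly_op p T) \<le> e"
        by (rule cfc_approx[OF T continuous_on_id p])
      ultimately show ?thesis by (simp add: p_def poly_op_pcompose)
    qed
    show ?thesis
      using close[OF A] close[OF B] norm_triangle_ineq4[of "A - poly_op q (A o\<^sub>L A)" "B - poly_op q (A o\<^sub>L A)"]
      by (simp add: eq)
  qed
  from nonpos_if_le_scaled[OF this] show ?thesis by simp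
qed

lemma abs_op_positive:
  assumes A: "positive_op A"
  shows "abs_op A = A"
proof -
  have *: "A \<in> bounded_operators" "sym_op A" using A by (auto simp: positive_op_iff)
  have "B = A" if "positive_op B \<and> B o\<^sub>L B = A o\<^sub>L A" for B
  proof (rule between_square_root_unique)
    show "between 0 (max (norm A) (norm B)) A" "between 0 (max (norm A) (norm B)) B"
      by (rule between_mono[OF positive_op_between]; use that A in simp)+
  qed (use that in simp)
  then show ?thesis
    unfolding abs_op_def sqrt_op_def adj_sym_op[OF *] using A by (intro the_equality) auto
qed

section \<open>Inverses of positive operators\<close>

lemma inv_op_eqI:
  assumes "A o\<^sub>L B = id_blinfun" "B o\<^sub>L A = id_blinfun"
  shows "regular A" "inv_op A = B"
proof -
  show "regular A" using assms unfolding regular_def by blast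
  show "inv_op A = B"
    unfolding inv_op_def
  proof (rule the_equality)
    fix C assume "A o\<^sub>L C = id_blinfun \<and> C o\<^sub>L A = id_blinfun"
    then show "C = B"
      using blinfun_compose_assoc[of C A B] assms by simp
  qed (use assms in simp)
qed

context
  fixes A :: "'h::{real_inner, banach} operator" and a b :: real
  assumes A: "between a b A"
begin

lemma cfc_id: "cfc a b (\<lambda>s. s) A = A"
  using cfc_poly[OF A, of "[:0, 1:]"] cfc_cong[OF A, of "poly [:0, 1:]" "\<lambda>t. t"] by simp

lemma cfc_resolvent:
  assumes t: "0 < a + t"
  defines "G \<equiv> cfc a b (\<lambda>s. 1 / (s + t)) A"
  shows "(A + t *\<^sub>R id_blinfun) o\<^sub>L G = id_blinfun" "G o\<^sub>L (A + t *\<^sub>R id_blinfun) = id_blinfun"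
proof -
  have c1: "continuous_on {a..b} (\<lambda>s. s + t)" by (intro continuous_intros)
  have c2: "continuous_on {a..b} (\<lambda>s. 1 / (s + t))"
    using t by (intro continuous_intros) auto
  have At: "cfc a b (\<lambda>s. s + t) A = A + t *\<^sub>R id_blinfun"
    using cfc_add[OF A continuous_on_id continuous_on_const, of t] by (simp add: cfc_id cfc_const[OF A])
  have one: "cfc a b (\<lambda>s. 1) A = id_blinfun" by (simp add: cfc_const[OF A])
  have "cfc a b (\<lambda>s. (s + t) * (1 / (s + t))) A = cfc a b (\<lambda>s. 1) A"
    using t by (intro cfc_cong[OF A]) auto
  then show "(A + t *\<^sub>R id_blinfun) o\<^sub>L G = id_blinfun"
    using cfc_mult[OF A c1 c2] by (simp add: At one G_def)
  have "cfc a b (\<lambda>s. 1 / (s + t) * (s + t)) A = cfc a b (\<lambda>s. 1) A"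
    using t by (intro cfc_cong[OF A]) auto
  then show "G o\<^sub>L (A + t *\<^sub>R id_blinfun) = id_blinfun"
    using cfc_mult[OF A c2 c1] by (simp add: At one G_def)
qed

text \<open>The composition rule for inversion: induction settles polynomials in \<open>I\<close>,
  approximation the rest. It gives the logarithm of an inverse.\<close>

lemma cfc_inverse_compose:
  assumes pos: "0 < a" and f: "continuous_on {1 / b..1 / a} f"
  defines "I \<equiv> cfc a b (\<lambda>s. 1 / s) A"
  shows "between (1 / b) (1 / a) I" "cfc (1 / b) (1 / a) f I = cfc a b (\<lambda>s. f (1 / s)) A"
proof -
  have ab: "a \<le> b" using A by (simp add: between_def)
  have inv: "1 / s \<in> {1 / b..1 / a}" if "s \<in> {a..b}" for s
    using that pos by (auto simp: field_simps)
  have ci: "continuous_on {a..b} (\<lambda>s. 1 / s)"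
    using pos by (intro continuous_intros) auto
  have comp: "continuous_on {a..b} (\<lambda>s. h (1 / s))" if "continuous_on {1 / b..1 / a} h" for h :: "real \<Rightarrow> real"
    by (rule continuous_on_compose2[OF that ci]) (use inv in blast)
  have "cfc a b (\<lambda>s. 1 / b) A x \<bullet> x \<le> I x \<bullet> x" "I x \<bullet> x \<le> cfc a b (\<lambda>s. 1 / a) A x \<bullet> x" for x
    unfolding I_def by (rule cfc_mono[OF A _ ci], use inv in auto)
      (rule cfc_mono[OF A ci], use inv in auto)
  moreover have "sym_op I" unfolding I_def by (rule sym_op_cfc[OF A ci])
  ultimately show btw: "between (1 / b) (1 / a) I"
    using ab pos by (simp add: between_def cfc_const[OF A] blinfun.scaleR_left frac_le)
  have poly: "poly_op p I = cfc a b (\<lambda>s. poly p (1 / s)) A" for p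
  proof (induction p)
    case 0
    then show ?case by (simp add: cfc_const[OF A])
  next
    case (pCons c p)
    have cp: "continuous_on {a..b} (\<lambda>s. poly p (1 / s))" by (intro comp continuous_intros)
    have "cfc a b (\<lambda>s. c + 1 / s * poly p (1 / s)) A = c *\<^sub>R id_blinfun + (I o\<^sub>L cfc a b (\<lambda>s. poly p (1 / s)) A)"
      by (simp only: cfc_add[OF A continuous_on_const continuous_on_mult[OF ci cp]] cfc_mult[OF A ci cp] cfc_const[OF A] I_def)
    then show ?case using pCons by simp
  qed
  show "cfc (1 / b) (1 / a) f I = cfc a b (\<lambda>s. f (1 / s)) A"
  proof (rule cfcI[OF btw f])
    fix e :: real assume "0 < e"
    then obtain p where p: "\<And>t. 1 / b \<le> t \<Longrightarrow> t \<le> 1 / a \<Longrightarrow> \<bar>f t - poly p t\<bar> \<le> e"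
      using weierstrass_poly[OF f] by blast
    have cp: "continuous_on {a..b} (\<lambda>s. poly p (1 / s))" by (intro comp continuous_intros)
    have "norm (cfc a b (\<lambda>s. f (1 / s) - poly p (1 / s)) A) \<le> e"
      by (rule cfc_norm_le[OF A continuous_on_diff[OF comp[OF f] cp]]) (use inv p in auto)
    then show "\<exists>p. (\<forall>t\<in>{1 / b..1 / a}. \<bar>f t - poly p t\<bar> \<le> e) \<and> norm (cfc a b (\<lambda>s. f (1 / s)) A - poly_op p I) \<le> e"
      using p by (intro exI[of _ p]) (simp add: poly cfc_diff[OF A comp[OF f] cp])
  qed
qed

end

text \<open>Since \<open>t * t \<le> norm A * t\<close> on \<open>[0, norm A]\<close>, the square of
  \<open>norm (A x)\<close> is at most \<open>norm A * (A x \<bullet> x)\<close>. The inverse bounds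
  \<open>norm (A x)\<close> from below, and so the form.\<close>

lemma regular_positive_bounded_below:
  assumes A: "positive_op A" "regular A" and nontriv: "(id_blinfun :: 'h::complex_hilbert operator) \<noteq> 0"
  shows "\<exists>e>0. between e (norm A) (A :: 'h operator)"
proof -
  obtain B where B: "A o\<^sub>L B = id_blinfun" "B o\<^sub>L A = id_blinfun"
    using A(2) unfolding regular_def by blast
  have btw: "between 0 (norm A) A" by (rule positive_op_between[OF A(1)])
  have sym: "sym_op A" by (rule between_sym[OF btw])
  have sq: "(norm (A x))\<^sup>2 \<le> norm A * (A x \<bullet> x)" for x
  proof -
    have "0 \<le> poly_op [:0, norm A, - 1:] A x \<bullet> x"
    proof (rule poly_op_nonneg[OF btw])
      fix t :: real assume "0 \<le> t" "t \<le> norm A"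
      then have "t * t \<le> norm A * t" by (intro mult_right_mono) auto
      then show "0 \<le> poly [:0, norm A, - 1:] t" by (simp add: algebra_simps)
    qed
    then show ?thesis
      by (simp add: sym_op_inner_self[OF sym] blinfun.bilinear_simps inner_diff_left)
  qed
  define K where "K = (norm B)\<^sup>2 * norm A"
  have le: "x \<bullet> x \<le> K * (A x \<bullet> x)" for x
  proof -
    have "norm x = norm (B (A x))"
      using arg_cong[OF B(2), of "\<lambda>T. T x"] by simp
    also have "\<dots> \<le> norm B * norm (A x)" by (rule norm_blinfun)
    finally have "(norm x)\<^sup>2 \<le> (norm B * norm (A x))\<^sup>2" by (intro power_mono) auto
    also have "\<dots> \<le> (norm B)\<^sup>2 * (norm A * (A x \<bullet> x))"
      unfolding power_mult_distrib by (intro mult_left_mono sq) auto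
    finally show ?thesis by (simp add: K_def power2_norm_eq_inner mult.assoc)
  qed
  have "A \<noteq> 0" "B \<noteq> 0" using B nontriv by auto
  then have K: "0 < K" by (simp add: K_def)
  \<comment> \<open>\<open>between\<close> demands \<open>e \<le> norm A\<close>, hence the minimum;
    on the zero space it would be 0.\<close>
  define e where "e = min (1 / K) (norm A)"
  have e: "0 < e" using K \<open>A \<noteq> 0\<close> by (simp add: e_def)
  have "e * (x \<bullet> x) \<le> A x \<bullet> x" for x
  proof -
    have "e * (x \<bullet> x) \<le> 1 / K * (x \<bullet> x)" by (intro mult_right_mono) (auto simp: e_def)
    also have "\<dots> \<le> A x \<bullet> x" using le[of x] K by (simp add: pos_divide_le_eq mult.commute)
    finally show ?thesis .
  qed
  then have "between e (norm A) A"
    using btw by (auto simp: between_def e_def)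
  then show ?thesis using e by blast
qed

section \<open>Tracial states\<close>

context
  fixes R :: "'h::complex_hilbert operator set" and \<tau> :: "'h operator \<Rightarrow> complex"
  assumes R: "von_neumann_algebra R" and tau: "faithful_normal_tracial_state R \<tau>"
begin

lemma R_algebra: "op_algebra R"
  by (rule von_neumann_op_algebra(1)[OF R])

lemma R_bounded: "A \<in> R \<Longrightarrow> A \<in> bounded_operators"
  using von_neumann_op_algebra(2)[OF R] by blast

lemma state_linear: "clinear_on R \<tau>"
  using tau unfolding faithful_normal_tracial_state_def state_on_def by (elim conjE)

lemma state_add: "A \<in> R \<Longrightarrow> B \<in> R \<Longrightarrow> Re (\<tau> (A + B)) = Re (\<tau> A) + Re (\<tau> B)"
  using state_linear by (simp add: clinear_on_def)

lemma state_scaleR: "A \<in> R \<Longrightarrow> Re (\<tau> (c *\<^sub>R A)) = c * Re (\<tau> A)"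
  using state_linear by (simp add: clinear_on_def scaleR_scaleC scaleC_complex_def)

lemma state_diff:
  assumes "A \<in> R" "B \<in> R"
  shows "Re (\<tau> (A - B)) = Re (\<tau> A) - Re (\<tau> B)"
  using state_add[OF op_algebra_diff[OF R_algebra assms] assms(2)] by simp

lemma state_0: "\<tau> 0 = 0"
proof -
  have "\<tau> (0 *\<^sub>C id_blinfun) = 0 *\<^sub>C \<tau> id_blinfun"
    using state_linear op_algebraD(1)[OF R_algebra] by (simp add: clinear_on_def)
  moreover have "0 *\<^sub>C (id_blinfun :: 'h operator) = 0"
    using scaleR_scaleC[of 0 "id_blinfun :: 'h operator"] by simp
  ultimately show ?thesis by (simp add: scaleC_complex_def)
qed

lemma state_sum: "(\<And>i. i \<in> I \<Longrightarrow> f i \<in> R) \<Longrightarrow> Re (\<tau> (sum f I)) = (\<Sum>i\<in>I. Re (\<tau> (f i)))"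
  by (induction I rule: infinite_finite_induct)
    (simp_all add: state_0 state_add op_algebra_sum[OF R_algebra])

lemma state_id: "\<tau> id_blinfun = 1"
  using tau unfolding faithful_normal_tracial_state_def state_on_def by (elim conjE)

lemma id_nontrivial: "(id_blinfun :: 'h operator) \<noteq> 0"
  using state_0 state_id by auto

lemma state_nonneg_Reals: "A \<in> R \<Longrightarrow> positive_op A \<Longrightarrow> \<tau> A \<in> \<real>\<^sub>\<ge>\<^sub>0"
  using tau unfolding faithful_normal_tracial_state_def state_on_def by (elim conjE) blast

lemma state_mono:
  assumes A: "A \<in> R" "sym_op A" and B: "B \<in> R" "sym_op B" and le: "\<And>x. A x \<bullet> x \<le> B x \<bullet> x"
  shows "Re (\<tau> A) \<le> Re (\<tau> B)"
proof -
  have BA: "B - A \<in> R" by (rule op_algebra_diff[OF R_algebra B(1) A(1)])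
  have "positive_op (B - A)"
    using le by (simp add: positive_op_iff R_bounded[OF BA] sym_op_diff A B blinfun.diff_left inner_diff_left)
  then have "0 \<le> Re (\<tau> (B - A))"
    using state_nonneg_Reals[OF BA] by (simp add: complex_nonneg_Reals_iff)
  then show ?thesis by (simp add: state_diff A B)
qed

lemma state_norm_bound:
  assumes A: "A \<in> R" "sym_op A" and e: "norm A \<le> e"
  shows "\<bar>Re (\<tau> A)\<bar> \<le> e"
proof -
  have idR: "c *\<^sub>R id_blinfun \<in> R" for c by (intro op_algebraD[OF R_algebra])
  have bd: "\<bar>A x \<bullet> x\<bar> \<le> e * (x \<bullet> x)" for x
    by (rule order_trans[OF form_bound mult_right_mono[OF e]]) simp
  have "Re (\<tau> A) \<le> Re (\<tau> (e *\<^sub>R id_blinfun))"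
    by (rule state_mono[OF A idR sym_op_scaleR[OF sym_op_id]])
      (use bd in \<open>auto simp: blinfun.scaleR_left abs_le_iff\<close>)
  moreover have "Re (\<tau> ((- e) *\<^sub>R id_blinfun)) \<le> Re (\<tau> A)"
    by (rule state_mono[OF idR sym_op_scaleR[OF sym_op_id] A])
      (use bd in \<open>auto simp: blinfun.scaleR_left blinfun.minus_left abs_le_iff minus_le_iff\<close>)
  ultimately show ?thesis
    using op_algebraD(1)[OF R_algebra] by (simp only: state_scaleR state_id) (simp add: abs_le_iff)
qed

lemma state_close:
  assumes "A \<in> R" "B \<in> R" "sym_op A" "sym_op B" "norm (A - B) \<le> e"
  shows "\<bar>Re (\<tau> A) - Re (\<tau> B)\<bar> \<le> e"
  using state_norm_bound[OF op_algebra_diff[OF R_algebra assms(1,2)] sym_op_diff[OF assms(3,4)] assms(5)]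
  by (simp add: state_diff assms)

section \<open>The distribution function of the trace\<close>

context
  fixes A :: "'h operator" and a b :: real
  assumes A: "between a b A" and AR: "A \<in> R"
begin

lemma spec_proj_R: "spec_proj a b A t \<in> R"
  by (rule spec_proj_in[OF A R_algebra AR])

lemma state_spec_proj_mono: "s \<le> t \<Longrightarrow> Re (\<tau> (spec_proj a b A s)) \<le> Re (\<tau> (spec_proj a b A t))"
  by (intro state_mono spec_proj_R sym_op_spec_proj[OF A] spec_proj_mono[OF A])

text \<open>\<open>normal_on\<close> concerns increasing families, while the projections decrease as
  \<open>s\<close> falls to \<open>t\<close>; so it is applied to the complements. Strong right
  continuity identifies their least upper bound, and monotonicity turns the supremum into a
  limit.\<close>

lemma state_spec_proj_right_continuous:
  "((\<lambda>s. Re (\<tau> (spec_proj a b A s))) \<longlongrightarrow> Re (\<tau> (spec_proj a b A t))) (at_right t)"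
proof -
  let ?P = "spec_proj a b A"
  let ?Q = "\<lambda>s. id_blinfun - ?P s"
  define D where "D = ?Q ` {t<..}"
  have symQ: "sym_op (?Q s)" for s by (intro sym_op_diff sym_op_id sym_op_spec_proj[OF A])
  have QR: "?Q s \<in> R" for s
    by (intro op_algebra_diff[OF R_algebra] op_algebraD(1)[OF R_algebra] spec_proj_R)
  have Qle: "le_op (?Q s) (?Q s')" if "s' \<le> s" for s s'
    using spec_proj_mono[OF A that]
    by (simp add: le_op_iff R_bounded QR symQ blinfun.diff_left inner_diff_left)
  have lub: "le_op (?Q t) K" if K: "K \<in> R" "\<forall>X\<in>D. le_op X K" for K
  proof -
    have Ks: "positive_op (K - ?Q s)" if "t < s" for s
      using K(2) that by (auto simp: D_def le_op_def)
    \<comment> \<open>\<open>K\<close> dominates a symmetric operator; adding that operator back to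
      the positive difference shows that \<open>K\<close> is symmetric.\<close>
    have "sym_op ((K - ?Q (t + 1)) + ?Q (t + 1))"
      using Ks[of "t + 1"] symQ by (intro sym_op_add) (auto simp: positive_op_iff)
    then have symK: "sym_op K" by simp
    have "?Q t x \<bullet> x \<le> K x \<bullet> x" for x
    proof (rule tendsto_upperbound)
      show "((\<lambda>s. ?Q s x \<bullet> x) \<longlongrightarrow> ?Q t x \<bullet> x) (at_right t)"
        unfolding blinfun.diff_left
        by (intro tendsto_inner tendsto_diff tendsto_const spec_proj_right_continuous[OF A])
      show "\<forall>\<^sub>F s in at_right t. ?Q s x \<bullet> x \<le> K x \<bullet> x"
        unfolding eventually_at_right_field
        using Ks by (intro exI[of _ "t + 1"]) (auto simp: positive_op_iff blinfun.diff_left inner_diff_left)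
    qed simp
    then show ?thesis
      using le_op_iff[OF R_bounded[OF QR] R_bounded[OF K(1)] symQ symK] by blast
  qed
  have "normal_on R \<tau>"
    using tau unfolding faithful_normal_tracial_state_def by (elim conjE)
  note normal = this[unfolded normal_on_def, THEN spec, THEN spec, THEN mp, of D "?Q t"]
  have "D \<noteq> {}" by (auto simp: D_def)
  have sup: "Re (\<tau> (?Q t)) = (SUP X\<in>D. Re (\<tau> X))"
  proof (rule normal, intro conjI)
    show "D \<subseteq> {X \<in> R. self_adjoint X}"
      using QR symQ R_bounded self_adjoint_sym_op by (auto simp: D_def)
    show "\<forall>X\<in>D. \<forall>Y\<in>D. \<exists>Z\<in>D. le_op X Z \<and> le_op Y Z"
    proof (intro ballI)
      fix X Y assume "X \<in> D" "Y \<in> D"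
      then obtain r s where "X = ?Q r" "Y = ?Q s" "t < r" "t < s" by (auto simp: D_def)
      then show "\<exists>Z\<in>D. le_op X Z \<and> le_op Y Z"
        by (intro bexI[of _ "?Q (min r s)"]) (auto simp: D_def intro!: Qle)
    qed
    show "\<forall>X\<in>D. le_op X (?Q t)" by (auto simp: D_def intro!: Qle)
    show "self_adjoint (?Q t)" by (rule self_adjoint_sym_op[OF R_bounded[OF QR] symQ])
    show "\<forall>K\<in>R. self_adjoint K \<and> (\<forall>X\<in>D. le_op X K) \<longrightarrow> le_op (?Q t) K"
      by (intro ballI impI, elim conjE) (rule lub)
  qed (rule \<open>D \<noteq> {}\<close> QR)+
  have tQ: "Re (\<tau> (?Q s)) = 1 - Re (\<tau> (?P s))" for s
    by (simp add: state_diff spec_proj_R op_algebraD(1)[OF R_algebra] state_id)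
  have mono: "Re (\<tau> (?P s)) \<le> Re (\<tau> (?P s'))" if "s \<le> s'" for s s' by (rule state_spec_proj_mono[OF that])
  show ?thesis
  proof (rule tendstoI)
    fix e :: real assume e: "0 < e"
    have bdd: "bdd_above ((\<lambda>X. Re (\<tau> X)) ` D)"
      unfolding D_def by (rule bdd_aboveI[of _ "Re (\<tau> (?Q t))"]) (use mono tQ in auto)
    have "Re (\<tau> (?Q t)) - e < (SUP X\<in>D. Re (\<tau> X))" using sup e by simp
    then obtain X where "X \<in> D" "Re (\<tau> (?Q t)) - e < Re (\<tau> X)"
      using less_cSUP_iff[OF \<open>D \<noteq> {}\<close> bdd] by blast
    then obtain s where s: "t < s" "Re (\<tau> (?Q t)) - e < Re (\<tau> (?Q s))"
      unfolding D_def by blast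
    have "dist (Re (\<tau> (?P r))) (Re (\<tau> (?P t))) < e" if "t < r" "r < s" for r
      using s mono[of t r] mono[of r s] that by (simp add: tQ dist_real_def)
    then show "\<forall>\<^sub>F r in at_right t. dist (Re (\<tau> (?P r))) (Re (\<tau> (?P t))) < e"
      unfolding eventually_at_right_field using s(1) by blast
  qed
qed

lemma state_spec_proj_stieltjes: "stieltjes a b 1 (\<lambda>t. Re (\<tau> (spec_proj a b A t)))"
  unfolding stieltjes_def
proof (intro conjI allI impI state_spec_proj_right_continuous state_spec_proj_mono)
  show "a \<le> b" using A by (simp add: between_def)
qed (simp_all add: spec_proj_eq_0[OF A] spec_proj_eq_id[OF A] state_0 state_id)

lemma cfc_R: "continuous_on {a..b} f \<Longrightarrow> cfc a b f A \<in> R"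
  by (rule op_algebra_cfc[OF R_algebra AR A])

text \<open>Uniformity of \<open>stieltjes_riemann\<close> does the work: one \<open>N\<close> makes
  the step operator close to \<open>poly_op p A\<close> in norm and the sum of its traces close to
  the integral against the trace measure. Only finite sums pass through
  \<open>\<tau>\<close>.\<close>

lemma state_cfc_poly:
  "(\<integral>t. poly p t \<partial>interval_measure (\<lambda>t. Re (\<tau> (spec_proj a b A t)))) = Re (\<tau> (poly_op p A))"
proof -
  let ?P = "spec_proj a b A"
  let ?F = "\<lambda>t. Re (\<tau> (?P t))"
  have ab: "a \<le> b" using A by (simp add: between_def)
  note Rs = resolution_spec_proj[OF A] and symA = between_sym[OF A]
  have "\<bar>(\<integral>t. poly p t \<partial>interval_measure ?F) - Re (\<tau> (poly_op p A))\<bar> \<le> e * 2" if e: "0 < e" for e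
  proof -
    have "continuous_on UNIV (poly p)" by (intro continuous_intros)
    then obtain N where N: "0 < N" "\<And>n c F. N \<le> n \<Longrightarrow> stieltjes a b c F \<Longrightarrow>
        \<bar>(\<integral>u. poly p u \<partial>interval_measure F) - (\<Sum>i<n. poly p (mesh_point a b n (Suc i)) * (F (mesh_point a b n (Suc i)) - F (mesh_point a b n i)))\<bar> \<le> e * c"
      by (rule stieltjes_riemann[OF ab _ e]) (rule that)
    define t where "t = mesh_point a b N"
    define U where "U = (\<Sum>i<N. poly p (t (Suc i)) *\<^sub>R (?P (t (Suc i)) - ?P (t i)))"
    have symU: "sym_op U" unfolding U_def by (rule sym_op_resolution_step[OF symA Rs])
    have termR: "?P (t (Suc i)) - ?P (t i) \<in> R" for i
      by (intro op_algebra_diff[OF R_algebra] spec_proj_R)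
    have UR: "U \<in> R"
      unfolding U_def by (intro op_algebra_sum[OF R_algebra] op_algebraD(3)[OF R_algebra] termR)
    have "norm (poly_op p A - U) \<le> e"
    proof (rule sym_op_norm_le)
      show "sym_op (poly_op p A - U)" by (intro sym_op_diff sym_op_poly_op symA symU)
      fix x
      have "U x \<bullet> x = (\<Sum>i<N. poly p (t (Suc i)) * (?P (t (Suc i)) x \<bullet> x - ?P (t i) x \<bullet> x))"
        unfolding U_def by (rule resolution_step_form[OF symA Rs])
      then show "\<bar>(poly_op p A - U) x \<bullet> x\<bar> \<le> e * (x \<bullet> x)"
        using N(2)[OF order_refl resolution_stieltjes[OF Rs, of x]] resolution_poly[OF symA Rs, where p = p and x = x]
        by (simp add: t_def blinfun.diff_left inner_diff_left)
    qed (use e in simp)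
    then have 1: "\<bar>Re (\<tau> (poly_op p A)) - Re (\<tau> U)\<bar> \<le> e"
      by (rule state_close[OF op_algebra_poly_op[OF R_algebra AR] UR sym_op_poly_op[OF symA] symU])
    have "Re (\<tau> U) = (\<Sum>i<N. poly p (t (Suc i)) * (?F (t (Suc i)) - ?F (t i)))"
      unfolding U_def by (subst state_sum)
        (simp_all add: op_algebraD(3)[OF R_algebra] termR state_scaleR state_diff spec_proj_R)
    then have 2: "\<bar>(\<integral>u. poly p u \<partial>interval_measure ?F) - Re (\<tau> U)\<bar> \<le> e * 1"
      using N(2)[OF order_refl state_spec_proj_stieltjes] by (simp add: t_def)
    show ?thesis using 1 2 by linarith
  qed
  from nonpos_if_le_scaled[OF this] show ?thesis by simp
qed

lemma state_cfc:
  assumes f: "f \<in> borel_measurable borel" "continuous_on {a..b} f"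
  shows "(\<integral>t. f t \<partial>interval_measure (\<lambda>t. Re (\<tau> (spec_proj a b A t)))) = Re (\<tau> (cfc a b f A))"
proof -
  let ?N = "interval_measure (\<lambda>t. Re (\<tau> (spec_proj a b A t)))"
  have "\<bar>(\<integral>t. f t \<partial>?N) - Re (\<tau> (cfc a b f A))\<bar> \<le> e * 2" if e: "0 < e" for e
  proof -
    obtain p where p: "\<And>t. a \<le> t \<Longrightarrow> t \<le> b \<Longrightarrow> \<bar>f t - poly p t\<bar> \<le> e"
      using weierstrass_poly[OF f(2) e] by blast
    have "continuous_on UNIV (poly p)" by (intro continuous_intros)
    then have pm: "poly p \<in> borel_measurable borel" "continuous_on {a..b} (poly p)"
      by (auto intro: borel_measurable_continuous_onI continuous_on_subset)
    have "\<bar>(\<integral>t. f t \<partial>?N) - (\<integral>t. poly p t \<partial>?N)\<bar> \<le> e * 1"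
      by (rule stieltjes_integral_close[OF state_spec_proj_stieltjes f pm p])
    moreover have "\<bar>Re (\<tau> (cfc a b f A)) - Re (\<tau> (poly_op p A))\<bar> \<le> e"
      by (rule state_close[OF cfc_R[OF f(2)] op_algebra_poly_op[OF R_algebra AR] sym_op_cfc[OF A f(2)]
            sym_op_poly_op[OF between_sym[OF A]] cfc_approx[OF A f(2) p]])
    ultimately show ?thesis using state_cfc_poly[of p] by linarith
  qed
  from nonpos_if_le_scaled[OF this] show ?thesis by simp
qed

end

end

lemma ln_one_plus_ratio:
  fixes u h :: real
  assumes "0 < u" "0 < u + h"
  shows "ln (1 + h / u) = ln (u + h) - ln u"
proof -
  have "1 + h / u = (u + h) / u" using assms by (simp add: add_divide_distrib)
  then show ?thesis unfolding \<open>1 + h / u = (u + h) / u\<close> using assms by (simp add: ln_div)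
qed

text \<open>The error is quadratic in \<open>h\<close> and uniform in \<open>u \<ge> m\<close>, so
  it survives the functional calculus as a norm bound. The restriction on \<open>h\<close> keeps the
  modulus of \<open>h / u\<close> within \<open>1 / 2\<close>.\<close>

lemma ln_shift_approx:
  fixes u h m :: real
  assumes m: "0 < m" "m \<le> u" and h: "\<bar>h\<bar> \<le> m / 2"
  shows "\<bar>ln (u + h) - ln u - h * (1 / u)\<bar> \<le> 2 * h\<^sup>2 / m\<^sup>2"
proof -
  have u: "0 < u" "0 < u + h" using assms by (auto simp: abs_le_iff)
  have hu: "\<bar>h / u\<bar> \<le> \<bar>h\<bar> / m"
    using m by (simp add: abs_divide frac_le)
  also have "\<bar>h\<bar> / m \<le> 1 / 2" using m h by (simp add: divide_simps)
  finally have "\<bar>h / u\<bar> \<le> 1 / 2" .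
  then have "\<bar>ln (1 + h / u) - h / u\<bar> \<le> 2 * (h / u)\<^sup>2"
    by (rule abs_ln_one_plus_x_minus_x_bound)
  also have "ln (1 + h / u) = ln (u + h) - ln u"
    by (rule ln_one_plus_ratio[OF u])
  also have "2 * (h / u)\<^sup>2 \<le> 2 * h\<^sup>2 / m\<^sup>2"
    using power_mono[OF hu, of 2] by (simp add: power_divide)
  finally show ?thesis by simp
qed

section \<open>The determinant of operators bounded below\<close>

context
  fixes R :: "'h::complex_hilbert operator set" and \<tau> :: "'h operator \<Rightarrow> complex"
  assumes R: "von_neumann_algebra R" and tau: "faithful_normal_tracial_state R \<tau>"
begin

lemma between_le_norm:
  assumes "between e M (A :: 'h operator)"
  shows "e \<le> norm A"
proof -
  obtain x :: 'h where x: "x \<noteq> 0"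
    using id_nontrivial[OF R tau] by (metis blinfun_eqI id_apply blinfun.zero_left blinfun_apply_id_blinfun)
  have "e * (x \<bullet> x) \<le> A x \<bullet> x" using assms by (simp add: between_def)
  also have "\<dots> \<le> norm A * (x \<bullet> x)" using form_bound[of A x] by simp
  finally show ?thesis using x by simp
qed

lemma between_positive_op: "A \<in> R \<Longrightarrow> between e M A \<Longrightarrow> 0 \<le> e \<Longrightarrow> positive_op A"
  unfolding positive_op_iff between_def
  using R_bounded[OF R tau] by (meson inner_ge_zero mult_nonneg_nonneg order_trans)

lemma FK_det_regular:
  assumes AR: "A \<in> R" and A: "between e M A" and e: "0 < e"
  shows "regular A" "FK_det \<tau> A = exp (Re (\<tau> (cfc e M ln A)))"
proof -
  have pos: "positive_op A" using between_positive_op[OF AR A] e by simp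
  have bnd: "A \<in> bounded_operators" by (rule R_bounded[OF R tau AR])
  show reg: "regular A"
    using inv_op_eqI(1)[OF cfc_resolvent[OF A, of 0]] e by simp
  have A': "between e (norm A) A"
    using A between_le_norm[OF A] positive_op_between[OF pos] by (simp add: between_def)
  have ln_cont: "continuous_on {e..b} ln" for b using e by (intro continuous_intros) auto
  \<comment> \<open>\<open>op_fun_eq_cfc\<close> wants an interval inside
    \<open>[- norm A, norm A]\<close>, whereas \<open>M\<close> is arbitrary; a larger common
    interval mediates.\<close>
  have "cfc e (norm A) ln A = cfc e (max M (norm A)) ln A"
    by (rule cfc_interval[OF A']) (auto intro: ln_cont)
  also have "\<dots> = cfc e M ln A"
    by (rule cfc_interval[OF A, symmetric]) (auto intro: ln_cont)
  finally have eq: "cfc e (norm A) ln A = cfc e M ln A" .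
  have "- norm A \<le> e" using e norm_ge_zero[of A] by linarith
  then have "op_fun ln A = cfc e (norm A) ln A"
    by (rule op_fun_eq_cfc[OF A' bnd _ order_refl _ ln_cont]) simp
  then show "FK_det \<tau> A = exp (Re (\<tau> (cfc e M ln A)))"
    using reg by (simp add: FK_det_def abs_op_positive[OF pos] eq)
qed

text \<open>Membership is stated for every \<open>op_algebra\<close> because the equality case needs
  it for the subalgebra too.\<close>

lemma FK_det_inverse:
  assumes AR: "A \<in> R" and A: "between e M A" and e: "0 < e"
  shows "A o\<^sub>L inv_op A = id_blinfun" "inv_op A o\<^sub>L A = id_blinfun"
    "between (1 / M) (1 / e) (inv_op A)" "op_algebra T \<Longrightarrow> A \<in> T \<Longrightarrow> inv_op A \<in> T"
    "FK_det \<tau> (inv_op A) = 1 / FK_det \<tau> A"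
proof -
  have eM: "e \<le> M" using A by (simp add: between_def)
  define I where "I = cfc e M (\<lambda>s. 1 / s) A"
  have ci: "continuous_on {e..M} (\<lambda>s. 1 / s)" using e by (intro continuous_intros) auto
  have I: "A o\<^sub>L I = id_blinfun" "I o\<^sub>L A = id_blinfun"
    using cfc_resolvent[OF A, of 0] e by (simp_all add: I_def)
  then have inv: "inv_op A = I" by (rule inv_op_eqI(2))
  show "A o\<^sub>L inv_op A = id_blinfun" "inv_op A o\<^sub>L A = id_blinfun" using I inv by simp_all
  have mem: "I \<in> T" if "op_algebra T" "A \<in> T" for T
    unfolding I_def by (rule op_algebra_cfc[OF that A ci])
  then show "op_algebra T \<Longrightarrow> A \<in> T \<Longrightarrow> inv_op A \<in> T" by (simp add: inv)
  have lnc: "continuous_on {1 / M..1 / e} ln" "continuous_on {e..M} ln"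
    using e eM by (auto intro!: continuous_intros)
  have btw: "between (1 / M) (1 / e) I"
    unfolding I_def by (rule cfc_inverse_compose(1)[OF A e lnc(1)])
  then show "between (1 / M) (1 / e) (inv_op A)" by (simp add: inv)
  have "cfc (1 / M) (1 / e) ln I = cfc e M (\<lambda>s. ln (1 / s)) A"
    unfolding I_def by (rule cfc_inverse_compose(2)[OF A e lnc(1)])
  also have "\<dots> = cfc e M (\<lambda>s. - 1 * ln s) A"
    using e by (intro cfc_cong[OF A]) (simp add: ln_div)
  also have "\<dots> = (- 1) *\<^sub>R cfc e M ln A" by (rule cfc_scale[OF A lnc(2)])
  finally have "Re (\<tau> (cfc (1 / M) (1 / e) ln I)) = - Re (\<tau> (cfc e M ln A))"
    by (simp only: state_scaleR[OF R tau cfc_R[OF R tau A AR lnc(2)]])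
  moreover have "0 < 1 / M" using e eM by simp
  ultimately show "FK_det \<tau> (inv_op A) = 1 / FK_det \<tau> A"
    unfolding inv FK_det_regular(2)[OF AR A e]
    using FK_det_regular(2)[OF mem[OF R_algebra[OF R tau] AR] btw]
    by (simp add: exp_minus inverse_eq_divide)
qed

lemma trace_measure_positive:
  assumes "A \<in> R" "positive_op A"
  shows "trace_measure \<tau> A = interval_measure (\<lambda>t. Re (\<tau> (spec_proj 0 (norm A) A t)))"
  unfolding trace_measure_def
  by (subst spectral_family_eq[OF positive_op_between[OF assms(2)] R_bounded[OF R tau assms(1)]]) simp_all

section \<open>The trace of the logarithm\<close>

context
  fixes A :: "'h operator" and a b :: real
  assumes A: "between a b A" and AR: "A \<in> R"
begin

lemma continuous_on_shifted:
  "0 < a + t \<Longrightarrow> continuous_on {a..b} (\<lambda>s. ln (s + t))"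
  "0 < a + t \<Longrightarrow> continuous_on {a..b} (\<lambda>s. 1 / (s + t))"
  by (intro continuous_intros; force)+

lemma log_trace_DERIV:
  assumes t: "0 < a + t"
  shows "((\<lambda>t. Re (\<tau> (cfc a b (\<lambda>s. ln (s + t)) A))) has_real_derivative
    Re (\<tau> (cfc a b (\<lambda>s. 1 / (s + t)) A))) (at t)"
proof -
  let ?L = "\<lambda>t. Re (\<tau> (cfc a b (\<lambda>s. ln (s + t)) A))" and ?G = "cfc a b (\<lambda>s. 1 / (s + t)) A"
  \<comment> \<open>The least value of \<open>s + t\<close> on \<open>{a..b}\<close>.\<close>
  define m where "m = a + t"
  have m: "0 < m" using t by (simp add: m_def)
  note cR = cfc_R[OF R tau A AR]
  have bound: "\<bar>?L (t + h) - ?L t - h * Re (\<tau> ?G)\<bar> \<le> 2 * h\<^sup>2 / m\<^sup>2" if h: "\<bar>h\<bar> \<le> m / 2" for h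
  proof -
    have th: "0 < a + (t + h)" using h m by (auto simp: m_def abs_le_iff)
    note c1 = continuous_on_shifted(1)[OF th] and c2 = continuous_on_shifted(1)[OF t]
      and c3 = continuous_on_shifted(2)[OF t]
    have c3': "continuous_on {a..b} (\<lambda>s. h * (1 / (s + t)))" by (intro continuous_on_mult continuous_on_const c3)
    have c12: "continuous_on {a..b} (\<lambda>s. ln (s + (t + h)) - ln (s + t))" by (intro continuous_on_diff c1 c2)
    let ?f = "\<lambda>s. ln (s + (t + h)) - ln (s + t) - h * (1 / (s + t))"
    have cf: "continuous_on {a..b} ?f" by (intro continuous_on_diff c12 c3')
    have eq: "cfc a b ?f A = cfc a b (\<lambda>s. ln (s + (t + h))) A - cfc a b (\<lambda>s. ln (s + t)) A - h *\<^sub>R ?G"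
      by (simp only: cfc_diff[OF A c12 c3'] cfc_diff[OF A c1 c2] cfc_scale[OF A c3])
    have "norm (cfc a b ?f A) \<le> 2 * h\<^sup>2 / m\<^sup>2"
    proof (rule cfc_norm_le[OF A cf])
      fix s assume "a \<le> s" "s \<le> b"
      then show "\<bar>?f s\<bar> \<le> 2 * h\<^sup>2 / m\<^sup>2"
        using ln_shift_approx[OF m _ h, of "s + t"] by (simp add: m_def add.assoc)
    qed
    then have "\<bar>Re (\<tau> (cfc a b ?f A))\<bar> \<le> 2 * h\<^sup>2 / m\<^sup>2"
      by (rule state_norm_bound[OF R tau cR[OF cf] sym_op_cfc[OF A cf]])
    moreover have "Re (\<tau> (cfc a b ?f A)) = ?L (t + h) - ?L t - h * Re (\<tau> ?G)"
      unfolding eq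
      by (simp only: state_diff[OF R tau] state_scaleR[OF R tau] cR[OF c1] cR[OF c2] cR[OF c3]
          op_algebra_diff[OF R_algebra[OF R tau]] op_algebraD(3)[OF R_algebra[OF R tau]])
    ultimately show ?thesis by simp
  qed
  have "((\<lambda>h. (?L (t + h) - ?L t) / h - Re (\<tau> ?G)) \<longlongrightarrow> 0) (at 0)"
  proof (rule Lim_null_comparison)
    have "((\<lambda>h. 2 / m\<^sup>2 * \<bar>h\<bar>) \<longlongrightarrow> 2 / m\<^sup>2 * \<bar>0\<bar>) (at 0)"
      by (intro tendsto_intros)
    then show "((\<lambda>h. 2 / m\<^sup>2 * \<bar>h\<bar>) \<longlongrightarrow> 0) (at 0)" by simp
    have est: "norm ((?L (t + h) - ?L t) / h - Re (\<tau> ?G)) \<le> 2 / m\<^sup>2 * \<bar>h\<bar>" if "h \<noteq> 0" "\<bar>h\<bar> < m / 2" for h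
    proof -
      have "(?L (t + h) - ?L t) / h - Re (\<tau> ?G) = (?L (t + h) - ?L t - h * Re (\<tau> ?G)) / h"
        using that by (simp add: diff_divide_distrib)
      also have "\<bar>\<dots>\<bar> \<le> (2 * h\<^sup>2 / m\<^sup>2) / \<bar>h\<bar>"
        unfolding abs_divide using bound[of h] that by (intro divide_right_mono) auto
      also have "\<dots> = 2 / m\<^sup>2 * \<bar>h\<bar>"
        using that by (simp add: power2_eq_square abs_if)
      finally show ?thesis by simp
    qed
    show "\<forall>\<^sub>F h in at 0. norm ((?L (t + h) - ?L t) / h - Re (\<tau> ?G)) \<le> 2 / m\<^sup>2 * \<bar>h\<bar>"
      unfolding eventually_at using est m by (intro exI[of _ "m / 2"]) (simp add: dist_real_def)
  qed
  then show ?thesis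
    unfolding DERIV_def by (rule LIM_zero_cancel)
qed

text \<open>The normalisation by \<open>ln t\<close> is the same for all operators, as
  \<open>\<tau>\<close> is 1 at the identity; in a difference of two log traces it cancels.\<close>

lemma log_trace_at_top:
  "((\<lambda>t. Re (\<tau> (cfc a b (\<lambda>s. ln (s + t)) A)) - ln t) \<longlongrightarrow> 0) at_top"
proof (rule Lim_null_comparison)
  \<comment> \<open>\<open>K\<close> bounds the modulus of \<open>s\<close> on
    \<open>{a..b}\<close>; the summand 1 keeps it positive. \<open>2 * K \<le> t\<close> then gives
    \<open>0 < a + t\<close> and keeps the modulus of \<open>s / t\<close> within
    \<open>1 / 2\<close>.\<close>
  define K where "K = \<bar>a\<bar> + \<bar>b\<bar> + 1"
  have K: "0 < K" by (simp add: K_def)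
  show "((\<lambda>t. 2 * K / t) \<longlongrightarrow> 0) at_top"
    by (rule real_tendsto_divide_at_top[OF tendsto_const filterlim_ident])
  have "norm (Re (\<tau> (cfc a b (\<lambda>s. ln (s + t)) A)) - ln t) \<le> 2 * K / t" if t: "2 * K \<le> t" for t
  proof -
    have t0: "0 < t" "0 < a + t" using t K by (auto simp: K_def)
    note c = continuous_on_shifted(1)[OF t0(2)]
    have cf: "continuous_on {a..b} (\<lambda>s. ln (s + t) - ln t)" by (intro continuous_on_diff c continuous_on_const)
    have "norm (cfc a b (\<lambda>s. ln (s + t) - ln t) A) \<le> 2 * K / t"
    proof (rule cfc_norm_le[OF A cf])
      fix s assume s: "a \<le> s" "s \<le> b"
      have sK: "\<bar>s\<bar> \<le> K" using s by (auto simp: K_def)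
      have st: "\<bar>s / t\<bar> \<le> K / t" using sK t0 by (simp add: abs_divide divide_right_mono)
      also have "K / t \<le> 1 / 2" using t K t0 by (simp add: divide_simps)
      finally have half: "\<bar>s / t\<bar> \<le> 1 / 2" .
      have "ln (s + t) - ln t = ln (1 + s / t)"
        using ln_one_plus_ratio[of t s] s t0 by (simp add: add.commute)
      moreover have "\<bar>ln (1 + s / t) - s / t\<bar> \<le> 2 * (s / t)\<^sup>2"
        by (rule abs_ln_one_plus_x_minus_x_bound[OF half])
      moreover have "2 * (s / t)\<^sup>2 \<le> \<bar>s / t\<bar>"
        using mult_right_mono[OF half, of "\<bar>s / t\<bar>"] by (simp add: power2_eq_square flip: abs_mult)
      ultimately show "\<bar>ln (s + t) - ln t\<bar> \<le> 2 * K / t"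
        using st by linarith
    qed
    then have "\<bar>Re (\<tau> (cfc a b (\<lambda>s. ln (s + t) - ln t) A))\<bar> \<le> 2 * K / t"
      by (rule state_norm_bound[OF R tau cfc_R[OF R tau A AR cf] sym_op_cfc[OF A cf]])
    moreover have "Re (\<tau> (cfc a b (\<lambda>s. ln (s + t) - ln t) A)) = Re (\<tau> (cfc a b (\<lambda>s. ln (s + t)) A)) - ln t"
      using op_algebraD(1,3)[OF R_algebra[OF R tau]]
      by (simp add: cfc_diff[OF A c continuous_on_const] cfc_const[OF A] state_diff[OF R tau cfc_R[OF R tau A AR c]]
          state_scaleR[OF R tau] state_id[OF R tau])
    ultimately show ?thesis by simp
  qed
  then show "\<forall>\<^sub>F t in at_top. norm (Re (\<tau> (cfc a b (\<lambda>s. ln (s + t)) A)) - ln t) \<le> 2 * K / t"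
    unfolding eventually_at_top_linorder by blast
qed

end

end

section \<open>Conditional expectations\<close>

context
  fixes R S :: "'h::complex_hilbert operator set"
    and \<tau> :: "'h operator \<Rightarrow> complex"
    and \<Phi> :: "'h operator \<Rightarrow> 'h operator"
  assumes R: "von_neumann_algebra R" and tau: "faithful_normal_tracial_state R \<tau>"
    and S: "von_neumann_algebra S" and SR: "S \<subseteq> R"
    and Phi: "conditional_expectation R S \<Phi>" and pres: "preserves_on R \<tau> \<Phi>"
begin

lemma expectation_in: "A \<in> R \<Longrightarrow> \<Phi> A \<in> S" "A \<in> R \<Longrightarrow> \<Phi> A \<in> R"
  using Phi SR unfolding conditional_expectation_def by blast+

lemma expectation_module: "A \<in> R \<Longrightarrow> B \<in> S \<Longrightarrow> C \<in> S \<Longrightarrow> \<Phi> (B o\<^sub>L A o\<^sub>L C) = B o\<^sub>L \<Phi> A o\<^sub>L C"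
  using Phi unfolding conditional_expectation_def by blast

lemma expectation_id: "\<Phi> id_blinfun = id_blinfun"
  using Phi unfolding conditional_expectation_def by (elim conjE)

lemma expectation_fixed:
  assumes "A \<in> S"
  shows "\<Phi> A = A"
  using expectation_module[of id_blinfun A id_blinfun] op_algebraD(1)[OF R_algebra[OF R tau]]
    op_algebraD(1)[OF von_neumann_op_algebra(1)[OF S]] assms by (simp add: expectation_id)

lemma expectation_fixed_iff: "A \<in> R \<Longrightarrow> \<Phi> A = A \<longleftrightarrow> A \<in> S"
  using expectation_fixed expectation_in(1)[of A] by metis

lemma expectation_linear: "clinear_on R \<Phi>"
  using Phi unfolding conditional_expectation_def by (elim conjE)

lemma expectation_scaleR: "A \<in> R \<Longrightarrow> \<Phi> (c *\<^sub>R A) = c *\<^sub>R \<Phi> A"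
  using expectation_linear by (simp add: clinear_on_def scaleR_scaleC)

lemma expectation_diff:
  assumes "A \<in> R" "B \<in> R"
  shows "\<Phi> (A - B) = \<Phi> A - \<Phi> B"
proof -
  have "A - B \<in> R" by (rule op_algebra_diff[OF R_algebra[OF R tau] assms])
  then have "\<Phi> (A - B + B) = \<Phi> (A - B) + \<Phi> B"
    using expectation_linear assms unfolding clinear_on_def by blast
  then show ?thesis by simp
qed

lemma expectation_positive: "A \<in> R \<Longrightarrow> positive_op A \<Longrightarrow> positive_op (\<Phi> A)"
  using Phi unfolding conditional_expectation_def by blast

text \<open>Positivity is applied to \<open>A - a\<close> and \<open>b - A\<close>. Hence one
  interval serves for \<open>A\<close> and \<open>\<Phi> A\<close> in every comparison.\<close>

lemma expectation_between:
  assumes A: "A \<in> R" "between a b A"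
  shows "between a b (\<Phi> A)"
proof -
  note RA = R_algebra[OF R tau] and Rb = R_bounded[OF R tau]
  have cR: "c *\<^sub>R id_blinfun \<in> R" for c by (intro op_algebraD[OF RA])
  have sA: "sym_op A" by (rule between_sym[OF A(2)])
  have sc: "sym_op (c *\<^sub>R id_blinfun)" for c by (intro sym_op_scaleR sym_op_id)
  have lo: "A - a *\<^sub>R id_blinfun \<in> R" and up: "b *\<^sub>R id_blinfun - A \<in> R"
    by (intro op_algebra_diff[OF RA] A(1) cR)+
  have "positive_op (A - a *\<^sub>R id_blinfun)"
    using A(2) Rb[OF lo] sym_op_diff[OF sA sc, of a]
    by (simp add: positive_op_iff between_def blinfun.bilinear_simps inner_diff_left)
  from expectation_positive[OF lo this] have 1: "positive_op (\<Phi> A - a *\<^sub>R id_blinfun)"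
    by (simp add: expectation_diff A cR expectation_scaleR op_algebraD(1)[OF RA] expectation_id)
  have "positive_op (b *\<^sub>R id_blinfun - A)"
    using A(2) Rb[OF up] sym_op_diff[OF sc sA, of b]
    by (simp add: positive_op_iff between_def blinfun.bilinear_simps inner_diff_left)
  from expectation_positive[OF up this] have 2: "positive_op (b *\<^sub>R id_blinfun - \<Phi> A)"
    by (simp add: expectation_diff A cR expectation_scaleR op_algebraD(1)[OF RA] expectation_id)
  have "sym_op (\<Phi> A - a *\<^sub>R id_blinfun + a *\<^sub>R id_blinfun)"
    using 1 sc by (intro sym_op_add) (auto simp: positive_op_iff)
  then show ?thesis
    using 1 2 A(2) by (simp add: between_def positive_op_iff blinfun.bilinear_simps inner_diff_left)
qed

text \<open>
  Put \<open>B = \<Phi>(A)\<close>, \<open>D = A - B\<close>, \<open>G = (A + t)\<^sup>-\<^sup>1\<close> and \<open>C = (B + t)\<^sup>-\<^sup>1\<close>.  Then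
  \<open>G = C - C D C + C D G D C\<close>, and \<open>\<tau>(C D C) = \<tau>(C \<Phi>(D) C) = 0\<close> because \<open>C \<in> \<S>\<close>.
\<close>

lemma expectation_resolvent:
  assumes AR: "A \<in> R" and A: "between a b A" and t: "0 < a + t"
  shows "Re (\<tau> (cfc a b (\<lambda>s. 1 / (s + t)) (\<Phi> A))) \<le> Re (\<tau> (cfc a b (\<lambda>s. 1 / (s + t)) A))" (is ?le)
    and "Re (\<tau> (cfc a b (\<lambda>s. 1 / (s + t)) (\<Phi> A))) = Re (\<tau> (cfc a b (\<lambda>s. 1 / (s + t)) A)) \<Longrightarrow> \<Phi> A = A"
proof -
  note RA = R_algebra[OF R tau] and Rb = R_bounded[OF R tau]
  define B where "B = \<Phi> A"
  define D where "D = A - B"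
  define G where "G = cfc a b (\<lambda>s. 1 / (s + t)) A"
  define C where "C = cfc a b (\<lambda>s. 1 / (s + t)) B"
  \<comment> \<open>\<open>adj K\<close> is \<open>C o\<^sub>L D\<close>, so the remainder
    \<open>C D G D C\<close> is \<open>adj K\<close> times \<open>G\<close> times
    \<open>K\<close>.\<close>
  define K where "K = D o\<^sub>L C"
  have BS: "B \<in> S" and BR: "B \<in> R" using expectation_in[OF AR] by (simp_all add: B_def)
  have B: "between a b B" unfolding B_def by (rule expectation_between[OF AR A])
  have cont: "continuous_on {a..b} (\<lambda>s. 1 / (s + t))" using t by (intro continuous_intros) auto
  have CS: "C \<in> S" unfolding C_def by (rule op_algebra_cfc[OF von_neumann_op_algebra(1)[OF S] BS B cont])
  then have CR: "C \<in> R" using SR by blast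
  have GR: "G \<in> R" unfolding G_def by (rule op_algebra_cfc[OF RA AR A cont])
  have DR: "D \<in> R" unfolding D_def by (rule op_algebra_diff[OF RA AR BR])
  have KR: "K \<in> R" unfolding K_def by (rule op_algebraD(4)[OF RA DR CR])
  have CDR: "C o\<^sub>L D \<in> R" by (rule op_algebraD(4)[OF RA CR DR])
  have symC: "sym_op C" unfolding C_def by (rule sym_op_cfc[OF B cont])
  have symG: "sym_op G" unfolding G_def by (rule sym_op_cfc[OF A cont])
  have symD: "sym_op D" unfolding D_def by (intro sym_op_diff between_sym[OF A] between_sym[OF B])
  have D': "D = (A + t *\<^sub>R id_blinfun) - (B + t *\<^sub>R id_blinfun)" by (simp add: D_def)
  note rA = cfc_resolvent[OF A t, folded G_def] and rB = cfc_resolvent[OF B t, folded C_def]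
  have CDG: "(C o\<^sub>L D) o\<^sub>L G = C - G"
    using rA rB by (simp only: D' blinfun_compose_diff blinfun_compose_id) (simp only: blinfun_compose_assoc blinfun_compose_id)
  have GDC: "G o\<^sub>L K = C - G"
    using rA rB unfolding K_def
    by (simp only: D' blinfun_compose_diff blinfun_compose_assoc[symmetric] blinfun_compose_id)
  have CK: "C o\<^sub>L K = C o\<^sub>L D o\<^sub>L C" by (simp add: K_def blinfun_compose_assoc)
  have main: "(C o\<^sub>L D) o\<^sub>L (G o\<^sub>L K) = (C o\<^sub>L D o\<^sub>L C) - C + G"
    unfolding GDC blinfun_compose_diff CDG by simp
  have PhiD: "\<Phi> D = 0"
    unfolding D_def by (simp add: expectation_diff[OF AR BR] expectation_fixed[OF BS]) (simp add: B_def)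
  have CDCR: "C o\<^sub>L D o\<^sub>L C \<in> R" by (rule op_algebraD(4)[OF RA CDR CR])
  have "\<tau> (C o\<^sub>L D o\<^sub>L C) = \<tau> (\<Phi> (C o\<^sub>L D o\<^sub>L C))"
    using pres CDCR by (simp add: preserves_on_def)
  also have "\<dots> = 0"
    by (simp add: expectation_module[OF DR CS CS] PhiD state_0[OF R tau])
  finally have zero: "\<tau> (C o\<^sub>L D o\<^sub>L C) = 0" .
  have diff: "Re (\<tau> ((C o\<^sub>L D) o\<^sub>L (G o\<^sub>L K))) = Re (\<tau> G) - Re (\<tau> C)"
    unfolding main
    by (simp add: state_add[OF R tau op_algebra_diff[OF RA CDCR CR] GR] state_diff[OF R tau CDCR CR] zero)
  \<comment> \<open>The least value of \<open>1 / (s + t)\<close> on \<open>{a..b}\<close>, so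
    \<open>G\<close> dominates \<open>k\<close>. The remainder then dominates \<open>k\<close> times
    \<open>adj K o\<^sub>L K\<close>, the expression to which faithfulness applies.\<close>
  define k where "k = 1 / (b + t)"
  have k: "0 < k" using A t by (simp add: k_def between_def)
  have adjK: "adj K = C o\<^sub>L D"
    unfolding K_def by (rule adj_compose_sym_op[OF Rb[OF DR] Rb[OF CR] symD symC])
  have KK: "(C o\<^sub>L D) o\<^sub>L K \<in> R" by (rule op_algebraD(4)[OF RA CDR KR])
  have form: "((C o\<^sub>L D) o\<^sub>L T) x \<bullet> y = T x \<bullet> K y" for T x y
    by (simp add: K_def sym_opD[OF symC] sym_opD[OF symD])
  have symT: "sym_op ((C o\<^sub>L D) o\<^sub>L (T o\<^sub>L K))" if "sym_op T" for T
    unfolding sym_op_def using form[of "T o\<^sub>L K"] sym_opD[OF that] by (simp add: inner_commute del: blinfun_apply_blinfun_compose) (simp add: inner_commute sym_opD[OF that])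
  have symKK: "sym_op ((C o\<^sub>L D) o\<^sub>L K)" using symT[OF sym_op_id] by simp
  have "k * (z \<bullet> z) \<le> G z \<bullet> z" for z
  proof -
    have "cfc a b (\<lambda>s. k) A z \<bullet> z \<le> G z \<bullet> z"
      unfolding G_def by (rule cfc_mono[OF A continuous_on_const cont]) (use t in \<open>auto simp: k_def frac_le\<close>)
    then show ?thesis by (simp add: cfc_const[OF A] blinfun.scaleR_left)
  qed
  then have "(k *\<^sub>R ((C o\<^sub>L D) o\<^sub>L K)) x \<bullet> x \<le> ((C o\<^sub>L D) o\<^sub>L (G o\<^sub>L K)) x \<bullet> x" for x
    unfolding blinfun.scaleR_left inner_scaleR_left form by simp
  then have "Re (\<tau> (k *\<^sub>R ((C o\<^sub>L D) o\<^sub>L K))) \<le> Re (\<tau> ((C o\<^sub>L D) o\<^sub>L (G o\<^sub>L K)))"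
    by (rule state_mono[OF R tau op_algebraD(3)[OF RA KK] sym_op_scaleR[OF symKK]
          op_algebraD(4)[OF RA CDR op_algebraD(4)[OF RA GR KR]] symT[OF symG]])
  then have key: "k * Re (\<tau> ((C o\<^sub>L D) o\<^sub>L K)) \<le> Re (\<tau> G) - Re (\<tau> C)"
    by (simp only: diff state_scaleR[OF R tau KK])
  have "positive_op ((C o\<^sub>L D) o\<^sub>L K)"
    by (simp only: positive_op_iff Rb[OF KK] symKK form) simp
  then have pos: "\<tau> ((C o\<^sub>L D) o\<^sub>L K) \<in> \<real>\<^sub>\<ge>\<^sub>0"
    by (rule state_nonneg_Reals[OF R tau KK])
  then have pos': "0 \<le> Re (\<tau> ((C o\<^sub>L D) o\<^sub>L K))" by (simp add: complex_nonneg_Reals_iff)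
  show "Re (\<tau> (cfc a b (\<lambda>s. 1 / (s + t)) (\<Phi> A))) \<le> Re (\<tau> (cfc a b (\<lambda>s. 1 / (s + t)) A))"
    using key mult_nonneg_nonneg[OF less_imp_le[OF k] pos'] by (simp add: G_def C_def B_def)
  assume "Re (\<tau> (cfc a b (\<lambda>s. 1 / (s + t)) (\<Phi> A))) = Re (\<tau> (cfc a b (\<lambda>s. 1 / (s + t)) A))"
  then have "k * Re (\<tau> ((C o\<^sub>L D) o\<^sub>L K)) \<le> 0"
    using key by (simp add: G_def C_def B_def)
  then have "Re (\<tau> ((C o\<^sub>L D) o\<^sub>L K)) = 0"
    using k pos' by (simp add: mult_le_0_iff)
  then have "\<tau> (adj K o\<^sub>L K) = 0"
    using pos by (simp add: adjK complex_nonneg_Reals_iff complex_eq_iff)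
  moreover have "\<forall>X\<in>R. \<tau> (adj X o\<^sub>L X) = 0 \<longrightarrow> X = 0"
    using tau unfolding faithful_normal_tracial_state_def by (elim conjE)
  ultimately have "K = 0" using KR by blast
  \<comment> \<open>Multiplying \<open>K\<close> on the right by the inverse of \<open>C\<close>
    leaves \<open>D\<close>.\<close>
  then have "D o\<^sub>L (C o\<^sub>L (B + t *\<^sub>R id_blinfun)) = 0"
    by (simp add: K_def flip: blinfun_compose_assoc)
  then have "D = 0" by (simp only: rB blinfun_compose_id)
  then show "\<Phi> A = A" by (simp add: D_def B_def)
qed

lemma expectation_log_trace:
  assumes AR: "A \<in> R" and A: "between a b A" and t: "0 < a + t"
  shows "Re (\<tau> (cfc a b (\<lambda>s. ln (s + t)) A)) \<le> Re (\<tau> (cfc a b (\<lambda>s. ln (s + t)) (\<Phi> A)))"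
    and "Re (\<tau> (cfc a b (\<lambda>s. ln (s + t)) A)) = Re (\<tau> (cfc a b (\<lambda>s. ln (s + t)) (\<Phi> A))) \<Longrightarrow> \<Phi> A = A"
proof -
  note BR = expectation_in(2)[OF AR] and B = expectation_between[OF AR A]
  define g where "g t = Re (\<tau> (cfc a b (\<lambda>s. ln (s + t)) (\<Phi> A))) - Re (\<tau> (cfc a b (\<lambda>s. ln (s + t)) A))" for t
  define g' where "g' t = Re (\<tau> (cfc a b (\<lambda>s. 1 / (s + t)) (\<Phi> A))) - Re (\<tau> (cfc a b (\<lambda>s. 1 / (s + t)) A))" for t
  have der: "(g has_real_derivative g' u) (at u)" if "0 < a + u" for u
    unfolding g_def g'_def
    by (intro DERIV_diff log_trace_DERIV[OF R tau] A AR B BR that)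
  have g'_le: "g' u \<le> 0" if "0 < a + u" for u
    using expectation_resolvent(1)[OF AR A that] by (simp add: g'_def)
  have dec: "g v \<le> g u" if "0 < a + u" "u \<le> v" for u v
  proof (rule DERIV_nonpos_imp_nonincreasing[OF that(2)])
    fix x assume "u \<le> x" "x \<le> v"
    then show "\<exists>y. (g has_real_derivative y) (at x) \<and> y \<le> 0"
      using that(1) der[of x] g'_le[of x] by (intro exI[of _ "g' x"]) simp
  qed
  have "((\<lambda>u. (Re (\<tau> (cfc a b (\<lambda>s. ln (s + u)) (\<Phi> A))) - ln u) - (Re (\<tau> (cfc a b (\<lambda>s. ln (s + u)) A)) - ln u)) \<longlongrightarrow> 0 - 0) at_top"
    by (intro tendsto_diff log_trace_at_top[OF R tau] A AR B BR)
  then have lim: "(g \<longlongrightarrow> 0) at_top" by (simp add: g_def[abs_def])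
  have nonneg: "0 \<le> g u" if u: "0 < a + u" for u
  proof (rule tendsto_upperbound[OF lim])
    show "\<forall>\<^sub>F v in at_top. g v \<le> g u"
      unfolding eventually_at_top_linorder using dec[OF u] by blast
  qed simp
  show "Re (\<tau> (cfc a b (\<lambda>s. ln (s + t)) A)) \<le> Re (\<tau> (cfc a b (\<lambda>s. ln (s + t)) (\<Phi> A)))"
    using nonneg[OF t] by (simp add: g_def)
  assume "Re (\<tau> (cfc a b (\<lambda>s. ln (s + t)) A)) = Re (\<tau> (cfc a b (\<lambda>s. ln (s + t)) (\<Phi> A)))"
  then have gt: "g t = 0" by (simp add: g_def)
  have zero: "g u = 0" if "t \<le> u" for u
    using dec[OF t that] nonneg[of u] gt t that by simp
  \<comment> \<open>At \<open>t + 1\<close> the function \<open>g\<close> vanishes in a whole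
    neighbourhood, so its derivative there is 0.\<close>
  have t1: "0 < a + (t + 1)" using t by simp
  have "\<forall>\<^sub>F u in nhds (t + 1). g u = 0"
    using eventually_nhds_in_open[of "{t<..}" "t + 1"] by (auto elim!: eventually_mono intro: zero)
  then have "((\<lambda>_. 0) has_real_derivative g' (t + 1)) (at (t + 1))"
    using der[OF t1] by (subst (asm) DERIV_cong_ev[OF refl _ refl]) auto
  then have "g' (t + 1) = 0"
    using DERIV_unique[OF _ DERIV_const] by blast
  then show "\<Phi> A = A"
    using expectation_resolvent(2)[OF AR A t1] by (simp add: g'_def)
qed

lemma FK_det_expectation_regular:
  assumes AR: "A \<in> R" and A: "between e M A" and e: "0 < e"
  shows "FK_det \<tau> A \<le> FK_det \<tau> (\<Phi> A)" "FK_det \<tau> A = FK_det \<tau> (\<Phi> A) \<longleftrightarrow> \<Phi> A = A"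
  using expectation_log_trace[OF AR A, of 0] e
    FK_det_regular(2)[OF R tau AR A e]
    FK_det_regular(2)[OF R tau expectation_in(2)[OF AR] expectation_between[OF AR A] e]
  by auto

lemma FK_det_expectation_inverse:
  assumes AR: "A \<in> R" and A: "between e M A" and e: "0 < e"
  shows "FK_det \<tau> (inv_op (\<Phi> (inv_op A))) \<le> FK_det \<tau> A"
    "FK_det \<tau> (inv_op (\<Phi> (inv_op A))) = FK_det \<tau> A \<longleftrightarrow> \<Phi> A = A"
proof -
  note RA = R_algebra[OF R tau] and SA = von_neumann_op_algebra(1)[OF S]
  note invA = FK_det_inverse[OF R tau AR A e]
  define I where "I = inv_op A"
  have IR: "I \<in> R" unfolding I_def by (rule invA(4)[OF RA AR])
  have M: "0 < 1 / M" using A e by (simp add: between_def)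
  have I: "between (1 / M) (1 / e) I" unfolding I_def by (rule invA(3))
  have invI: "inv_op I = A" unfolding I_def by (rule inv_op_eqI(2)[OF invA(2,1)])
  have pos: "0 < FK_det \<tau> A" "0 < FK_det \<tau> (\<Phi> I)" "0 < FK_det \<tau> I"
    by (simp_all add: FK_det_regular(2)[OF R tau AR A e] FK_det_regular(2)[OF R tau IR I M]
        FK_det_regular(2)[OF R tau expectation_in(2)[OF IR] expectation_between[OF IR I] M])
  have FI: "FK_det \<tau> I = 1 / FK_det \<tau> A" unfolding I_def by (rule invA(5))
  have FP: "FK_det \<tau> (inv_op (\<Phi> I)) = 1 / FK_det \<tau> (\<Phi> I)"
    by (rule FK_det_inverse(5)[OF R tau expectation_in(2)[OF IR] expectation_between[OF IR I] M])
  note ineq = FK_det_expectation_regular[OF IR I M]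
  show "FK_det \<tau> (inv_op (\<Phi> (inv_op A))) \<le> FK_det \<tau> A"
    using ineq(1) pos unfolding FP FI I_def[symmetric] by (simp add: field_simps)
  \<comment> \<open>Equality for the inverse means that the inverse lies in \<open>S\<close>;
    closure of \<open>S\<close> under inversion carries this over to \<open>A\<close>.\<close>
  have "I \<in> S \<longleftrightarrow> A \<in> S"
    using FK_det_inverse(4)[OF R tau IR I M SA] invA(4)[OF SA] unfolding I_def[symmetric] invI by blast
  then have "\<Phi> I = I \<longleftrightarrow> \<Phi> A = A"
    by (simp add: expectation_fixed_iff IR AR)
  moreover have "FK_det \<tau> (inv_op (\<Phi> I)) = FK_det \<tau> A \<longleftrightarrow> FK_det \<tau> I = FK_det \<tau> (\<Phi> I)"
    using pos unfolding FP FI by (auto simp: field_simps)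
  ultimately show "FK_det \<tau> (inv_op (\<Phi> (inv_op A))) = FK_det \<tau> A \<longleftrightarrow> \<Phi> A = A"
    using ineq(2) unfolding I_def[symmetric] by simp
qed

end

section \<open>Singular operators\<close>

text \<open>With an atom at 0 the integrals would fall below \<open>L\<close> as \<open>t\<close>
  tends to 0. Without it, \<open>- ln (s + t)\<close> increases to \<open>- ln s\<close> almost
  everywhere while its integrals stay below \<open>- L\<close>; monotone convergence then yields
  integrability along with the bound.\<close>

lemma stieltjes_log_limit:
  assumes F: "stieltjes 0 b 1 F"
    and L: "\<And>t. 0 < t \<Longrightarrow> L \<le> (\<integral>s. ln (s + t) \<partial>interval_measure F)"
  shows "AE s in interval_measure F. 0 < s" "integrable (interval_measure F) ln"
    "L \<le> (\<integral>s. ln s \<partial>interval_measure F)"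
proof -
  let ?N = "interval_measure F"
  interpret finite_measure ?N by (rule stieltjes_finite[OF F])
  define f where "f n s = ln (s + 1 / real (Suc n))" for n s
  have b: "0 \<le> b" using F by (simp add: stieltjes_def)
  have fm: "f n \<in> borel_measurable borel" for n unfolding f_def by measurable
  have fi: "integrable ?N (f n)" for n
  proof (rule stieltjes_integrable_continuous[OF F fm])
    have "s + 1 / real (Suc n) \<noteq> 0" if "s \<in> {0..b}" for s
      using that by (metis add_nonneg_pos atLeastAtMost_iff divide_pos_pos of_nat_0_less_iff order_less_irrefl zero_less_Suc zero_less_one)
    then show "continuous_on {0..b} (f n)" unfolding f_def by (intro continuous_intros) auto
  qed
  have Lf: "L \<le> (\<integral>s. f n s \<partial>?N)" for n unfolding f_def by (rule L) simp
  define K where "K = ln (b + 1)"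
  define m where "m = measure ?N {0}"
  \<comment> \<open>At 0 the value is exactly \<open>- ln (real (Suc n))\<close>; elsewhere
    monotonicity of \<open>ln\<close> gives \<open>K\<close>.\<close>
  have fK: "f n s \<le> K + indicator {0} s * (- ln (real (Suc n)) - K)" if "0 \<le> s" "s \<le> b" for n s
  proof (cases "s = 0")
    case True
    then show ?thesis by (simp add: f_def ln_div)
  next
    case False
    then have "0 < s + 1 / real (Suc n)" using that by (intro add_pos_nonneg) auto
    moreover have "1 / real (Suc n) \<le> 1" by simp
    then have "s + 1 / real (Suc n) \<le> b + 1" using that by linarith
    ultimately have "f n s \<le> K" unfolding f_def K_def by (simp only: ln_mono)
    then show ?thesis using False by simp
  qed
  have mass: "m * (ln (real (Suc n)) + K) \<le> K - L" for n
  proof -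
    have ind: "integrable ?N (\<lambda>s. indicator {0} s * k)" for k :: real
      using integrable_mult_indicator[of "{0}" ?N "\<lambda>_. k"] by simp
    have "L \<le> (\<integral>s. K + indicator {0} s * (- ln (real (Suc n)) - K) \<partial>?N)"
    proof (rule order_trans[OF Lf[of n] integral_mono_AE])
      show "AE s in ?N. f n s \<le> K + indicator {0} s * (- ln (real (Suc n)) - K)"
        using stieltjes_AE[OF F] by eventually_elim (rule fK; simp)
      show "integrable ?N (\<lambda>s. K + indicator {0} s * (- ln (real (Suc n)) - K))"
        by (intro Bochner_Integration.integrable_add ind) simp
    qed (rule fi)
    also have "\<dots> = K + m * (- ln (real (Suc n)) - K)"
      by (subst Bochner_Integration.integral_add[OF _ ind]) (simp_all add: stieltjes_total[OF F] m_def)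
    finally show ?thesis by (simp add: algebra_simps)
  qed
  \<comment> \<open>If \<open>m\<close> were positive, the left side of \<open>mass\<close> would
    grow without bound in \<open>n\<close>.\<close>
  have "m = 0"
  proof (rule ccontr)
    assume "m \<noteq> 0"
    then have m: "0 < m" by (simp add: m_def zero_less_measure_iff measure_nonneg less_le)
    obtain n :: nat where "exp ((K - L) / m - K) < real n" using reals_Archimedean2 by blast
    then have "exp ((K - L) / m - K) < real (Suc n)" by simp
    then have "(K - L) / m - K < ln (real (Suc n))"
      by (metis exp_gt_zero ln_exp ln_less_cancel_iff of_nat_0_less_iff zero_less_Suc)
    then have "(K - L) / m < ln (real (Suc n)) + K" by simp
    then have "K - L < m * (ln (real (Suc n)) + K)"
      using m by (simp add: pos_divide_less_eq mult.commute)
    then show False using mass[of n] by simp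
  qed
  then have "{0} \<in> null_sets ?N"
    by (auto simp: null_sets_def emeasure_eq_measure m_def)
  then have "AE s in ?N. s \<noteq> 0" by (rule AE_I') auto
  with stieltjes_AE[OF F] show pos: "AE s in ?N. 0 < s" by eventually_elim auto
  have f_dec: "f n s \<le> f k s" if "k \<le> n" "0 < s" for k n s
  proof -
    have "1 / real (Suc n) \<le> 1 / real (Suc k)" using that by (simp add: frac_le)
    moreover have "0 < s + 1 / real (Suc n)" using that by (intro add_pos_nonneg) auto
    ultimately show ?thesis unfolding f_def by (intro ln_mono) auto
  qed
  have "decseq (\<lambda>n. \<integral>s. f n s \<partial>?N)"
  proof (rule decseq_SucI, rule integral_mono_AE[OF fi fi])
    show "AE s in ?N. f (Suc n) s \<le> f n s" for n using pos by eventually_elim (rule f_dec; simp)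
  qed
  then obtain l where l: "(\<lambda>n. \<integral>s. f n s \<partial>?N) \<longlonglongrightarrow> l"
    using decseq_convergent[of _ L] Lf by blast
  have Ll: "L \<le> l" by (rule LIMSEQ_le_const[OF l]) (use Lf in blast)
  have i: "integrable ?N (\<lambda>s. - f n s)" for n using fi by simp
  have mono: "AE s in ?N. mono (\<lambda>n. - f n s)"
    using pos by eventually_elim (simp add: mono_def f_dec)
  have lim: "AE s in ?N. (\<lambda>n. - f n s) \<longlonglongrightarrow> - ln s"
    using pos
  proof eventually_elim
    case (elim s)
    have "(\<lambda>n. 1 / real (Suc n)) \<longlonglongrightarrow> 0"
      using LIMSEQ_inverse_real_of_nat by (simp add: inverse_eq_divide)
    then have "(\<lambda>n. ln (s + 1 / real (Suc n))) \<longlonglongrightarrow> ln (s + 0)"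
      using elim by (intro tendsto_intros) auto
    then show ?case unfolding f_def by (intro tendsto_minus) simp
  qed
  have ilim: "(\<lambda>n. \<integral>s. - f n s \<partial>?N) \<longlonglongrightarrow> - l"
    using tendsto_minus[OF l] by simp
  have meas: "(\<lambda>s. - ln s) \<in> borel_measurable ?N" by measurable
  have neg: "integrable ?N (\<lambda>s. - ln s)" "(\<integral>s. - ln s \<partial>?N) = - l"
    using integrable_monotone_convergence[OF i mono lim ilim meas]
      integral_monotone_convergence[OF i mono lim ilim meas] by auto
  from Bochner_Integration.integrable_minus[OF neg(1)] show "integrable ?N ln" by simp
  from neg(2) show "L \<le> (\<integral>s. ln s \<partial>?N)" using Ll by simp
qed

lemma FK_det_nonneg: "0 \<le> FK_det \<tau> A"
  by (simp add: FK_det_def)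

context
  fixes R S :: "'h::complex_hilbert operator set"
    and \<tau> :: "'h operator \<Rightarrow> complex"
    and \<Phi> :: "'h operator \<Rightarrow> 'h operator"
  assumes R: "von_neumann_algebra R" and tau: "faithful_normal_tracial_state R \<tau>"
    and S: "von_neumann_algebra S" and SR: "S \<subseteq> R"
    and Phi: "conditional_expectation R S \<Phi>" and pres: "preserves_on R \<tau> \<Phi>"
begin

text \<open>\<open>\<Phi> A\<close> may be regular although \<open>A\<close> is not, and the two
  branches of \<open>FK_det\<close> are defined differently. The shifted bound \<open>key\<close> is
  therefore carried to the limit separately in each.\<close>

lemma FK_det_expectation_singular:
  assumes AR: "A \<in> R" and pos: "positive_op A" and sing: "\<not> regular A"
    and AE: "AE s in trace_measure \<tau> A. 0 < s" and int: "integrable (trace_measure \<tau> A) ln"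
  shows "exp (\<integral>s. ln s \<partial>trace_measure \<tau> A) \<le> FK_det \<tau> (\<Phi> A)"
proof -
  note hyps = R tau S SR Phi pres
  define N where "N X = interval_measure (\<lambda>t. Re (\<tau> (spec_proj 0 (norm X) X t)))" for X
  define B where "B = \<Phi> A"
  define L where "L = (\<integral>s. ln s \<partial>trace_measure \<tau> A)"
  \<comment> \<open>The norms of \<open>A\<close> and \<open>B\<close> may differ, while
    \<open>expectation_log_trace\<close> compares the two on one interval.\<close>
  define M where "M = max (norm A) (norm B)"
  have BR: "B \<in> R" unfolding B_def by (rule expectation_in(2)[OF hyps AR])
  have posB: "positive_op B" unfolding B_def by (rule expectation_positive[OF hyps AR pos])
  have NA: "trace_measure \<tau> A = N A" unfolding N_def by (rule trace_measure_positive[OF R tau AR pos])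
  have NB: "trace_measure \<tau> B = N B" unfolding N_def by (rule trace_measure_positive[OF R tau BR posB])
  have lnc: "continuous_on {0..c} (\<lambda>s. ln (s + t))" if "0 < t" for t c :: real
    using that by (intro continuous_intros) auto
  have lnm: "(\<lambda>s. ln (s + t)) \<in> borel_measurable borel" for t :: real by measurable
  have log_int: "(\<integral>s. ln (s + t) \<partial>N X) = Re (\<tau> (cfc 0 M (\<lambda>s. ln (s + t)) X))"
    if X: "X \<in> R" "positive_op X" "norm X \<le> M" and t: "0 < t" for X t
  proof -
    note btw = positive_op_between[OF X(2)]
    have "(\<integral>s. ln (s + t) \<partial>N X) = Re (\<tau> (cfc 0 (norm X) (\<lambda>s. ln (s + t)) X))"
      unfolding N_def by (rule state_cfc[OF R tau btw X(1) lnm lnc[OF t]])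
    also have "cfc 0 (norm X) (\<lambda>s. ln (s + t)) X = cfc 0 M (\<lambda>s. ln (s + t)) X"
      by (rule cfc_interval[OF btw order_refl X(3) lnc[OF t]])
    finally show ?thesis .
  qed
  have AM: "between 0 M A" by (rule between_mono[OF positive_op_between[OF pos]]) (simp_all add: M_def)
  have key: "L \<le> (\<integral>s. ln (s + t) \<partial>N B)" if t: "0 < t" for t
  proof -
    have F: "stieltjes 0 (norm A) 1 (\<lambda>t. Re (\<tau> (spec_proj 0 (norm A) A t)))"
      by (rule state_spec_proj_stieltjes[OF R tau positive_op_between[OF pos] AR])
    have "L \<le> (\<integral>s. ln (s + t) \<partial>N A)"
      unfolding L_def NA
    proof (rule integral_mono_AE)
      show "integrable (N A) ln" using int by (simp add: NA)
      show "integrable (N A) (\<lambda>s. ln (s + t))"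
        unfolding N_def by (rule stieltjes_integrable_continuous[OF F lnm lnc[OF t]])
      \<comment> \<open>In HOL \<open>ln 0 = 0\<close>, so for \<open>t < 1\<close> the comparison
        fails at \<open>s = 0\<close>; the hypothesis \<open>AE\<close> excludes that point.\<close>
      show "AE s in N A. ln s \<le> ln (s + t)"
        using AE unfolding NA by eventually_elim (use t in simp)
    qed
    also have "\<dots> = Re (\<tau> (cfc 0 M (\<lambda>s. ln (s + t)) A))"
      by (rule log_int[OF AR pos _ t]) (simp add: M_def)
    also have "\<dots> \<le> Re (\<tau> (cfc 0 M (\<lambda>s. ln (s + t)) B))"
      unfolding B_def by (rule expectation_log_trace(1)[OF hyps AR AM]) (use t in simp)
    also have "\<dots> = (\<integral>s. ln (s + t) \<partial>N B)"
      by (rule log_int[OF BR posB _ t, symmetric]) (simp add: M_def)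
    finally show ?thesis .
  qed
  have "exp L \<le> FK_det \<tau> B"
  proof (cases "regular B")
    case True
    obtain e where e: "0 < e" "between e (norm B) B"
      using regular_positive_bounded_below[OF posB True id_nontrivial[OF R tau]] by blast
    have lne: "continuous_on {e..norm B} ln" using e(1) by (intro continuous_intros) auto
    \<comment> \<open>On \<open>[e, norm B]\<close> the shift changes \<open>ln\<close> by at most
      \<open>t / e\<close>, which vanishes with \<open>t\<close>.\<close>
    have "L - Re (\<tau> (cfc e (norm B) ln B)) \<le> t * (1 / e)" if t: "0 < t" for t
    proof -
      have lnt: "continuous_on {e..norm B} (\<lambda>s. ln (s + t))"
        by (rule continuous_on_subset[OF lnc[OF t]]) (use e in auto)
      have "cfc e (norm B) (\<lambda>s. ln (s + t)) B = cfc 0 M (\<lambda>s. ln (s + t)) B"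
        by (rule cfc_interval[OF e(2) _ _ lnc[OF t]]) (use e in \<open>simp_all add: M_def\<close>)
      then have 1: "L \<le> Re (\<tau> (cfc e (norm B) (\<lambda>s. ln (s + t)) B))"
        using key[OF t] log_int[OF BR posB _ t] by (simp add: M_def)
      have "norm (cfc e (norm B) (\<lambda>s. ln (s + t) - ln s) B) \<le> t * (1 / e)"
      proof (rule cfc_norm_le[OF e(2) continuous_on_diff[OF lnt lne]])
        fix s assume s: "e \<le> s"
        have "ln (s + t) - ln s = ln (1 + t / s)"
          by (rule ln_one_plus_ratio[symmetric]) (use s e t in auto)
        also have "\<dots> \<le> t / s" by (rule ln_add_one_self_le_self) (use s e t in simp)
        also have "\<dots> \<le> t * (1 / e)" using s e t by (simp add: frac_le)
        finally have "ln (s + t) - ln s \<le> t * (1 / e)" .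
        moreover have "ln s \<le> ln (s + t)" using s e t by simp
        ultimately show "\<bar>ln (s + t) - ln s\<bar> \<le> t * (1 / e)" by simp
      qed
      then have "norm (cfc e (norm B) (\<lambda>s. ln (s + t)) B - cfc e (norm B) ln B) \<le> t * (1 / e)"
        by (simp only: cfc_diff[OF e(2) lnt lne])
      then have "\<bar>Re (\<tau> (cfc e (norm B) (\<lambda>s. ln (s + t)) B)) - Re (\<tau> (cfc e (norm B) ln B))\<bar> \<le> t * (1 / e)"
        by (rule state_close[OF R tau cfc_R[OF R tau e(2) BR lnt] cfc_R[OF R tau e(2) BR lne]
              sym_op_cfc[OF e(2) lnt] sym_op_cfc[OF e(2) lne]])
      then show ?thesis using 1 by linarith
    qed
    from nonpos_if_le_scaled[OF this] show ?thesis
      by (simp add: FK_det_regular(2)[OF R tau BR e(2) e(1)])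
  next
    case False
    have F: "stieltjes 0 (norm B) 1 (\<lambda>t. Re (\<tau> (spec_proj 0 (norm B) B t)))"
      by (rule state_spec_proj_stieltjes[OF R tau positive_op_between[OF posB] BR])
    note lim = stieltjes_log_limit[OF F key[unfolded N_def], folded N_def]
    show ?thesis
      unfolding FK_det_def abs_op_positive[OF posB] NB using lim False by simp
  qed
  then show ?thesis by (simp add: L_def B_def)
qed

lemma FK_det_expectation:
  assumes AR: "A \<in> R" and pos: "positive_op A"
  shows "FK_det \<tau> A \<le> FK_det \<tau> (\<Phi> A)"
proof (cases "regular A")
  case True
  then obtain e where "0 < e" "between e (norm A) A"
    using regular_positive_bounded_below[OF pos _ id_nontrivial[OF R tau]] by blast
  then show ?thesis using FK_det_expectation_regular(1)[OF R tau S SR Phi pres AR] by blast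
next
  case False
  \<comment> \<open>Either \<open>FK_det \<tau> A\<close> is 0, or the two conditions of the
    singular branch hold.\<close>
  then show ?thesis
    using FK_det_expectation_singular[OF AR pos False] FK_det_nonneg[of \<tau> "\<Phi> A"]
    unfolding FK_det_def[of \<tau> A] abs_op_positive[OF pos] by simp
qed

end

theorem theorem4p1:
  fixes R S :: "'h::complex_hilbert operator set"
    and \<tau> :: "'h operator \<Rightarrow> complex"
    and \<Phi> :: "'h operator \<Rightarrow> 'h operator"
  assumes "separable_space (euclidean :: 'h topology)"
    and "finite_von_neumann_algebra R"
    and "faithful_normal_tracial_state R \<tau>"
    and "von_neumann_algebra S" and "S \<subseteq> R"
    and "conditional_expectation R S \<Phi>" and "\<Phi> ` R = S"
    and "preserves_on R \<tau> \<Phi>"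
  shows "(\<forall>A\<in>R. positive_op A \<and> regular A \<longrightarrow>
            FK_det \<tau> (inv_op (\<Phi> (inv_op A))) \<le> FK_det \<tau> A \<and>
            FK_det \<tau> A \<le> FK_det \<tau> (\<Phi> A) \<and>
            (FK_det \<tau> (inv_op (\<Phi> (inv_op A))) = FK_det \<tau> A \<longleftrightarrow> \<Phi> A = A) \<and>
            (FK_det \<tau> A = FK_det \<tau> (\<Phi> A) \<longleftrightarrow> \<Phi> A = A) \<and>
            (\<Phi> A = A \<longleftrightarrow> A \<in> S)) \<and>
         (\<forall>A\<in>R. positive_op A \<longrightarrow> FK_det \<tau> A \<le> FK_det \<tau> (\<Phi> A))"
proof -
  have R: "von_neumann_algebra R"
    using assms(2) unfolding finite_von_neumann_algebra_def by (rule conjunct1)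
  note hyps = R assms(3,4,5,6,8)
  show ?thesis
  proof (intro conjI ballI impI; (elim conjE)?)
    fix A assume AR: "A \<in> R" and "positive_op A" "regular A"
    then obtain e where e: "0 < e" "between e (norm A) A"
      using regular_positive_bounded_below[OF _ _ id_nontrivial[OF R assms(3)]] by blast
    show "FK_det \<tau> (inv_op (\<Phi> (inv_op A))) \<le> FK_det \<tau> A"
      "FK_det \<tau> (inv_op (\<Phi> (inv_op A))) = FK_det \<tau> A \<longleftrightarrow> \<Phi> A = A"
      by (rule FK_det_expectation_inverse[OF hyps AR e(2,1)])+
    show "FK_det \<tau> A \<le> FK_det \<tau> (\<Phi> A)" "FK_det \<tau> A = FK_det \<tau> (\<Phi> A) \<longleftrightarrow> \<Phi> A = A"
      by (rule FK_det_expectation_regular[OF hyps AR e(2,1)])+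
    show "\<Phi> A = A \<longleftrightarrow> A \<in> S" by (rule expectation_fixed_iff[OF hyps AR])
  next
    fix A assume "A \<in> R" "positive_op A"
    then show "FK_det \<tau> A \<le> FK_det \<tau> (\<Phi> A)" by (rule FK_det_expectation[OF hyps])
  qed
qed

end
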